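(* Assume that $f$ is $\mu$-quasi strongly convex, $\mu\ge0$, and the functions $f_{ij}$ are convex and $L$-smooth for all $i\in\{1,\dots,n\}$, $j\in\{1,\dots,m\}$. Consider EC-LSVRG with $p\in(0,1)$ and $$0<\gamma\le\min\left\{\frac1{24L},\ \frac{\delta}{8L\sqrt{3\left(2+3\delta\left(2+\frac1{1-p}\right)\right)}}\right\}.$$ Then EC-LSVRG satisfies the parametric assumption of the context with $A=2L$, $\widetilde A=12L$, $A'=2L$, $B_1=\widetilde B_1=B_1'=B_2=0$, $D_1=\frac2n\sum_{i=1}^n\|\nabla f_i(x^* )\|^2$, $D_1'=\widetilde D_1=0$, $\widetilde B_2=3$, $B_2'=2$, $\sigma_{1,k}^2\equiv0$, $C_1=0$, $\sigma_{2,k}^2=\sigma_k^2=\frac1{nm}\sum_{i=1}^n\sum_{j=1}^m\|\nabla f_{ij}(w_i^k)-\nabla f_{ij}(x^* )\|^2$, $\rho_1=1$, $\rho_2=p$, $C_2=Lp$, $D_2=0$, $G=0$, $F_1=0$, $$F_2=\frac{72L\gamma^2}{\delta p\left(1-\min\{\frac{\gamma\mu}2,\frac p4\}\right)},\qquad D_3=\frac{12L\gamma}{\delta^2}D_1.$$ Moreover, with $M_2=\frac4p$ and $T^0=\|x^0-x^*\|^2+M_2\gamma^2\sigma_0^2$, for all $K\ge0$ $$\mathbf E[f(\bar x^K)-f(x^* )]\le\left(1-\min\left\{\frac{\gamma\mu}2,\frac p4\right\}\right)^K\frac{4(T^0+\gamma F_2\sigma_0^2)}\gamma+\frac{48L\gamma^2}{\delta^2}D_1$$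 when $\mu>0$, and $$\mathbf E[f(\bar x^K)-f(x^* )]\le\frac{4(T^0+\gamma F_2\sigma_0^2)}{\gamma K}+\frac{48L\gamma^2}{\delta^2}D_1$$ when $\mu=0$ (right-hand side read as $+\infty$ for $K=0$).
   Context: $f(x)=\frac1n\sum_{i=1}^nf_i(x)$, $f_i(x)=\frac1m\sum_{j=1}^mf_{ij}(x)$ on $\mathbb R^d$. A function is $L$-smooth if it is differentiable with $L$-Lipschitz gradient. $f$ is $\mu$-quasi strongly convex if it has a unique minimizer $x^*$ and $f(x^* )\ge f(x)+\langle\nabla f(x),x^*-x\rangle+\frac\mu2\|x-x^*\|^2$ for all $x$. $\mathcal C$ is a (possibly randomized) compression operator with $\mathbf E\|\mathcal C(x)-x\|^2\le(1-\delta)\|x\|^2$ for all $x$, $\delta\in(0,1]$. All random choices use fresh independent randomness. EC-LSVRG: given deterministic $x^0,w_i^0\in\mathbb R^d$, $e_i^0=0$; at iteration $k\ge0$ each worker $i$ picks $l$ uniformly from $\{1,\dots,m\}$, sets $g_i^k=\nabla f_{il}(x^k)-\nabla f_{il}(w_i^k)+\nabla f_i(w_i^k)$, $v_i^k=\mathcal C(e_i^k+\gamma g_i^k)$, $e_i^{k+1}=e_i^k+\gamma g_i^k-v_i^k$, and $w_i^{k+1}=x^k$ with probability $p$, $w_i^{k+1}=w_i^k$ with probability $1-p$; then $x^{k+1}=x^k-\frac1n\sum_iv_i^k$. Parametric assumption: let $g^k=\frac1n\sum_ig_i^k$, $e^k=\frac1n\sum_ie_i^k$, $\mathbf E_k$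 the conditional expectation given all randomness generated before iteration $k$, $\bar g_i^k=\mathbf E_k[g_i^k]$. For all $k,K\ge0$: $\mathbf E_k[g^k]=\nabla f(x^k)$; $\frac1n\sum_i\|\bar g_i^k\|^2\le2A(f(x^k)-f(x^* ))+B_1\sigma_{1,k}^2+B_2\sigma_{2,k}^2+D_1$; $\frac1n\sum_i\mathbf E_k\|g_i^k-\bar g_i^k\|^2\le2\widetilde A(f(x^k)-f(x^* ))+\widetilde B_1\sigma_{1,k}^2+\widetilde B_2\sigma_{2,k}^2+\widetilde D_1$; $\mathbf E_k\|g^k\|^2\le2A'(f(x^k)-f(x^* ))+B_1'\sigma_{1,k}^2+B_2'\sigma_{2,k}^2+D_1'$; $\mathbf E_k[\sigma_{1,k+1}^2]\le(1-\rho_1)\sigma_{1,k}^2+2C_1(f(x^k)-f(x^* ))+G\rho_1\sigma_{2,k}^2+D_2$; $\mathbf E_k[\sigma_{2,k+1}^2]\le(1-\rho_2)\sigma_{2,k}^2+2C_2(f(x^k)-f(x^* ))$; $3L\sum_{k=0}^Kw_k\mathbf E\|e^k\|^2\le\frac14\sum_{k=0}^Kw_k\mathbf E[f(x^k)-f(x^* )]+F_1\sigma_{1,0}^2+F_2\sigma_{2,0}^2+\gamma D_3W_K$, where (scalar weights) $w_k=(1-\eta)^{-(k+1)}$, $W_K=\sum_{k=0}^Kw_k$, $\eta=\min\{\frac{\gamma\mu}2,\frac{\rho_1}4,\frac{\rho_2}4\}$. Also $\bar x^K=\frac1{W_K}\sum_{k=0}^Kw_kx^k$. *)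

theory Defs
  imports "HOL-Probability.Probability"
begin

definition grad :: "('a::real_inner \<Rightarrow> real) \<Rightarrow> 'a \<Rightarrow> 'a" where
  "grad h x = (THE D. GDERIV h x :> D)"

definition L_smooth :: "real \<Rightarrow> ('a::euclidean_space \<Rightarrow> real) \<Rightarrow> bool" where
  "L_smooth L h \<longleftrightarrow> (\<forall>x. h differentiable (at x)) \<and> L-lipschitz_on UNIV (grad h)"

definition unique_minimizer :: "('a \<Rightarrow> real) \<Rightarrow> 'a \<Rightarrow> bool" where
  "unique_minimizer h xs \<longleftrightarrow> (\<forall>y. h xs \<le> h y) \<and> (\<forall>z. (\<forall>y. h z \<le> h y) \<longrightarrow> z = xs)"

definition quasi_strongly_convex ::
    "real \<Rightarrow> ('a::euclidean_space \<Rightarrow> real) \<Rightarrow> 'a \<Rightarrow> bool" where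
  "quasi_strongly_convex \<mu> h xs \<longleftrightarrow> unique_minimizer h xs \<and>
     (\<forall>x. h xs \<ge> h x + grad h x \<bullet> (xs - x) + \<mu> / 2 * (norm (x - xs))\<^sup>2)"

definition f_loc :: "nat \<Rightarrow> (nat \<Rightarrow> nat \<Rightarrow> 'a \<Rightarrow> real) \<Rightarrow> nat \<Rightarrow> 'a \<Rightarrow> real" where
  "f_loc m fs i x = (\<Sum>j=1..m. fs i j x) / real m"

definition f_glob :: "nat \<Rightarrow> nat \<Rightarrow> (nat \<Rightarrow> nat \<Rightarrow> 'a \<Rightarrow> real) \<Rightarrow> 'a \<Rightarrow> real" where
  "f_glob n m fs x = (\<Sum>i=1..n. f_loc m fs i x) / real n"

definition avg :: "nat \<Rightarrow> (nat \<Rightarrow> 'b::real_vector) \<Rightarrow> 'b" where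
  "avg n u = (1 / real n) *\<^sub>R (\<Sum>i=1..n. u i)"

text \<open>A randomized operator is a jointly measurable map that receives, besides its argument, a
  random seed with law \<open>S\<close>. The non-negative integral makes the second moment meaningful without
  a separate integrability requirement. A deterministic operator ignores the seed.\<close>

definition compression_operator ::
    "'s measure \<Rightarrow> real \<Rightarrow> ('s \<Rightarrow> 'a::euclidean_space \<Rightarrow> 'a) \<Rightarrow> bool" where
  "compression_operator S \<delta> C \<longleftrightarrow>
     prob_space S \<and> 0 < \<delta> \<and> \<delta> \<le> 1 \<and>
     (\<lambda>(s, x). C s x) \<in> borel_measurable (S \<Otimes>\<^sub>M borel) \<and>
     (\<forall>x. (\<integral>\<^sup>+ s. ennreal ((norm (C s x - x))\<^sup>2) \<partial>S) \<le> ennreal ((1 - \<delta>) * (norm x)\<^sup>2))"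

text \<open>In one iteration one worker draws an index, a compression seed and a coin, independently
  of each other. The space of \<open>uniform_count_measure {1..m}\<close> is \<open>{1..m}\<close>, so a measurable draw never
  yields an index outside this range, not even on a null set.\<close>

definition draw_law :: "'s measure \<Rightarrow> nat \<Rightarrow> real \<Rightarrow> (nat \<times> 's \<times> bool) measure" where
  "draw_law S m p =
     uniform_count_measure {1..m} \<Otimes>\<^sub>M (S \<Otimes>\<^sub>M measure_pmf (bernoulli_pmf p))"

text \<open>\<open>Z k i\<close> is the draw of worker \<open>i\<close> in iteration \<open>k\<close>.\<close>

definition fresh_draws ::
    "'w measure \<Rightarrow> 's measure \<Rightarrow> nat \<Rightarrow> nat \<Rightarrow> real \<Rightarrow>
      (nat \<Rightarrow> nat \<Rightarrow> 'w \<Rightarrow> nat \<times> 's \<times> bool) \<Rightarrow> bool" where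
  "fresh_draws M S n m p Z \<longleftrightarrow>
     prob_space M \<and>
     prob_space.indep_vars M (\<lambda>_. draw_law S m p) (\<lambda>(k, i). Z k i) (UNIV \<times> {1..n}) \<and>
     (\<forall>k. \<forall>i\<in>{1..n}. distr M (draw_law S m p) (Z k i) = draw_law S m p)"

text \<open>The \<open>\<sigma>\<close>-algebra generated by all draws of the iterations before \<open>k\<close>.\<close>

definition history ::
    "'w measure \<Rightarrow> 's measure \<Rightarrow> nat \<Rightarrow> nat \<Rightarrow> real \<Rightarrow>
      (nat \<Rightarrow> nat \<Rightarrow> 'w \<Rightarrow> nat \<times> 's \<times> bool) \<Rightarrow> nat \<Rightarrow> 'w measure" where
  "history M S n m p Z k = sigma (space M)
     {Z j i -` U \<inter> space M | j i U. j < k \<and> i \<in> {1..n} \<and> U \<in> sets (draw_law S m p)}"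

text \<open>The library has conditional expectations of real variables only; vectors are treated
  coordinatewise.\<close>

definition vec_cond_exp ::
    "'w measure \<Rightarrow> 'w measure \<Rightarrow> ('w \<Rightarrow> 'a::euclidean_space) \<Rightarrow> 'w \<Rightarrow> 'a" where
  "vec_cond_exp M F X \<omega> = (\<Sum>b\<in>Basis. real_cond_exp M F (\<lambda>\<omega>'. X \<omega>' \<bullet> b) \<omega> *\<^sub>R b)"

text \<open>The processes \<open>x\<close>, \<open>w\<close>, \<open>e\<close>, \<open>g\<close>, \<open>v\<close> are the iterates of EC-LSVRG driven by the draws \<open>Z\<close>.
  Arguments: iteration, then worker (except for \<open>x\<close>), then outcome.\<close>

definition ec_lsvrg ::
    "'w measure \<Rightarrow> nat \<Rightarrow> nat \<Rightarrow> (nat \<Rightarrow> nat \<Rightarrow> 'a::euclidean_space \<Rightarrow> real) \<Rightarrow>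
      ('s \<Rightarrow> 'a \<Rightarrow> 'a) \<Rightarrow> real \<Rightarrow> 'a \<Rightarrow> (nat \<Rightarrow> 'a) \<Rightarrow>
      (nat \<Rightarrow> nat \<Rightarrow> 'w \<Rightarrow> nat \<times> 's \<times> bool) \<Rightarrow>
      (nat \<Rightarrow> 'w \<Rightarrow> 'a) \<Rightarrow> (nat \<Rightarrow> nat \<Rightarrow> 'w \<Rightarrow> 'a) \<Rightarrow> (nat \<Rightarrow> nat \<Rightarrow> 'w \<Rightarrow> 'a) \<Rightarrow>
      (nat \<Rightarrow> nat \<Rightarrow> 'w \<Rightarrow> 'a) \<Rightarrow> (nat \<Rightarrow> nat \<Rightarrow> 'w \<Rightarrow> 'a) \<Rightarrow> bool" where
  "ec_lsvrg M n m fs C \<gamma> x0 w0 Z x w e g v \<longleftrightarrow>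
     (\<forall>\<omega>\<in>space M.
        x 0 \<omega> = x0 \<and>
        (\<forall>i\<in>{1..n}. w 0 i \<omega> = w0 i \<and> e 0 i \<omega> = 0) \<and>
        (\<forall>k.
          (\<forall>i\<in>{1..n}. case Z k i \<omega> of (l, s, coin) \<Rightarrow>
             g k i \<omega> = grad (fs i l) (x k \<omega>) - grad (fs i l) (w k i \<omega>)
                        + grad (f_loc m fs i) (w k i \<omega>) \<and>
             v k i \<omega> = C s (e k i \<omega> + \<gamma> *\<^sub>R g k i \<omega>) \<and>
             e (Suc k) i \<omega> = e k i \<omega> + \<gamma> *\<^sub>R g k i \<omega> - v k i \<omega> \<and>
             w (Suc k) i \<omega> = (if coin then x k \<omega> else w k i \<omega>)) \<and>
          x (Suc k) \<omega> = x k \<omega> - avg n (\<lambda>i. v k i \<omega>)))"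

definition sigma_sq ::
    "nat \<Rightarrow> nat \<Rightarrow> (nat \<Rightarrow> nat \<Rightarrow> 'a::euclidean_space \<Rightarrow> real) \<Rightarrow> 'a \<Rightarrow> (nat \<Rightarrow> 'a) \<Rightarrow> real" where
  "sigma_sq n m fs xs u =
     (\<Sum>i=1..n. \<Sum>j=1..m. (norm (grad (fs i j) (u i) - grad (fs i j) xs))\<^sup>2) / (real n * real m)"

text \<open>The fields ending in \<open>t\<close> carry a tilde on paper, those ending in \<open>p\<close> a prime.\<close>

record ec_constants =
  cA :: real   cAt :: real   cAp :: real
  cB1 :: real  cB1t :: real  cB1p :: real
  cB2 :: real  cB2t :: real  cB2p :: real
  cC1 :: real  cC2 :: real
  cD1 :: real  cD1t :: real  cD1p :: real
  cD2 :: real  cD3 :: real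
  cF1 :: real  cF2 :: real
  cG :: real
  rho1 :: real rho2 :: real

definition rate :: "real \<Rightarrow> real \<Rightarrow> ec_constants \<Rightarrow> real" where
  "rate \<gamma> \<mu> c = min (\<gamma> * \<mu> / 2) (min (rho1 c / 4) (rho2 c / 4))"

definition weight :: "real \<Rightarrow> nat \<Rightarrow> real" where
  "weight \<eta> k = 1 / (1 - \<eta>) ^ (k + 1)"

definition weight_sum :: "real \<Rightarrow> nat \<Rightarrow> real" where
  "weight_sum \<eta> K = (\<Sum>k=0..K. weight \<eta> k)"

definition weighted_avg :: "real \<Rightarrow> (nat \<Rightarrow> 'a::real_vector) \<Rightarrow> nat \<Rightarrow> 'a" where
  "weighted_avg \<eta> u K = (1 / weight_sum \<eta> K) *\<^sub>R (\<Sum>k=0..K. weight \<eta> k *\<^sub>R u k)"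

text \<open>\<open>F k\<close> is the history before iteration \<open>k\<close>; \<open>sig1\<close> and \<open>sig2\<close> are the processes
  \<open>\<sigma>\<^sub>1\<^sup>2\<close> and \<open>\<sigma>\<^sub>2\<^sup>2\<close> (already squared). The integrability clauses say that all the expectations
  occurring in the inequalities exist; they are needed because the Bochner integral and
  \<open>real_cond_exp\<close> return junk values for functions that are not integrable.\<close>

definition parametric_assumption ::
    "'w measure \<Rightarrow> (nat \<Rightarrow> 'w measure) \<Rightarrow> nat \<Rightarrow> ('a::euclidean_space \<Rightarrow> real) \<Rightarrow> 'a \<Rightarrow>
      real \<Rightarrow> real \<Rightarrow> real \<Rightarrow>
      (nat \<Rightarrow> 'w \<Rightarrow> 'a) \<Rightarrow> (nat \<Rightarrow> nat \<Rightarrow> 'w \<Rightarrow> 'a) \<Rightarrow> (nat \<Rightarrow> nat \<Rightarrow> 'w \<Rightarrow> 'a) \<Rightarrow>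
      (nat \<Rightarrow> 'w \<Rightarrow> real) \<Rightarrow> (nat \<Rightarrow> 'w \<Rightarrow> real) \<Rightarrow> ec_constants \<Rightarrow> bool" where
  "parametric_assumption M F n f xs L \<mu> \<gamma> x g e sig1 sig2 c \<longleftrightarrow>
    (let gbar = (\<lambda>k i. vec_cond_exp M (F k) (g k i));
         gk = (\<lambda>k \<omega>. avg n (\<lambda>i. g k i \<omega>));
         ek = (\<lambda>k \<omega>. avg n (\<lambda>i. e k i \<omega>));
         gap = (\<lambda>k \<omega>. f (x k \<omega>) - f xs);
         \<eta> = rate \<gamma> \<mu> c
     in
      (\<forall>k. (\<forall>i\<in>{1..n}. integrable M (g k i) \<and>
                          integrable M (\<lambda>\<omega>. (norm (g k i \<omega> - gbar k i \<omega>))\<^sup>2)) \<and>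
           integrable M (\<lambda>\<omega>. (norm (gk k \<omega>))\<^sup>2) \<and>
           integrable M (\<lambda>\<omega>. (norm (ek k \<omega>))\<^sup>2) \<and>
           integrable M (gap k) \<and> integrable M (sig1 k) \<and> integrable M (sig2 k)) \<and>
      (\<forall>k. AE \<omega> in M. vec_cond_exp M (F k) (gk k) \<omega> = grad f (x k \<omega>)) \<and>
      (\<forall>k. AE \<omega> in M.
         avg n (\<lambda>i. (norm (gbar k i \<omega>))\<^sup>2)
           \<le> 2 * cA c * gap k \<omega> + cB1 c * sig1 k \<omega> + cB2 c * sig2 k \<omega> + cD1 c) \<and>
      (\<forall>k. AE \<omega> in M.
         avg n (\<lambda>i. real_cond_exp M (F k) (\<lambda>\<omega>'. (norm (g k i \<omega>' - gbar k i \<omega>'))\<^sup>2) \<omega>)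
           \<le> 2 * cAt c * gap k \<omega> + cB1t c * sig1 k \<omega> + cB2t c * sig2 k \<omega> + cD1t c) \<and>
      (\<forall>k. AE \<omega> in M.
         real_cond_exp M (F k) (\<lambda>\<omega>'. (norm (gk k \<omega>'))\<^sup>2) \<omega>
           \<le> 2 * cAp c * gap k \<omega> + cB1p c * sig1 k \<omega> + cB2p c * sig2 k \<omega> + cD1p c) \<and>
      (\<forall>k. AE \<omega> in M.
         real_cond_exp M (F k) (sig1 (Suc k)) \<omega>
           \<le> (1 - rho1 c) * sig1 k \<omega> + 2 * cC1 c * gap k \<omega> + cG c * rho1 c * sig2 k \<omega> + cD2 c) \<and>
      (\<forall>k. AE \<omega> in M.
         real_cond_exp M (F k) (sig2 (Suc k)) \<omega>
           \<le> (1 - rho2 c) * sig2 k \<omega> + 2 * cC2 c * gap k \<omega>) \<and>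
      (\<forall>K. AE \<omega> in M.
         3 * L * (\<Sum>k=0..K. weight \<eta> k * (\<integral>\<omega>'. (norm (ek k \<omega>'))\<^sup>2 \<partial>M))
           \<le> 1 / 4 * (\<Sum>k=0..K. weight \<eta> k * (\<integral>\<omega>'. gap k \<omega>' \<partial>M))
              + cF1 c * sig1 0 \<omega> + cF2 c * sig2 0 \<omega> + \<gamma> * cD3 c * weight_sum \<eta> K))"

end

theory Submission
  imports Defs
begin

text \<open>
  Error feedback is harmless because of the \<^emph>\<open>virtual iterate\<close> \<open>x\<^sup>k - e\<^sup>k\<close>, where \<open>e\<^sup>k\<close> is the mean of
  the errors that the workers keep back. The compressed messages cancel in it
  (\<open>virtual_iterate_Suc\<close>), so it performs plain SGD steps \<open>-\<gamma> g\<^sup>k\<close>, except that the gradient is taken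
  at \<open>x\<^sup>k\<close> instead of \<open>x\<^sup>k - e\<^sup>k\<close>. The price for this displacement is a term \<open>3 L \<gamma> \<bar>e\<^sup>k\<bar>\<^sup>2\<close> in each
  step. The rest of the proof controls three quantities: the noise of \<open>g\<^sup>k\<close>, the error and the
  distance to the solution.

  \<^emph>\<open>Noise.\<close> For convex and \<open>L\<close>-smooth \<open>h\<close>, \<open>\<bar>\<nabla>h(x) - \<nabla>h(y)\<bar>\<^sup>2\<close> is at most \<open>2L\<close> times the gap between
  \<open>h(x)\<close> and the tangent of \<open>h\<close> at \<open>y\<close> (\<open>smooth_convex_gradient_gap\<close>). Averaged over all \<open>f\<^sub>i\<^sub>j\<close> with
  \<open>y\<close> the minimizer of \<open>f\<close>, the linear terms cancel (\<open>mean_gradient_gap\<close>). Every gradient estimate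
  reduces to this one by splitting the estimator into differences to the gradients at the solution:
  one part is bounded by the function gap, the other by \<open>\<sigma>\<^sup>2\<close> (\<open>mean_svrg_shifted_le\<close>,
  \<open>mean_svrg_variance_le\<close>). The coin replaces a fraction \<open>p\<close> of \<open>\<sigma>\<^sup>2\<close> by at most \<open>2Lp\<close> times the function gap
  (\<open>cond_exp_sig_le\<close>).

  \<^emph>\<open>Error.\<close> One compression contracts the mean squared error by \<open>1 - \<delta>/2\<close> and adds terms of order
  \<open>\<gamma>\<^sup>2\<close> (\<open>error_one_step\<close>, \<open>err_mean_Suc\<close>). Summed with the weights \<open>w\<^sub>k\<close>, whose growth rate \<open>\<eta>\<close>
  is at most \<open>\<delta>/10\<close> and \<open>p/4\<close>, the recursions for the error and for \<open>\<sigma>\<^sup>2\<close> bound the total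
  error by a quarter of the total function gap plus constants (\<open>weighted_error\<close>).

  \<^emph>\<open>Distance.\<close> The squared distance of the virtual iterate to the solution plus \<open>4\<gamma>\<^sup>2/p\<close> times \<open>\<sigma>\<^sup>2\<close>
  decreases by the factor \<open>1 - \<eta>\<close> and additionally by \<open>\<gamma>/2\<close> times the function gap, up to the price for
  the displacement (\<open>lyapunov_one_step\<close>). Summation and the bound for the total error leave
  \<open>\<gamma>/4\<close> times the weighted sum of the gaps on the left (\<open>weighted_gap\<close>), and convexity carries
  this over to the averaged iterate.

  The conditional expectations are computed with one principle: what is known before iteration \<open>k\<close> is
  independent of the draws of iteration \<open>k\<close>, so these are integrated out with the past held fixed
  (\<open>cond_exp_fresh\<close>). Integrability of all quantities comes from square integrability of the state,
  which is preserved by every iteration (\<open>regular_state\<close>).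
\<close>

section \<open>Gradients and smooth convex functions\<close>

lemma GDERIV_grad:
  fixes h :: "'a::euclidean_space \<Rightarrow> real"
  assumes "h differentiable (at x)"
  shows "GDERIV h x :> grad h x"
proof -
  obtain h' where h': "(h has_derivative h') (at x)"
    using assms by (auto simp: differentiable_def)
  interpret linear h' using h' by (rule has_derivative_linear)
  have "h' u = inner u (\<Sum>b\<in>Basis. h' b *\<^sub>R b)" for u
  proof -
    have "h' u = h' (\<Sum>b\<in>Basis. (u \<bullet> b) *\<^sub>R b)" by (simp add: euclidean_representation)
    also have "\<dots> = (\<Sum>b\<in>Basis. (u \<bullet> b) * h' b)" by (simp add: sum scale)
    finally show ?thesis by (simp add: inner_sum_right mult.commute)
  qed
  then have "h' = (\<lambda>u. inner u (\<Sum>b\<in>Basis. h' b *\<^sub>R b))" by blast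
  then have D: "GDERIV h x :> (\<Sum>b\<in>Basis. h' b *\<^sub>R b)"
    using h' by (simp add: gderiv_def)
  have "D1 = D2" if "GDERIV h x :> D1" "GDERIV h x :> D2" for D1 D2 :: 'a
  proof -
    have "(\<lambda>u. inner u D1) = (\<lambda>u. inner u D2)"
      using that unfolding gderiv_def by (rule has_derivative_unique)
    then have "inner (D1 - D2) D1 = inner (D1 - D2) D2" by metis
    then have "inner (D1 - D2) (D1 - D2) = 0" by (simp add: inner_diff_right)
    then show ?thesis by simp
  qed
  with D show ?thesis unfolding grad_def by (metis the_equality)
qed

lemma grad_eqI:
  fixes h :: "'a::euclidean_space \<Rightarrow> real"
  assumes "GDERIV h x :> D"
  shows "grad h x = D"
proof -
  have "h differentiable (at x)" using assms by (auto simp: gderiv_def differentiable_def)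
  then have "GDERIV h x :> grad h x" by (rule GDERIV_grad)
  then have "(\<lambda>u. inner u (grad h x)) = (\<lambda>u. inner u D)"
    using assms unfolding gderiv_def by (rule has_derivative_unique)
  then have "inner (grad h x - D) (grad h x) = inner (grad h x - D) D" by metis
  then have "inner (grad h x - D) (grad h x - D) = 0" by (simp add: inner_diff_right)
  then show ?thesis by simp
qed

lemma GDERIV_mean:
  fixes h :: "nat \<Rightarrow> 'a::euclidean_space \<Rightarrow> real"
  assumes "\<And>i. i \<in> {1..n} \<Longrightarrow> GDERIV (h i) x :> D i"
  shows "GDERIV (\<lambda>y. (\<Sum>i=1..n. h i y) / real n) x :> avg n D"
proof -
  have "((\<lambda>y. (\<Sum>i=1..n. h i y) * (1 / real n)) has_derivative
      (\<lambda>u. (\<Sum>i=1..n. inner u (D i)) * (1 / real n))) (at x)"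
    using assms unfolding gderiv_def by (intro derivative_intros) auto
  then show ?thesis by (simp add: gderiv_def avg_def inner_sum_right)
qed

lemma line_deriv:
  fixes h :: "'a::euclidean_space \<Rightarrow> real"
  assumes "\<And>x. GDERIV h x :> G x"
  shows "((\<lambda>t. h (x + t *\<^sub>R u)) has_real_derivative inner u (G (x + t *\<^sub>R u))) (at t within A)"
proof -
  have "(h has_derivative (\<lambda>z. inner z (G (x + t *\<^sub>R u)))) (at (x + t *\<^sub>R u))"
    using assms[of "x + t *\<^sub>R u"] unfolding gderiv_def .
  moreover have "((\<lambda>t. x + t *\<^sub>R u) has_derivative (\<lambda>s. s *\<^sub>R u)) (at t within A)"
    by (auto intro!: derivative_eq_intros)
  ultimately have "((\<lambda>t. h (x + t *\<^sub>R u)) has_derivative (\<lambda>s. inner (s *\<^sub>R u) (G (x + t *\<^sub>R u)))) (at t within A)"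
    by (rule has_derivative_compose[rotated])
  then show ?thesis
    by (simp add: has_field_derivative_def mult_commute_abs)
qed

text \<open>Along the segment the function is a convex function of one real variable, so it stays above its
  tangent at the start of the segment.\<close>

lemma convex_above_tangent:
  fixes h :: "'a::euclidean_space \<Rightarrow> real"
  assumes "convex_on UNIV h" and "\<And>x. GDERIV h x :> G x"
  shows "h x + inner (G x) (y - x) \<le> h y"
proof -
  define \<phi> where "\<phi> t = h (x + t *\<^sub>R (y - x))" for t :: real
  have eq: "x + ((1 - t) * a + t * b) *\<^sub>R (y - x)
      = (1 - t) *\<^sub>R (x + a *\<^sub>R (y - x)) + t *\<^sub>R (x + b *\<^sub>R (y - x))" for t a b :: real
    by (simp add: algebra_simps)
  have "convex_on UNIV \<phi>"
  proof (rule convex_onI)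
    fix t a b :: real assume "0 < t" "t < 1"
    then show "\<phi> ((1 - t) *\<^sub>R a + t *\<^sub>R b) \<le> (1 - t) * \<phi> a + t * \<phi> b"
      unfolding \<phi>_def real_scaleR_def eq
      using convex_onD[OF assms(1), of t "x + a *\<^sub>R (y - x)" "x + b *\<^sub>R (y - x)"] by simp
  qed simp
  moreover have "(\<phi> has_real_derivative inner (y - x) (G x)) (at 0)"
    unfolding \<phi>_def using line_deriv[OF assms(2), of x "y - x" 0] by simp
  ultimately have "\<phi> 1 - \<phi> 0 \<ge> inner (y - x) (G x) * (1 - 0)"
    by (intro convex_on_imp_above_tangent[of UNIV]) auto
  then show ?thesis by (simp add: \<phi>_def inner_commute)
qed

text \<open>The restriction of the function to the segment minus the quadratic on the right-hand side has
  a non-positive derivative, because the gradient moves by at most \<open>L t \<bar>y - x\<bar>\<close> after time \<open>t\<close>.\<close>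

lemma smooth_below_quadratic:
  fixes h :: "'a::euclidean_space \<Rightarrow> real"
  assumes G: "\<And>x. GDERIV h x :> G x" and Lip: "L-lipschitz_on UNIV G"
  shows "h y \<le> h x + inner (G x) (y - x) + L / 2 * (norm (y - x))\<^sup>2"
proof -
  define u where "u = y - x"
  define \<phi> where "\<phi> t = h (x + t *\<^sub>R u) - t * inner u (G x) - L / 2 * (norm u)\<^sup>2 * t\<^sup>2" for t :: real
  have der: "(\<phi> has_real_derivative
      inner u (G (x + t *\<^sub>R u)) - inner u (G x) - L * (norm u)\<^sup>2 * t) (at t)" for t
    unfolding \<phi>_def
    by (rule derivative_eq_intros line_deriv[OF G] refl | simp)+
  have "\<phi> 1 \<le> \<phi> 0"
  proof (rule DERIV_nonpos_imp_nonincreasing[of 0 1])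
    fix t :: real assume t: "0 \<le> t" "t \<le> 1"
    have "inner u (G (x + t *\<^sub>R u)) - inner u (G x) = inner u (G (x + t *\<^sub>R u) - G x)"
      by (simp add: inner_diff_right)
    also have "\<dots> \<le> norm u * norm (G (x + t *\<^sub>R u) - G x)"
      by (rule norm_cauchy_schwarz)
    also have "\<dots> \<le> norm u * (L * norm (t *\<^sub>R u))"
      using lipschitz_onD[OF Lip, of "x + t *\<^sub>R u" x]
      by (intro mult_left_mono) (auto simp: dist_norm)
    also have "\<dots> = L * (norm u)\<^sup>2 * t" using t by (simp add: power2_eq_square)
    finally show "\<exists>d. (\<phi> has_real_derivative d) (at t) \<and> d \<le> 0"
      using der[of t] by (intro exI[of _ "inner u (G (x + t *\<^sub>R u)) - inner u (G x) - L * (norm u)\<^sup>2 * t"]) auto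
  qed simp
  then show ?thesis by (simp add: \<phi>_def u_def inner_commute)
qed

text \<open>Compare the tangent at \<open>y\<close> with the quadratic majorant at \<open>x\<close> in the point reached from \<open>x\<close> by a
  gradient step of length \<open>1/L\<close> for the function \<open>h - \<langle>\<nabla>h(y), \<cdot>\<rangle>\<close>, whose minimizer is \<open>y\<close>.\<close>

lemma smooth_convex_gradient_gap:
  fixes h :: "'a::euclidean_space \<Rightarrow> real"
  assumes conv: "convex_on UNIV h" and G: "\<And>x. GDERIV h x :> G x"
    and Lip: "L-lipschitz_on UNIV G" and L: "0 < L"
  shows "(norm (G x - G y))\<^sup>2 \<le> 2 * L * (h x - h y - inner (G y) (x - y))"
proof -
  define d where "d = G x - G y"
  define z where "z = x - (1 / L) *\<^sub>R d"
  have "h y + inner (G y) (z - y) \<le> h z"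
    by (rule convex_above_tangent[OF conv G])
  also have "h z \<le> h x + inner (G x) (z - x) + L / 2 * (norm (z - x))\<^sup>2"
    by (rule smooth_below_quadratic[OF G Lip])
  finally have 1: "h y + inner (G y) (z - y) \<le> h x + inner (G x) (z - x) + L / 2 * (norm (z - x))\<^sup>2" .
  have zx: "z - x = - ((1 / L) *\<^sub>R d)" by (simp add: z_def)
  have 2: "inner (G y) (z - y) = inner (G y) (x - y) - (1 / L) * inner (G y) d"
    by (simp add: z_def inner_diff_right)
  have 3: "inner (G x) (z - x) = - (1 / L) * inner (G x) d" by (simp add: zx)
  have 4: "L / 2 * (norm (z - x))\<^sup>2 = (norm d)\<^sup>2 / (2 * L)"
    using L unfolding zx by (simp add: power2_eq_square field_simps)
  have 5: "(1 / L) * inner (G x) d - (1 / L) * inner (G y) d = (norm d)\<^sup>2 / L"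
    by (simp add: d_def power2_norm_eq_inner inner_diff_left right_diff_distrib[symmetric] divide_simps)
  have "(norm d)\<^sup>2 / (2 * L) \<le> h x - h y - inner (G y) (x - y)"
    using 1 5 unfolding 2 3 4 by simp
  then show ?thesis using L by (simp add: d_def field_simps)
qed

section \<open>Averages\<close>

lemma avg_const [simp]: "1 \<le> n \<Longrightarrow> avg n (\<lambda>_. a) = a"
  by (simp add: avg_def sum_constant_scaleR)

lemma avg_real: "avg n u = (\<Sum>i=1..n. u i) / real n" for u :: "nat \<Rightarrow> real"
  by (simp add: avg_def)

lemma avg_add: "avg n (\<lambda>i. u i + u' i) = avg n u + avg n u'"
  by (simp add: avg_def sum.distrib scaleR_add_right)

lemma avg_diff: "avg n (\<lambda>i. u i - u' i) = avg n u - avg n u'"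
  by (simp add: avg_def sum_subtractf scaleR_diff_right)

lemma avg_scaleR: "avg n (\<lambda>i. a *\<^sub>R u i) = a *\<^sub>R avg n u"
  by (simp add: avg_def scaleR_sum_right[symmetric] scaleR_left_commute)

lemma avg_cmult: "avg n (\<lambda>i. a * u i) = a * avg n u" for a :: real
  using avg_scaleR[of n a u] by simp

lemma avg_inner: "avg n (\<lambda>i. inner a (u i)) = inner a (avg n u)"
  by (simp add: avg_def inner_sum_right)

lemma avg_cong: "(\<And>i. i \<in> {1..n} \<Longrightarrow> u i = u' i) \<Longrightarrow> avg n u = avg n u'"
  by (simp add: avg_def)

lemma avg_mono:
  fixes u :: "nat \<Rightarrow> real"
  assumes "\<And>i. i \<in> {1..n} \<Longrightarrow> u i \<le> u' i"
  shows "avg n u \<le> avg n u'"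
  unfolding avg_real by (intro divide_right_mono sum_mono assms) auto

lemma avg_nonneg:
  fixes u :: "nat \<Rightarrow> real"
  assumes "\<And>i. i \<in> {1..n} \<Longrightarrow> 0 \<le> u i"
  shows "0 \<le> avg n u"
  unfolding avg_real by (intro divide_nonneg_nonneg sum_nonneg assms) auto

lemmas avg_simps = avg_add avg_diff avg_cmult avg_const

text \<open>The parallel axis theorem for the uniform distribution on \<open>{1..n}\<close>.\<close>

lemma avg_norm_shift:
  fixes u :: "nat \<Rightarrow> 'a::real_inner"
  assumes "1 \<le> n"
  shows "avg n (\<lambda>i. (norm (a + u i))\<^sup>2)
    = (norm (a + avg n u))\<^sup>2 + avg n (\<lambda>i. (norm (u i - avg n u))\<^sup>2)"
proof -
  define b where "b = avg n u"
  have "avg n (\<lambda>i. (norm (a + u i))\<^sup>2)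
      = avg n (\<lambda>i. (norm (a + b))\<^sup>2 + 2 * (inner (a + b) (u i) - inner (a + b) b) + (norm (u i - b))\<^sup>2)"
    by (intro avg_cong) (simp add: power2_norm_eq_inner algebra_simps inner_commute)
  also have "\<dots> = (norm (a + b))\<^sup>2 + 2 * (inner (a + b) b - inner (a + b) b) + avg n (\<lambda>i. (norm (u i - b))\<^sup>2)"
    using assms by (simp add: avg_simps avg_inner b_def)
  finally show ?thesis by (simp add: b_def)
qed

lemma avg_norm_variance_le:
  fixes u :: "nat \<Rightarrow> 'a::real_inner"
  assumes "1 \<le> n"
  shows "avg n (\<lambda>i. (norm (u i - avg n u))\<^sup>2) \<le> avg n (\<lambda>i. (norm (u i))\<^sup>2)"
  using avg_norm_shift[OF assms, of 0 u] by simp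

lemma norm_avg_le:
  fixes u :: "nat \<Rightarrow> 'a::real_inner"
  assumes "1 \<le> n"
  shows "(norm (avg n u))\<^sup>2 \<le> avg n (\<lambda>i. (norm (u i))\<^sup>2)"
  using avg_norm_shift[OF assms, of 0 u] avg_nonneg[of n "\<lambda>i. (norm (u i - avg n u))\<^sup>2"] by simp

lemma norm_add_square_le:
  fixes a b :: "'a::real_inner"
  assumes "0 < s"
  shows "(norm (a + b))\<^sup>2 \<le> (1 + s) * (norm a)\<^sup>2 + (1 + 1 / s) * (norm b)\<^sup>2"
proof -
  have "0 \<le> (norm (s *\<^sub>R a - b))\<^sup>2 / s" using assms by simp
  also have "\<dots> = s * (norm a)\<^sup>2 - 2 * inner a b + (norm b)\<^sup>2 / s"
    using assms by (simp add: power2_norm_eq_inner inner_diff_left inner_diff_right inner_commute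
        diff_divide_distrib add_divide_distrib)
  finally show ?thesis
    by (simp add: power2_norm_eq_inner inner_add_left inner_add_right inner_commute algebra_simps)
qed

lemma norm_diff_square_le:
  fixes a b :: "'a::real_inner"
  shows "(norm (a - b))\<^sup>2 \<le> 2 * (norm a)\<^sup>2 + 2 * (norm b)\<^sup>2"
  using norm_add_square_le[of 1 a "- b"] by simp

lemma norm_add_square_le2:
  fixes a b :: "'a::real_inner"
  shows "(norm (a + b))\<^sup>2 \<le> 2 * (norm a)\<^sup>2 + 2 * (norm b)\<^sup>2"
  using norm_add_square_le[of 1 a b] by simp

lemma convex_on_avg:
  assumes "\<And>i. i \<in> {1..n} \<Longrightarrow> convex_on UNIV (h i)"
  shows "convex_on UNIV (\<lambda>x. avg n (\<lambda>i. h i x))"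
proof (rule convex_onI)
  fix t :: real and x y :: 'a assume t: "0 < t" "t < 1"
  have "avg n (\<lambda>i. h i ((1 - t) *\<^sub>R x + t *\<^sub>R y)) \<le> avg n (\<lambda>i. (1 - t) * h i x + t * h i y)"
    using t by (intro avg_mono convex_onD[OF assms]) auto
  then show "avg n (\<lambda>i. h i ((1 - t) *\<^sub>R x + t *\<^sub>R y))
      \<le> (1 - t) * avg n (\<lambda>i. h i x) + t * avg n (\<lambda>i. h i y)"
    by (simp only: avg_simps)
qed simp

section \<open>The finite-sum problem at a fixed state\<close>

locale smooth_convex_finite_sum =
  fixes n m :: nat and fs :: "nat \<Rightarrow> nat \<Rightarrow> 'a::euclidean_space \<Rightarrow> real" and xs :: 'a and L :: real
  assumes n: "1 \<le> n" and m: "1 \<le> m" and L: "0 < L"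
    and conv: "\<And>i j. i \<in> {1..n} \<Longrightarrow> j \<in> {1..m} \<Longrightarrow> convex_on UNIV (fs i j)"
    and smooth: "\<And>i j. i \<in> {1..n} \<Longrightarrow> j \<in> {1..m} \<Longrightarrow> L_smooth L (fs i j)"
    and minimal: "\<And>y. f_glob n m fs xs \<le> f_glob n m fs y"
begin

abbreviation "f \<equiv> f_glob n m fs"
abbreviation "dfs i j \<equiv> grad (fs i j)"
abbreviation "dloc i \<equiv> grad (f_loc m fs i)"
abbreviation "gap x \<equiv> f x - f xs"
abbreviation "\<sigma>2 \<equiv> sigma_sq n m fs xs"

definition heterogeneity :: real where "heterogeneity = 2 / real n * (\<Sum>i=1..n. (norm (dloc i xs))\<^sup>2)"

text \<open>The gradient estimator at the point \<open>x\<close> with reference point \<open>u\<close>. The drawn index is the last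
  argument, so that the conditional mean for a fixed state is the average of \<open>svrg i x u\<close>.\<close>

definition svrg :: "nat \<Rightarrow> 'a \<Rightarrow> 'a \<Rightarrow> nat \<Rightarrow> 'a" where
  "svrg i x u l = dfs i l x - dfs i l u + dloc i u"

lemma gderiv_fs:
  assumes "i \<in> {1..n}" "j \<in> {1..m}"
  shows "GDERIV (fs i j) x :> dfs i j x"
  using smooth[OF assms] by (auto simp: L_smooth_def intro: GDERIV_grad)

lemma lip_fs:
  assumes "i \<in> {1..n}" "j \<in> {1..m}"
  shows "L-lipschitz_on UNIV (dfs i j)"
  using smooth[OF assms] by (simp add: L_smooth_def)

lemma gderiv_f_loc:
  assumes "i \<in> {1..n}"
  shows "GDERIV (f_loc m fs i) x :> avg m (\<lambda>j. dfs i j x)"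
  using GDERIV_mean[of m "fs i" x "\<lambda>j. dfs i j x"] gderiv_fs[OF assms]
  by (simp add: f_loc_def[abs_def])

lemma dloc_eq: "i \<in> {1..n} \<Longrightarrow> dloc i x = avg m (\<lambda>j. dfs i j x)"
  by (rule grad_eqI) (rule gderiv_f_loc)

lemma gderiv_f: "GDERIV f x :> avg n (\<lambda>i. dloc i x)"
  using GDERIV_mean[of n "f_loc m fs" x "\<lambda>i. dloc i x"] gderiv_f_loc
  by (simp add: f_glob_def[abs_def] dloc_eq)

lemma grad_f_eq: "grad f x = avg n (\<lambda>i. dloc i x)"
  by (rule grad_eqI) (rule gderiv_f)

lemma avg_dloc_xs: "avg n (\<lambda>i. dloc i xs) = 0"
proof -
  have "(f has_derivative (\<lambda>u. inner u (avg n (\<lambda>i. dloc i xs)))) (at xs)"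
    using gderiv_f[of xs] by (simp add: gderiv_def)
  then have "(\<lambda>u. inner u (avg n (\<lambda>i. dloc i xs))) = (\<lambda>u. 0)"
    by (rule differential_zero_maxmin[where S=UNIV, rotated 2]) (auto simp: minimal)
  then show ?thesis by (metis inner_eq_zero_iff)
qed

lemma f_avg: "f x = avg n (\<lambda>i. avg m (\<lambda>j. fs i j x))"
  by (simp add: f_glob_def f_loc_def avg_real)

lemma sigma_sq_avg:
  "\<sigma>2 u = avg n (\<lambda>i. avg m (\<lambda>j. (norm (dfs i j (u i) - dfs i j xs))\<^sup>2))"
  by (simp add: sigma_sq_def avg_real sum_divide_distrib mult.commute)

lemma sigma_sq_nonneg: "0 \<le> \<sigma>2 u"
  unfolding sigma_sq_avg by (intro avg_nonneg) simp

lemma gap_nonneg: "0 \<le> gap x"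
  using minimal by simp

lemma convex_f: "convex_on UNIV f"
  unfolding f_avg[abs_def] by (intro convex_on_avg conv)

lemma continuous_f: "continuous_on UNIV f"
  using gderiv_f by (intro continuous_at_imp_continuous_on ballI has_derivative_continuous)
    (auto simp: gderiv_def)

lemma dist_dfs_square_le:
  assumes "i \<in> {1..n}" "j \<in> {1..m}"
  shows "(norm (dfs i j x - dfs i j y))\<^sup>2 \<le> L\<^sup>2 * (norm (x - y))\<^sup>2"
  using lipschitz_onD[OF lip_fs[OF assms], of x y]
  by (metis UNIV_I dist_norm norm_ge_zero power_mono power_mult_distrib)

text \<open>The linear terms of the gaps of the single \<open>f\<^sub>i\<^sub>j\<close> cancel in the average, since the gradient of
  \<open>f\<close> vanishes at the minimizer.\<close>

lemma mean_gradient_gap: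
  "avg n (\<lambda>i. avg m (\<lambda>j. (norm (dfs i j x - dfs i j xs))\<^sup>2)) \<le> 2 * L * gap x"
proof -
  have "avg n (\<lambda>i. avg m (\<lambda>j. (norm (dfs i j x - dfs i j xs))\<^sup>2))
      \<le> avg n (\<lambda>i. avg m (\<lambda>j. 2 * L * (fs i j x - fs i j xs - inner (x - xs) (dfs i j xs))))"
    using smooth_convex_gradient_gap[OF conv gderiv_fs lip_fs L]
    by (intro avg_mono) (simp add: inner_commute)
  also have "\<dots> = avg n (\<lambda>i. 2 * L * (avg m (\<lambda>j. fs i j x) - avg m (\<lambda>j. fs i j xs)
      - inner (x - xs) (dloc i xs)))"
    by (intro avg_cong) (simp add: avg_simps avg_inner dloc_eq)
  also have "\<dots> = 2 * L * gap x"
    by (simp add: avg_simps avg_inner avg_dloc_xs f_avg)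
  finally show ?thesis .
qed

lemma mean_local_gradient_gap: "avg n (\<lambda>i. (norm (dloc i x - dloc i xs))\<^sup>2) \<le> 2 * L * gap x"
proof -
  have "avg n (\<lambda>i. (norm (dloc i x - dloc i xs))\<^sup>2)
      \<le> avg n (\<lambda>i. avg m (\<lambda>j. (norm (dfs i j x - dfs i j xs))\<^sup>2))"
    using norm_avg_le[OF m] by (intro avg_mono) (simp add: dloc_eq avg_diff[symmetric])
  also note mean_gradient_gap
  finally show ?thesis .
qed

lemma grad_gap: "(norm (grad f x))\<^sup>2 \<le> 2 * L * gap x"
proof -
  have "grad f x = avg n (\<lambda>i. dloc i x - dloc i xs)"
    by (simp add: avg_diff grad_f_eq avg_dloc_xs)
  then have "(norm (grad f x))\<^sup>2 \<le> avg n (\<lambda>i. (norm (dloc i x - dloc i xs))\<^sup>2)"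
    using norm_avg_le[OF n] by simp
  also note mean_local_gradient_gap
  finally show ?thesis .
qed

lemma gap_le_inner: "gap x \<le> inner (grad f x) (x - xs)"
proof -
  have "f x + inner (avg n (\<lambda>i. dloc i x)) (xs - x) \<le> f xs"
    by (rule convex_above_tangent[OF convex_f gderiv_f])
  then show ?thesis by (simp add: grad_f_eq inner_diff_right)
qed

text \<open>This makes the gap integrable along the run. It holds because \<open>gap_le_inner\<close> and \<open>grad_gap\<close> bound
  the squared gap by the gap times \<open>2L \<bar>x - x\<^sup>*\<bar>\<^sup>2\<close>.\<close>

lemma gap_le_dist: "gap x \<le> 2 * L * (norm (x - xs))\<^sup>2"
proof -
  define r where "r = norm (x - xs)"
  have "gap x \<le> norm (grad f x) * r"
    using gap_le_inner norm_cauchy_schwarz order_trans unfolding r_def by blast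
  then have "(gap x)\<^sup>2 \<le> (norm (grad f x) * r)\<^sup>2"
    using gap_nonneg by (intro power_mono)
  also have "\<dots> \<le> (2 * L * gap x) * r\<^sup>2"
    unfolding power_mult_distrib by (intro mult_right_mono grad_gap) simp
  finally have "gap x * gap x \<le> gap x * (2 * L * r\<^sup>2)"
    by (simp add: power2_eq_square mult_ac)
  then show ?thesis unfolding r_def[symmetric]
    using gap_nonneg[of x] L by (cases "gap x = 0") auto
qed

lemma avg_svrg:
  assumes "i \<in> {1..n}"
  shows "avg m (svrg i x u) = dloc i x"
proof -
  have "avg m (svrg i x u) = avg m (\<lambda>l. dfs i l x - dfs i l u + dloc i u)"
    by (simp add: svrg_def[abs_def])
  also have "\<dots> = dloc i x" using m assms by (simp add: avg_simps dloc_eq)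
  finally show ?thesis .
qed

text \<open>The shift by \<open>dloc i xs\<close> compares both gradient differences with the solution; the part that
  comes from the reference point is centered, so its mean square is at most the one without
  centering.\<close>

lemma mean_svrg_shifted_le:
  "avg n (\<lambda>i. avg m (\<lambda>l. (norm (svrg i x (u i) l - dloc i xs))\<^sup>2)) \<le> 4 * L * gap x + 2 * \<sigma>2 u"
proof -
  have "avg n (\<lambda>i. avg m (\<lambda>l. (norm (svrg i x (u i) l - dloc i xs))\<^sup>2))
     \<le> avg n (\<lambda>i. 2 * avg m (\<lambda>l. (norm (dfs i l x - dfs i l xs))\<^sup>2)
             + 2 * avg m (\<lambda>l. (norm (dfs i l (u i) - dfs i l xs))\<^sup>2))"
  proof (rule avg_mono)
    fix i assume i: "i \<in> {1..n}"
    define a where "a l = dfs i l x - dfs i l xs" for l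
    define b where "b l = dfs i l (u i) - dfs i l xs" for l
    have ab: "svrg i x (u i) l - dloc i xs = a l - (b l - avg m b)" for l
    proof -
      have "avg m b = dloc i (u i) - dloc i xs"
        using i by (simp add: b_def[abs_def] avg_diff dloc_eq)
      then show ?thesis by (simp add: svrg_def a_def b_def)
    qed
    have "avg m (\<lambda>l. (norm (svrg i x (u i) l - dloc i xs))\<^sup>2)
        \<le> avg m (\<lambda>l. 2 * (norm (a l))\<^sup>2 + 2 * (norm (b l - avg m b))\<^sup>2)"
      unfolding ab by (intro avg_mono norm_diff_square_le)
    also have "\<dots> \<le> 2 * avg m (\<lambda>l. (norm (a l))\<^sup>2) + 2 * avg m (\<lambda>l. (norm (b l))\<^sup>2)"
      using avg_norm_variance_le[OF m, of b] by (simp add: avg_simps)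
    finally show "avg m (\<lambda>l. (norm (svrg i x (u i) l - dloc i xs))\<^sup>2)
      \<le> 2 * avg m (\<lambda>l. (norm (dfs i l x - dfs i l xs))\<^sup>2)
             + 2 * avg m (\<lambda>l. (norm (dfs i l (u i) - dfs i l xs))\<^sup>2)"
      by (simp add: a_def b_def)
  qed
  also have "\<dots> \<le> 4 * L * gap x + 2 * \<sigma>2 u"
    using mean_gradient_gap[of x] by (simp add: avg_simps sigma_sq_avg)
  finally show ?thesis .
qed

text \<open>Centering at the mean \<open>dloc i x\<close> gives the smallest mean square, so centering at \<open>dloc i xs\<close>
  gives an upper bound.\<close>

lemma mean_svrg_variance_le:
  "avg n (\<lambda>i. avg m (\<lambda>l. (norm (svrg i x (u i) l - dloc i x))\<^sup>2)) \<le> 4 * L * gap x + 2 * \<sigma>2 u"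
proof -
  have "avg m (\<lambda>l. (norm (svrg i x (u i) l - dloc i x))\<^sup>2)
      \<le> avg m (\<lambda>l. (norm (svrg i x (u i) l - dloc i xs))\<^sup>2)" if "i \<in> {1..n}" for i
  proof -
    have "avg m (\<lambda>l. svrg i x (u i) l - dloc i xs) = dloc i x - dloc i xs"
      using m avg_svrg[OF that, of x "u i"] by (simp add: avg_simps)
    then show ?thesis
      using avg_norm_variance_le[OF m, of "\<lambda>l. svrg i x (u i) l - dloc i xs"] by simp
  qed
  then have "avg n (\<lambda>i. avg m (\<lambda>l. (norm (svrg i x (u i) l - dloc i x))\<^sup>2))
    \<le> avg n (\<lambda>i. avg m (\<lambda>l. (norm (svrg i x (u i) l - dloc i xs))\<^sup>2))"
    by (rule avg_mono)
  also note mean_svrg_shifted_le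
  finally show ?thesis .
qed

lemma heterogeneity_avg: "heterogeneity = 2 * avg n (\<lambda>i. (norm (dloc i xs))\<^sup>2)"
  by (simp add: heterogeneity_def avg_real)

lemma heterogeneity_nonneg: "0 \<le> heterogeneity"
  unfolding heterogeneity_avg by (intro mult_nonneg_nonneg avg_nonneg) auto

text \<open>The parameter \<open>s\<close> trades the function gap against the gradients at the solution: \<open>s = 1\<close> gives the
  constants \<open>4L\<close> and \<open>1\<close> of the parametric assumption, the error recursion takes \<open>s = 1/2\<close>.\<close>

lemma mean_dloc_le:
  assumes "0 < s"
  shows "avg n (\<lambda>i. (norm (dloc i x))\<^sup>2) \<le> (1 + 1 / s) * (2 * L * gap x) + (1 + s) * (heterogeneity / 2)"
proof -
  have "(norm (dloc i x))\<^sup>2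
      \<le> (1 + s) * (norm (dloc i xs))\<^sup>2 + (1 + 1 / s) * (norm (dloc i x - dloc i xs))\<^sup>2" for i
    using norm_add_square_le[OF assms, of "dloc i xs" "dloc i x - dloc i xs"] by simp
  then have "avg n (\<lambda>i. (norm (dloc i x))\<^sup>2)
      \<le> avg n (\<lambda>i. (1 + s) * (norm (dloc i xs))\<^sup>2 + (1 + 1 / s) * (norm (dloc i x - dloc i xs))\<^sup>2)"
    by (intro avg_mono)
  also have "\<dots> = (1 + s) * (heterogeneity / 2) + (1 + 1 / s) * avg n (\<lambda>i. (norm (dloc i x - dloc i xs))\<^sup>2)"
    by (simp only: avg_simps heterogeneity_avg)
  also have "\<dots> \<le> (1 + s) * (heterogeneity / 2) + (1 + 1 / s) * (2 * L * gap x)"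
    using assms by (intro add_left_mono mult_left_mono mean_local_gradient_gap) auto
  finally show ?thesis by simp
qed

text \<open>With Young's parameter \<open>\<delta>/2\<close> the contraction factor \<open>1 - \<delta>\<close> of the compressor is weakened to
  \<open>1 - \<delta>/2\<close>. The local gradients are split with parameter \<open>1/2\<close> so that less than the full \<open>heterogeneity\<close>
  appears: the remaining quarter pays for the growth of the weights \<open>w\<^sub>k\<close> later on.\<close>

lemma error_one_step:
  assumes "0 < \<delta>" "\<delta> \<le> 1"
  shows "(1 - \<delta>) * avg n (\<lambda>i. avg m (\<lambda>l. (norm (e i + \<gamma> *\<^sub>R svrg i x (u i) l))\<^sup>2))
    \<le> (1 - \<delta> / 2) * avg n (\<lambda>i. (norm (e i))\<^sup>2)
      + \<gamma>\<^sup>2 * ((2 / \<delta>) * (6 * L * gap x + 3 / 4 * heterogeneity) + 4 * L * gap x + 2 * \<sigma>2 u)"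
proof -
  have c1: "(1 - \<delta>) * (1 + \<delta> / 2) \<le> 1 - \<delta> / 2"
    using assms by (simp add: algebra_simps)
  have c2: "(1 - \<delta>) * (1 + 1 / (\<delta> / 2)) \<le> 2 / \<delta>"
    using assms by (simp add: field_simps)
  have "(1 - \<delta>) * avg m (\<lambda>l. (norm (e i + \<gamma> *\<^sub>R svrg i x (u i) l))\<^sup>2)
     \<le> (1 - \<delta> / 2) * (norm (e i))\<^sup>2 + (2 / \<delta>) * (\<gamma>\<^sup>2 * (norm (dloc i x))\<^sup>2)
        + \<gamma>\<^sup>2 * avg m (\<lambda>l. (norm (svrg i x (u i) l - dloc i x))\<^sup>2)" if i: "i \<in> {1..n}" for i
  proof -
    define V where "V = avg m (\<lambda>l. (norm (svrg i x (u i) l - dloc i x))\<^sup>2)"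
    have V: "0 \<le> V" unfolding V_def by (intro avg_nonneg) simp
    have mean: "avg m (\<lambda>l. \<gamma> *\<^sub>R svrg i x (u i) l) = \<gamma> *\<^sub>R dloc i x"
      using avg_svrg[OF i, of x "u i"] by (simp add: avg_scaleR)
    have "avg m (\<lambda>l. (norm (e i + \<gamma> *\<^sub>R svrg i x (u i) l))\<^sup>2)
        = (norm (e i + \<gamma> *\<^sub>R dloc i x))\<^sup>2 + \<gamma>\<^sup>2 * V"
      unfolding avg_norm_shift[OF m] mean V_def
      by (simp add: scaleR_diff_right[symmetric] power_mult_distrib avg_cmult)
    also have "\<dots> \<le> (1 + \<delta> / 2) * (norm (e i))\<^sup>2
        + (1 + 1 / (\<delta> / 2)) * (\<gamma>\<^sup>2 * (norm (dloc i x))\<^sup>2) + \<gamma>\<^sup>2 * V"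
      using norm_add_square_le[of "\<delta> / 2" "e i" "\<gamma> *\<^sub>R dloc i x"] assms
      by (simp add: power_mult_distrib)
    finally have "(1 - \<delta>) * avg m (\<lambda>l. (norm (e i + \<gamma> *\<^sub>R svrg i x (u i) l))\<^sup>2)
        \<le> (1 - \<delta>) * ((1 + \<delta> / 2) * (norm (e i))\<^sup>2
        + (1 + 1 / (\<delta> / 2)) * (\<gamma>\<^sup>2 * (norm (dloc i x))\<^sup>2) + \<gamma>\<^sup>2 * V)"
      using assms by (intro mult_left_mono) auto
    also have "\<dots> = ((1 - \<delta>) * (1 + \<delta> / 2)) * (norm (e i))\<^sup>2
        + ((1 - \<delta>) * (1 + 1 / (\<delta> / 2))) * (\<gamma>\<^sup>2 * (norm (dloc i x))\<^sup>2) + (1 - \<delta>) * (\<gamma>\<^sup>2 * V)"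
      (is "(1 - \<delta>) * (?c * ?a + ?c' * ?b + ?d) = _")
      by (metis (no_types) distrib_left mult.assoc)
    also have "\<dots> \<le> (1 - \<delta> / 2) * (norm (e i))\<^sup>2 + (2 / \<delta>) * (\<gamma>\<^sup>2 * (norm (dloc i x))\<^sup>2) + 1 * (\<gamma>\<^sup>2 * V)"
      using assms V by (intro add_mono mult_right_mono c1 c2) auto
    finally show ?thesis by (simp add: V_def)
  qed
  then have "avg n (\<lambda>i. (1 - \<delta>) * avg m (\<lambda>l. (norm (e i + \<gamma> *\<^sub>R svrg i x (u i) l))\<^sup>2))
    \<le> avg n (\<lambda>i. (1 - \<delta> / 2) * (norm (e i))\<^sup>2 + (2 / \<delta>) * (\<gamma>\<^sup>2 * (norm (dloc i x))\<^sup>2)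
        + \<gamma>\<^sup>2 * avg m (\<lambda>l. (norm (svrg i x (u i) l - dloc i x))\<^sup>2))"
    by (intro avg_mono)
  also have "\<dots> = (1 - \<delta> / 2) * avg n (\<lambda>i. (norm (e i))\<^sup>2)
      + (2 / \<delta>) * (\<gamma>\<^sup>2 * avg n (\<lambda>i. (norm (dloc i x))\<^sup>2))
      + \<gamma>\<^sup>2 * avg n (\<lambda>i. avg m (\<lambda>l. (norm (svrg i x (u i) l - dloc i x))\<^sup>2))"
    by (simp only: avg_simps)
  also have "\<dots> \<le> (1 - \<delta> / 2) * avg n (\<lambda>i. (norm (e i))\<^sup>2)
      + (2 / \<delta>) * (\<gamma>\<^sup>2 * (6 * L * gap x + 3 / 4 * heterogeneity)) + \<gamma>\<^sup>2 * (4 * L * gap x + 2 * \<sigma>2 u)"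
    using assms mean_dloc_le[of "1/2" x]
    by (intro add_mono mult_left_mono mean_svrg_variance_le order_refl) auto
  finally show ?thesis by (simp only: avg_cmult) (simp add: algebra_simps)
qed

end

text \<open>Feeding the gradient bound \<open>\<bar>\<nabla>f\<bar>\<^sup>2 \<le> 2L(f - f\<^sup>*)\<close> into quasi strong convexity at distance \<open>r\<close> from
  the minimizer gives a quadratic inequality for \<open>\<bar>\<nabla>f\<bar>\<close>, which is solvable only if its discriminant
  \<open>r\<^sup>2 (1 - \<mu>/L)\<close> is non-negative.\<close>

lemma (in smooth_convex_finite_sum) quasi_strong_convexity_le_smoothness:
  assumes "\<And>x. gap x + \<mu> / 2 * (norm (x - xs))\<^sup>2 \<le> inner (grad f x) (x - xs)"
  shows "\<mu> \<le> L"
proof -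
  obtain b :: 'a where b: "b \<in> Basis" using nonempty_Basis by blast
  define g where "g = norm (grad f (xs + b))"
  have "gap (xs + b) + \<mu> / 2 \<le> inner (grad f (xs + b)) b"
    using assms[of "xs + b"] b by simp
  also have "\<dots> \<le> g"
    using norm_cauchy_schwarz[of "grad f (xs + b)" b] b by (simp add: g_def)
  finally have 1: "gap (xs + b) + \<mu> / 2 \<le> g" .
  have 2: "g\<^sup>2 \<le> 2 * L * gap (xs + b)" unfolding g_def by (rule grad_gap)
  have "L * \<mu> \<le> 2 * L * g - 2 * L * gap (xs + b)"
    using mult_left_mono[OF 1, of "2 * L"] L by (simp add: algebra_simps)
  also have "\<dots> \<le> 2 * L * g - g\<^sup>2" using 2 by simp
  also have "\<dots> \<le> L * L" using zero_le_power2[of "g - L"] by (simp add: power2_eq_square algebra_simps)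
  finally show ?thesis using L by simp
qed

text \<open>The Lyapunov function is the squared distance of the virtual iterate \<open>x - e\<close> to the solution plus
  \<open>4 \<gamma>\<^sup>2 / p\<close> times \<open>\<sigma>\<^sup>2\<close>. The coefficient \<open>4/p\<close> makes the \<open>\<sigma>\<^sup>2\<close> from the stochastic gradient use up
  only half of the decrease \<open>p \<sigma>\<^sup>2\<close> in the reference points.\<close>

lemma (in smooth_convex_finite_sum) lyapunov_one_step:
  assumes qsc: "\<And>x. gap x + \<mu> / 2 * (norm (x - xs))\<^sup>2 \<le> inner (grad f x) (x - xs)"
    and \<mu>: "0 \<le> \<mu>" and \<gamma>: "0 < \<gamma>" "\<gamma> \<le> 1 / (24 * L)" and p: "0 < p"
    and \<eta>: "\<eta> \<le> \<gamma> * \<mu> / 2" "\<eta> \<le> p / 4" and s: "0 \<le> s"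
  shows "(norm (x - e - xs))\<^sup>2 - 2 * \<gamma> * inner (x - e - xs) (grad f x) + \<gamma>\<^sup>2 * (4 * L * gap x + 2 * s)
      + 4 / p * \<gamma>\<^sup>2 * ((1 - p) * s + p * (2 * L * gap x))
    \<le> (1 - \<eta>) * ((norm (x - e - xs))\<^sup>2 + 4 / p * \<gamma>\<^sup>2 * s) - \<gamma> / 2 * gap x + 3 * L * \<gamma> * (norm e)\<^sup>2"
proof -
  define T where "T = (norm (x - e - xs))\<^sup>2"
  define r where "r = (norm (x - xs))\<^sup>2"
  define E where "E = (norm e)\<^sup>2"
  define gx where "gx = gap x"
  have gx: "0 \<le> gx" unfolding gx_def by (rule gap_nonneg)
  have E: "0 \<le> E" and T: "0 \<le> T" by (simp_all add: E_def T_def)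
  have \<mu>L: "\<mu> \<le> L" using qsc by (rule quasi_strong_convexity_le_smoothness)
  have Tr: "T \<le> 2 * r + 2 * E"
    using norm_diff_square_le[of "x - xs" e] by (simp add: T_def r_def E_def algebra_simps)
  \<comment> \<open>Young's inequality with weight \<open>2L\<close>: by \<open>grad_gap\<close> the gradient term costs one of the two gaps
    gained from quasi strong convexity.\<close>
  have cross: "2 * inner e (grad f x) \<le> 2 * L * E + gx"
  proof -
    have "0 \<le> (norm ((2 * L) *\<^sub>R e - grad f x))\<^sup>2 / (2 * L)" using L by simp
    also have "\<dots> = 2 * L * E - 2 * inner e (grad f x) + (norm (grad f x))\<^sup>2 / (2 * L)"
      using L by (simp add: power2_norm_eq_inner E_def inner_diff_left inner_diff_right
          inner_commute add_divide_distrib diff_divide_distrib)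
    also have "(norm (grad f x))\<^sup>2 / (2 * L) \<le> gx"
      using grad_gap[of x] L by (simp add: gx_def field_simps)
    finally show ?thesis by simp
  qed
  have main: "inner (x - e - xs) (grad f x) = inner (grad f x) (x - xs) - inner e (grad f x)"
    by (simp add: inner_diff_left inner_diff_right inner_commute)
  have q: "gx + \<mu> / 2 * r \<le> inner (grad f x) (x - xs)"
    using qsc[of x] by (simp add: gx_def r_def)
  have "- 2 * inner (x - e - xs) (grad f x) \<le> - gx - \<mu> * r + 2 * L * E"
    unfolding main using q cross by simp
  moreover have "- \<mu> * r \<le> - \<mu> / 2 * T + \<mu> * E"
    using mult_left_mono[OF Tr \<mu>] by (simp add: algebra_simps)
  moreover have "\<mu> * E \<le> L * E" using \<mu>L E by (rule mult_right_mono)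
  ultimately have inner: "- 2 * inner (x - e - xs) (grad f x) \<le> - gx - \<mu> / 2 * T + 3 * L * E"
    by simp
  have i2: "- 2 * \<gamma> * inner (x - e - xs) (grad f x) \<le> - \<gamma> * gx - \<gamma> * \<mu> / 2 * T + 3 * L * \<gamma> * E"
    using mult_left_mono[OF inner, of \<gamma>] \<gamma> by (simp add: algebra_simps)
  have gg: "12 * L * \<gamma>\<^sup>2 * gx \<le> \<gamma> / 2 * gx"
  proof -
    have "12 * L * \<gamma> \<le> 1 / 2" using \<gamma> L by (simp add: field_simps)
    then have "12 * L * \<gamma> * (\<gamma> * gx) \<le> 1 / 2 * (\<gamma> * gx)"
      using \<gamma> gx by (intro mult_right_mono) auto
    then show ?thesis by (simp add: power2_eq_square algebra_simps)
  qed
  define Q where "Q = 4 / p * \<gamma>\<^sup>2 * s"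
  have Q: "0 \<le> Q" using p s by (simp add: Q_def)
  have "\<gamma>\<^sup>2 * (4 * L * gx + 2 * s) + 4 / p * \<gamma>\<^sup>2 * ((1 - p) * s + p * (2 * L * gx))
      = 12 * L * \<gamma>\<^sup>2 * gx + (1 - p / 2) * Q"
    using p by (simp add: Q_def field_simps)
  also have "\<dots> \<le> \<gamma> / 2 * gx + (1 - \<eta>) * Q"
    using \<eta> p Q by (intro add_mono gg mult_right_mono) auto
  finally have sigma: "\<gamma>\<^sup>2 * (4 * L * gx + 2 * s) + 4 / p * \<gamma>\<^sup>2 * ((1 - p) * s + p * (2 * L * gx))
      \<le> \<gamma> / 2 * gx + (1 - \<eta>) * Q" .
  have "\<eta> * T \<le> \<gamma> * \<mu> / 2 * T" using \<eta> T by (intro mult_right_mono)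
  then have "T - 2 * \<gamma> * inner (x - e - xs) (grad f x) \<le> (1 - \<eta>) * T - \<gamma> * gx + 3 * L * \<gamma> * E"
    using i2 by (simp add: left_diff_distrib)
  then show ?thesis
    unfolding T_def[symmetric] E_def[symmetric] gx_def[symmetric] Q_def[symmetric]
    using sigma by (simp add: distrib_left)
qed

section \<open>Weighted sums of recursive inequalities\<close>

lemma weight_pos: "\<eta> < 1 \<Longrightarrow> 0 < weight \<eta> k"
  by (simp add: weight_def)

lemma weight_Suc: "\<eta> < 1 \<Longrightarrow> (1 - \<eta>) * weight \<eta> (Suc k) = weight \<eta> k"
  by (simp add: weight_def)

lemma weight_sum_pos: "\<eta> < 1 \<Longrightarrow> 0 < weight_sum \<eta> K"
  unfolding weight_sum_def by (intro sum_pos weight_pos) auto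

text \<open>Summing by parts against the weights, which grow by the factor \<open>1/(1 - \<eta>)\<close> per step, turns a
  contraction by \<open>1 - q\<close> into an effective contraction gap \<open>q - \<eta>\<close>.\<close>

lemma weighted_sum_recursion:
  fixes a r :: "nat \<Rightarrow> real"
  assumes rec: "\<And>k. a (Suc k) \<le> (1 - q) * a k + r k"
    and a: "\<And>k. 0 \<le> a k" and \<eta>: "\<eta> < 1"
  shows "(q - \<eta>) * (\<Sum>k=0..K. weight \<eta> k * a k) \<le> a 0 + (\<Sum>k=0..K. weight \<eta> k * r k)"
proof -
  have step: "(q - \<eta>) * (weight \<eta> k * a k) + weight \<eta> k * a (Suc k)
      \<le> (1 - \<eta>) * (weight \<eta> k * a k) + weight \<eta> k * r k" for k
  proof -
    have "weight \<eta> k * a (Suc k) \<le> weight \<eta> k * ((1 - q) * a k + r k)"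
      using weight_pos[OF \<eta>, of k] by (intro mult_left_mono rec) auto
    then show ?thesis by (simp add: algebra_simps)
  qed
  have "(q - \<eta>) * (\<Sum>k=0..K. weight \<eta> k * a k) + weight \<eta> K * a (Suc K)
      \<le> a 0 + (\<Sum>k=0..K. weight \<eta> k * r k)"
  proof (induction K)
    case 0
    have "(1 - \<eta>) * weight \<eta> 0 = 1" using \<eta> by (simp add: weight_def)
    then show ?case using step[of 0] by (simp add: mult.assoc[symmetric])
  next
    case (Suc K)
    have "(1 - \<eta>) * (weight \<eta> (Suc K) * a (Suc K)) = weight \<eta> K * a (Suc K)"
      by (simp only: weight_Suc[OF \<eta>] mult.assoc[symmetric])
    then show ?case using Suc.IH step[of "Suc K"]
      by (simp only: sum.atLeast0_atMost_Suc distrib_left)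
  qed
  moreover have "0 \<le> weight \<eta> K * a (Suc K)"
    using a[of "Suc K"] weight_pos[OF \<eta>, of K] by simp
  ultimately show ?thesis by simp
qed

section \<open>Square-integrable random vectors\<close>

text \<open>Apart from the compressor, which comes with a second moment bound, each iteration only takes sums,
  averages and Lipschitz images. These preserve square integrability, and it makes every expectation
  that occurs exist.\<close>

definition square_integrable :: "'w measure \<Rightarrow> ('w \<Rightarrow> 'a::euclidean_space) \<Rightarrow> bool" where
  "square_integrable M X \<longleftrightarrow> X \<in> borel_measurable M \<and> integrable M (\<lambda>\<omega>. (norm (X \<omega>))\<^sup>2)"

lemma square_integrable_measurable: "square_integrable M X \<Longrightarrow> X \<in> borel_measurable M"
  by (simp add: square_integrable_def)

lemma square_integrable_norm: "square_integrable M X \<Longrightarrow> integrable M (\<lambda>\<omega>. (norm (X \<omega>))\<^sup>2)"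
  by (simp add: square_integrable_def)

lemma square_integrable_cong:
  assumes "\<And>\<omega>. \<omega> \<in> space M \<Longrightarrow> X \<omega> = Y \<omega>"
  shows "square_integrable M X \<longleftrightarrow> square_integrable M Y"
  unfolding square_integrable_def
  using assms by (intro conj_cong measurable_cong Bochner_Integration.integrable_cong refl) auto

lemma square_integrable_dominated:
  assumes "X \<in> borel_measurable M" "integrable M Y"
    and "\<And>\<omega>. \<omega> \<in> space M \<Longrightarrow> (norm (X \<omega>))\<^sup>2 \<le> Y \<omega>"
  shows "square_integrable M X"
  unfolding square_integrable_def
proof
  show "integrable M (\<lambda>\<omega>. (norm (X \<omega>))\<^sup>2)"
    using assms(1,3)
    by (intro Bochner_Integration.integrable_bound[OF assms(2)] AE_I2) (auto intro: order_trans[OF _ abs_ge_self])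
qed (fact assms(1))

lemma square_integrable_scaleR:
  assumes "square_integrable M X"
  shows "square_integrable M (\<lambda>\<omega>. a *\<^sub>R X \<omega>)"
  using assms unfolding square_integrable_def by (auto simp: power_mult_distrib)

lemma square_integrable_add:
  assumes "square_integrable M X" "square_integrable M Y"
  shows "square_integrable M (\<lambda>\<omega>. X \<omega> + Y \<omega>)"
proof (rule square_integrable_dominated[where Y = "\<lambda>\<omega>. 2 * (norm (X \<omega>))\<^sup>2 + 2 * (norm (Y \<omega>))\<^sup>2"])
  show "(\<lambda>\<omega>. X \<omega> + Y \<omega>) \<in> borel_measurable M"
    using assms by (auto simp: square_integrable_def)
qed (use assms in \<open>auto simp: square_integrable_def intro!: norm_add_square_le2\<close>)

lemma square_integrable_diff:
  assumes "square_integrable M X" "square_integrable M Y"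
  shows "square_integrable M (\<lambda>\<omega>. X \<omega> - Y \<omega>)"
  using square_integrable_add[OF assms(1) square_integrable_scaleR[OF assms(2), of "-1"]] by simp

lemma (in finite_measure) square_integrable_const: "square_integrable M (\<lambda>\<omega>. a)"
  by (simp add: square_integrable_def)

lemma (in finite_measure) square_integrable_sum:
  "(\<And>i. i \<in> I \<Longrightarrow> square_integrable M (X i)) \<Longrightarrow> square_integrable M (\<lambda>\<omega>. \<Sum>i\<in>I. X i \<omega>)"
  by (induction I rule: infinite_finite_induct) (auto intro: square_integrable_const square_integrable_add)

lemma (in finite_measure) square_integrable_avg:
  "(\<And>i. i \<in> {1..n} \<Longrightarrow> square_integrable M (X i)) \<Longrightarrow> square_integrable M (\<lambda>\<omega>. avg n (\<lambda>i. X i \<omega>))"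
  unfolding avg_def by (intro square_integrable_scaleR square_integrable_sum)

lemma integrable_inner_square_integrable:
  assumes "square_integrable M X" "square_integrable M Y"
  shows "integrable M (\<lambda>\<omega>. inner (X \<omega>) (Y \<omega>))"
proof -
  have "integrable M (\<lambda>\<omega>. ((norm (X \<omega> + Y \<omega>))\<^sup>2 - (norm (X \<omega>))\<^sup>2 - (norm (Y \<omega>))\<^sup>2) / 2)"
    using assms square_integrable_norm[OF square_integrable_add[OF assms]]
    by (auto simp: square_integrable_def)
  then show ?thesis by (simp add: dot_norm)
qed

lemma (in finite_measure) integrable_square_integrable:
  assumes "square_integrable M X"
  shows "integrable M X"
proof (rule Bochner_Integration.integrable_bound[where f = "\<lambda>\<omega>. 1 + (norm (X \<omega>))\<^sup>2"])
  have "t \<le> 1 + t\<^sup>2" for t :: real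
  proof (cases "1 \<le> t")
    case True
    then show ?thesis using self_le_power[of t 2] by simp
  next
    case False
    then show ?thesis using zero_le_power2[of t] by linarith
  qed
  then show "AE \<omega> in M. norm (X \<omega>) \<le> norm (1 + (norm (X \<omega>))\<^sup>2)" by simp
qed (use assms in \<open>auto simp: square_integrable_def\<close>)

lemma integrable_avg:
  fixes X :: "nat \<Rightarrow> 'w \<Rightarrow> real"
  assumes "\<And>i. i \<in> {1..n} \<Longrightarrow> integrable M (X i)"
  shows "integrable M (\<lambda>\<omega>. avg n (\<lambda>i. X i \<omega>))"
  unfolding avg_real using assms by (intro integrable_divide Bochner_Integration.integrable_sum)

lemma integral_avg:
  fixes X :: "nat \<Rightarrow> 'w \<Rightarrow> real"
  assumes "\<And>i. i \<in> {1..n} \<Longrightarrow> integrable M (X i)"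
  shows "(\<integral>\<omega>. avg n (\<lambda>i. X i \<omega>) \<partial>M) = avg n (\<lambda>i. \<integral>\<omega>. X i \<omega> \<partial>M)"
  unfolding avg_real using assms by (simp add: Bochner_Integration.integral_sum)

lemma measurable_avg [measurable]:
  fixes X :: "nat \<Rightarrow> 'w \<Rightarrow> 'a::euclidean_space"
  assumes "\<And>i. i \<in> {1..n} \<Longrightarrow> X i \<in> borel_measurable M"
  shows "(\<lambda>\<omega>. avg n (\<lambda>i. X i \<omega>)) \<in> borel_measurable M"
  unfolding avg_def using assms by measurable

lemma (in sigma_finite_subalgebra) real_cond_exp_avg:
  assumes "\<And>i. i \<in> {1..n} \<Longrightarrow> integrable M (X i)"
  shows "AE \<omega> in M. real_cond_exp M F (\<lambda>\<omega>. avg n (\<lambda>i. X i \<omega>)) \<omega>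
    = avg n (\<lambda>i. real_cond_exp M F (X i) \<omega>)"
proof -
  define X' where "X' i = (if i \<in> {1..n} then X i else (\<lambda>_. 0))" for i
  have int: "integrable M (X' i)" for i using assms by (simp add: X'_def)
  have X': "(\<Sum>i=1..n. h (X' i)) = (\<Sum>i=1..n. h (X i))" for h :: "_ \<Rightarrow> real"
    by (intro sum.cong) (auto simp: X'_def)
  have "AE \<omega> in M. real_cond_exp M F (\<lambda>\<omega>. (\<Sum>i=1..n. X' i \<omega>) / real n) \<omega>
      = real_cond_exp M F (\<lambda>\<omega>. \<Sum>i=1..n. X' i \<omega>) \<omega> / real n"
    using int by (intro real_cond_exp_cdiv Bochner_Integration.integrable_sum)
  moreover have "AE \<omega> in M. real_cond_exp M F (\<lambda>\<omega>. \<Sum>i=1..n. X' i \<omega>) \<omega>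
      = (\<Sum>i=1..n. real_cond_exp M F (X' i) \<omega>)"
    using int by (rule real_cond_exp_sum)
  ultimately show ?thesis
    by eventually_elim (simp only: avg_real X'[of "\<lambda>h. h _"] X'[of "\<lambda>h. real_cond_exp M F h _"])
qed

section \<open>Conditioning on the past of a fresh draw\<close>

text \<open>The \<open>\<sigma>\<close>-algebra \<open>F\<close> is the past and \<open>Z\<close> a draw with law \<open>N\<close>. The identity, seen as a map to the
  space with \<open>\<sigma>\<close>-algebra \<open>F\<close>, plays the role of the random variable that records the whole past;
  independence makes its joint law with \<open>Z\<close> a product.\<close>

locale fresh_draw = prob_space M
  for M :: "'w measure" +
  fixes F :: "'w measure" and N :: "'z measure" and Z :: "'w \<Rightarrow> 'z"
  assumes subalg: "subalgebra M F"
    and Z_measurable [measurable]: "Z \<in> measurable M N"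
    and indep: "indep_set (sets F) {Z -` B \<inter> space M |B. B \<in> sets N}"
    and law: "distr M N Z = N"
begin

abbreviation "past \<equiv> distr M F (\<lambda>\<omega>. \<omega>)"

lemma measurable_past: "h \<in> measurable F K \<Longrightarrow> h \<in> measurable M K"
  using measurable_from_subalg[OF subalg] .

lemma ident_measurable: "(\<lambda>\<omega>. \<omega>) \<in> measurable M F"
  by (rule measurable_past) simp

lemma pair_measurable: "(\<lambda>\<omega>. (\<omega>, Z \<omega>)) \<in> measurable M (F \<Otimes>\<^sub>M N)"
  by (rule measurable_Pair[OF ident_measurable Z_measurable])

lemma pair_past: "pair_prob_space past N"
proof -
  have "prob_space past" by (rule prob_space_distr) (rule ident_measurable)
  moreover have "prob_space N" using prob_space_distr[OF Z_measurable] law by simp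
  ultimately show ?thesis
    by (simp add: pair_prob_space_def pair_sigma_finite_def prob_space_imp_sigma_finite)
qed

lemma joint_law: "distr M (F \<Otimes>\<^sub>M N) (\<lambda>\<omega>. (\<omega>, Z \<omega>)) = past \<Otimes>\<^sub>M N"
proof (rule pair_measure_eqI[symmetric])
  interpret P: pair_prob_space past N by (rule pair_past)
  show "sigma_finite_measure past" "sigma_finite_measure N" by standard+
  fix A B assume "A \<in> sets past" and B: "B \<in> sets N"
  then have A: "A \<in> sets F" by simp
  then have AM: "A \<in> sets M" "A \<subseteq> space M"
    using subalg sets.sets_into_space by (auto simp: subalgebra_def)
  have "emeasure N B = emeasure (distr M N Z) B" by (simp add: law)
  also have "\<dots> = prob (Z -` B \<inter> space M)" using B by (simp add: emeasure_distr emeasure_eq_measure)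
  finally have NB: "emeasure N B = prob (Z -` B \<inter> space M)" .
  have "emeasure past A * emeasure N B = prob A * prob (Z -` B \<inter> space M)"
  proof -
    have "emeasure past A = emeasure M ((\<lambda>\<omega>. \<omega>) -` A \<inter> space M)"
      by (rule emeasure_distr[OF ident_measurable A])
    also have "(\<lambda>\<omega>. \<omega>) -` A \<inter> space M = A" using AM(2) by auto
    finally have "emeasure past A = prob A" unfolding emeasure_eq_measure .
    then show ?thesis by (simp only: NB ennreal_mult'[OF measure_nonneg])
  qed
  also have "\<dots> = prob (A \<inter> (Z -` B \<inter> space M))"
    using indep_setD[OF indep A, of "Z -` B \<inter> space M"] B by fastforce
  also have "A \<inter> (Z -` B \<inter> space M) = (\<lambda>\<omega>. (\<omega>, Z \<omega>)) -` (A \<times> B) \<inter> space M" by auto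
  finally show "emeasure past A * emeasure N B
      = emeasure (distr M (F \<Otimes>\<^sub>M N) (\<lambda>\<omega>. (\<omega>, Z \<omega>))) (A \<times> B)"
    unfolding emeasure_distr[OF pair_measurable pair_measureI[OF A B]] emeasure_eq_measure .
qed simp

lemma nn_integral_fresh:
  assumes [measurable]: "h \<in> borel_measurable (F \<Otimes>\<^sub>M N)"
  shows "(\<integral>\<^sup>+\<omega>. h (\<omega>, Z \<omega>) \<partial>M) = (\<integral>\<^sup>+\<omega>. \<integral>\<^sup>+z. h (\<omega>, z) \<partial>N \<partial>M)"
proof -
  interpret P: pair_prob_space past N by (rule pair_past)
  have "(\<integral>\<^sup>+\<omega>. h (\<omega>, Z \<omega>) \<partial>M) = (\<integral>\<^sup>+y. h y \<partial>(past \<Otimes>\<^sub>M N))"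
    unfolding joint_law[symmetric] by (simp add: nn_integral_distr[OF pair_measurable])
  also have "\<dots> = (\<integral>\<^sup>+\<omega>. \<integral>\<^sup>+z. h (\<omega>, z) \<partial>N \<partial>past)"
    by (rule P.M2.nn_integral_fst[symmetric]) simp
  also have "\<dots> = (\<integral>\<^sup>+\<omega>. \<integral>\<^sup>+z. h (\<omega>, z) \<partial>N \<partial>M)"
    using P.M2.borel_measurable_nn_integral_fst[of h F]
    by (simp add: nn_integral_distr[OF ident_measurable])
  finally show ?thesis .
qed

text \<open>Given the past, a fresh draw is integrated out with the past held fixed. On a past event \<open>A\<close> this
  is Fubini's theorem for the product of the law of the past and the law of the draw.\<close>

lemma cond_exp_fresh:
  fixes h :: "'w \<times> 'z \<Rightarrow> real"
  assumes h [measurable]: "h \<in> borel_measurable (F \<Otimes>\<^sub>M N)"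
    and int: "integrable M (\<lambda>\<omega>. h (\<omega>, Z \<omega>))"
  shows "AE \<omega> in M. real_cond_exp M F (\<lambda>\<omega>'. h (\<omega>', Z \<omega>')) \<omega> = (\<integral>z. h (\<omega>, z) \<partial>N)"
proof -
  interpret P: pair_prob_space past N by (rule pair_past)
  interpret finite_measure_subalgebra M F by standard (fact subalg)
  have hm: "(\<lambda>\<omega>. \<integral>z. h (\<omega>, z) \<partial>N) \<in> borel_measurable F"
    using P.M2.borel_measurable_lebesgue_integral[of "\<lambda>\<omega> z. h (\<omega>, z)" F] by simp
  have restrict: "integrable M (\<lambda>\<omega>. \<integral>z. h' (\<omega>, z) \<partial>N) \<and>
      (\<integral>\<omega>. h' (\<omega>, Z \<omega>) \<partial>M) = (\<integral>\<omega>. \<integral>z. h' (\<omega>, z) \<partial>N \<partial>M)"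
    if [measurable]: "h' \<in> borel_measurable (F \<Otimes>\<^sub>M N)" and int': "integrable M (\<lambda>\<omega>. h' (\<omega>, Z \<omega>))"
    for h' :: "'w \<times> 'z \<Rightarrow> real"
  proof -
    have hm': "(\<lambda>\<omega>. \<integral>z. h' (\<omega>, z) \<partial>N) \<in> borel_measurable F"
      using P.M2.borel_measurable_lebesgue_integral[of "\<lambda>\<omega> z. h' (\<omega>, z)" F] by simp
    have i: "integrable (past \<Otimes>\<^sub>M N) h'"
      unfolding joint_law[symmetric] using int' by (simp add: integrable_distr_eq[OF pair_measurable])
    have "(\<integral>\<omega>. h' (\<omega>, Z \<omega>) \<partial>M) = (\<integral>y. h' y \<partial>(past \<Otimes>\<^sub>M N))"
      unfolding joint_law[symmetric] by (simp add: integral_distr[OF pair_measurable])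
    also have "\<dots> = (\<integral>\<omega>. \<integral>z. h' (\<omega>, z) \<partial>N \<partial>past)"
      by (rule P.integral_fst'[OF i, symmetric])
    also have "\<dots> = (\<integral>\<omega>. \<integral>z. h' (\<omega>, z) \<partial>N \<partial>M)"
      using hm' by (simp add: integral_distr[OF ident_measurable])
    finally show ?thesis
      using P.integrable_fst'[OF i] hm' by (simp add: integrable_distr_eq[OF ident_measurable])
  qed
  show ?thesis
  proof (rule real_cond_exp_charact[OF _ int _ hm])
    show "integrable M (\<lambda>\<omega>. \<integral>z. h (\<omega>, z) \<partial>N)" using restrict[OF h int] by simp
    fix A assume A [measurable]: "A \<in> sets F"
    then have [measurable]: "A \<in> sets M" using subalg by (auto simp: subalgebra_def)
    define h' where "h' = (\<lambda>y :: 'w \<times> 'z. indicator A (fst y) * h y)"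
    have [measurable]: "h' \<in> borel_measurable (F \<Otimes>\<^sub>M N)" unfolding h'_def by measurable
    have "integrable M (\<lambda>\<omega>. h' (\<omega>, Z \<omega>))"
      using integrable_mult_indicator[OF \<open>A \<in> sets M\<close> int] by (simp add: h'_def)
    then have "(\<integral>\<omega>. h' (\<omega>, Z \<omega>) \<partial>M) = (\<integral>\<omega>. \<integral>z. h' (\<omega>, z) \<partial>N \<partial>M)"
      using restrict[of h'] by simp
    then show "(\<integral>\<omega>\<in>A. h (\<omega>, Z \<omega>) \<partial>M) = (\<integral>\<omega>\<in>A. (\<integral>z. h (\<omega>, z) \<partial>N) \<partial>M)"
      by (simp add: h'_def set_lebesgue_integral_def)
  qed
qed

text \<open>If only a finitely valued part \<open>\<tau>\<close> of the draw matters, integrability of each of the finitely many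
  cases is enough.\<close>

lemma finite_fresh:
  fixes H :: "'b \<Rightarrow> 'w \<Rightarrow> real"
  assumes \<tau> [measurable]: "\<tau> \<in> measurable N (count_space B)" and B: "finite B"
    and meas: "\<And>b. b \<in> B \<Longrightarrow> H b \<in> borel_measurable F"
    and int: "\<And>b. b \<in> B \<Longrightarrow> integrable M (H b)"
  shows "integrable M (\<lambda>\<omega>. H (\<tau> (Z \<omega>)) \<omega>)"
    and "AE \<omega> in M. real_cond_exp M F (\<lambda>\<omega>'. H (\<tau> (Z \<omega>')) \<omega>') \<omega> = (\<integral>z. H (\<tau> z) \<omega> \<partial>N)"
proof -
  have h: "(\<lambda>y. H (\<tau> (snd y)) (fst y)) \<in> borel_measurable (F \<Otimes>\<^sub>M N)"
    by (rule measurable_compose_countable'[where I = B])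
      (auto intro: measurable_compose[OF measurable_fst meas] countable_finite B)
  have hZ: "(\<lambda>\<omega>. H (\<tau> (Z \<omega>)) \<omega>) \<in> borel_measurable M"
    by (rule measurable_compose_countable'[where I = B])
      (auto intro: measurable_past[OF meas] countable_finite B)
  have range: "\<tau> (Z \<omega>) \<in> B" if "\<omega> \<in> space M" for \<omega>
    using measurable_space[OF measurable_compose[OF Z_measurable \<tau>] that] by simp
  show *: "integrable M (\<lambda>\<omega>. H (\<tau> (Z \<omega>)) \<omega>)"
  proof (rule Bochner_Integration.integrable_bound[OF _ hZ])
    show "integrable M (\<lambda>\<omega>. \<Sum>b\<in>B. \<bar>H b \<omega>\<bar>)" using int by auto
    show "AE \<omega> in M. norm (H (\<tau> (Z \<omega>)) \<omega>) \<le> norm (\<Sum>b\<in>B. \<bar>H b \<omega>\<bar>)"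
    proof (rule AE_I2)
      fix \<omega> assume "\<omega> \<in> space M"
      then have "\<bar>H (\<tau> (Z \<omega>)) \<omega>\<bar> \<le> (\<Sum>b\<in>B. \<bar>H b \<omega>\<bar>)"
        using range B by (intro member_le_sum[of _ B "\<lambda>b. \<bar>H b \<omega>\<bar>"]) auto
      then show "norm (H (\<tau> (Z \<omega>)) \<omega>) \<le> norm (\<Sum>b\<in>B. \<bar>H b \<omega>\<bar>)" by simp
    qed
  qed
  show "AE \<omega> in M. real_cond_exp M F (\<lambda>\<omega>'. H (\<tau> (Z \<omega>')) \<omega>') \<omega> = (\<integral>z. H (\<tau> z) \<omega> \<partial>N)"
    using cond_exp_fresh[OF h] * by simp
qed

end

section \<open>The law of one draw\<close>

lemma draw_index_measurable: "fst \<in> measurable (draw_law S m p) (count_space {1..m})"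
proof -
  have "fst \<in> measurable (draw_law S m p) (uniform_count_measure {1..m})"
    unfolding draw_law_def by simp
  then show ?thesis
    by (simp only: measurable_cong_sets[OF refl sets_uniform_count_measure_count_space])
qed

lemma draw_seed_measurable: "(\<lambda>z. fst (snd z)) \<in> measurable (draw_law S m p) S"
  unfolding draw_law_def by simp

lemma draw_coin_measurable: "(\<lambda>z. snd (snd z)) \<in> measurable (draw_law S m p) (count_space UNIV)"
proof -
  have "(\<lambda>z. snd (snd z)) \<in> measurable (draw_law S m p) (measure_pmf (bernoulli_pmf p))"
    unfolding draw_law_def by simp
  then show ?thesis by simp
qed

lemma integral_draw_index:
  fixes \<phi> :: "nat \<Rightarrow> real"
  assumes "prob_space S"
  shows "(\<integral>z. \<phi> (fst z) \<partial>draw_law S m p) = avg m \<phi>"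
proof -
  interpret R: prob_space "S \<Otimes>\<^sub>M measure_pmf (bernoulli_pmf p)"
    using assms by (intro prob_space_pair measure_pmf.prob_space_axioms)
  have "avg m \<phi> = (\<integral>l. \<phi> l \<partial>uniform_count_measure {1..m})"
    by (simp add: integral_uniform_count_measure avg_real)
  also have "\<dots> = (\<integral>l. \<phi> l \<partial>distr (draw_law S m p) (uniform_count_measure {1..m}) fst)"
    unfolding draw_law_def by (simp only: R.distr_pair_fst)
  also have "\<dots> = (\<integral>z. \<phi> (fst z) \<partial>draw_law S m p)"
    unfolding draw_law_def by (intro integral_distr measurable_fst)
      (auto simp: measurable_def space_uniform_count_measure sets_uniform_count_measure)
  finally show ?thesis ..
qed

lemma integral_draw_coin:
  fixes \<phi> :: "bool \<Rightarrow> real"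
  assumes "prob_space S" "1 \<le> m" "0 \<le> p" "p \<le> 1"
  shows "(\<integral>z. \<phi> (snd (snd z)) \<partial>draw_law S m p) = p * \<phi> True + (1 - p) * \<phi> False"
proof -
  let ?B = "measure_pmf (bernoulli_pmf p)" and ?U = "uniform_count_measure {1..m}"
  interpret S: prob_space S by fact
  interpret SB: pair_prob_space S ?B ..
  interpret U: prob_space ?U using assms by (intro prob_space_uniform_count_measure) auto
  interpret P: pair_prob_space ?U "S \<Otimes>\<^sub>M ?B" ..
  have coin: "(\<lambda>z. snd (snd z)) \<in> measurable (?U \<Otimes>\<^sub>M (S \<Otimes>\<^sub>M ?B)) ?B" by simp
  have snd: "distr (A \<Otimes>\<^sub>M B) B snd = B" if "prob_space A" "prob_space B" for A :: "'c measure" and B :: "'d measure"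
  proof -
    interpret A: prob_space A by fact
    interpret B: prob_space B by fact
    interpret AB: pair_prob_space A B ..
    show ?thesis
    proof (rule measure_eqI)
      fix X assume "X \<in> sets (distr (A \<Otimes>\<^sub>M B) B snd)"
      then have X: "X \<in> sets B" by simp
      then have "snd -` X \<inter> space (A \<Otimes>\<^sub>M B) = space A \<times> X"
        using sets.sets_into_space by (auto simp: space_pair_measure)
      with X show "emeasure (distr (A \<Otimes>\<^sub>M B) B snd) X = emeasure B X"
        by (simp add: emeasure_distr B.emeasure_pair_measure_Times A.emeasure_space_1)
    qed simp
  qed
  have "(\<integral>z. \<phi> (snd (snd z)) \<partial>draw_law S m p) = (\<integral>y. \<phi> (snd y) \<partial>distr (draw_law S m p) (S \<Otimes>\<^sub>M ?B) snd)"
    by (simp add: integral_distr draw_law_def)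
  also have "\<dots> = (\<integral>y. \<phi> (snd y) \<partial>(S \<Otimes>\<^sub>M ?B))"
    unfolding draw_law_def by (simp only: snd[OF U.prob_space_axioms SB.prob_space_axioms])
  also have "\<dots> = (\<integral>b. \<phi> b \<partial>distr (S \<Otimes>\<^sub>M ?B) ?B snd)"
    by (simp add: integral_distr)
  also have "\<dots> = (\<integral>b. \<phi> b \<partial>?B)"
    by (simp only: snd[OF S.prob_space_axioms measure_pmf.prob_space_axioms])
  finally show ?thesis using assms by simp
qed

text \<open>The seed is drawn independently of the index, so the compression bound applies for each value of
  the index separately.\<close>

lemma nn_integral_draw_compression:
  fixes C :: "'s \<Rightarrow> 'a::euclidean_space \<Rightarrow> 'a"
  assumes C: "compression_operator S \<delta> C" and m: "1 \<le> m"
  shows "(\<integral>\<^sup>+z. ennreal ((norm (C (fst (snd z)) (u (fst z)) - u (fst z)))\<^sup>2) \<partial>draw_law S m p)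
    \<le> ennreal ((1 - \<delta>) * avg m (\<lambda>l. (norm (u l))\<^sup>2))"
proof -
  let ?B = "measure_pmf (bernoulli_pmf p)" and ?U = "uniform_count_measure {1..m}"
  interpret S: prob_space S using C by (simp add: compression_operator_def)
  interpret SB: pair_prob_space S ?B ..
  have \<delta>: "\<delta> \<le> 1" using C by (simp add: compression_operator_def)
  have Cm [measurable]: "(\<lambda>y. C (fst y) (snd y)) \<in> borel_measurable (S \<Otimes>\<^sub>M borel)"
    using C by (simp add: compression_operator_def case_prod_beta')
  have Cu: "(\<lambda>s. C s (u l)) \<in> borel_measurable S" for l
    using measurable_compose[OF _ Cm, of "\<lambda>s. (s, u l)" S] by simp
  define h :: "nat \<times> 's \<times> bool \<Rightarrow> ennreal" where "h = (\<lambda>z. ennreal ((norm (C (fst (snd z)) (u (fst z)) - u (fst z)))\<^sup>2))"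
  have h: "h \<in> borel_measurable (?U \<Otimes>\<^sub>M (S \<Otimes>\<^sub>M ?B))"
    unfolding h_def
  proof (rule measurable_compose_countable'[where I = "{1..m}" and g = fst
        and f = "\<lambda>l z. ennreal ((norm (C (fst (snd z)) (u l) - u l))\<^sup>2)"])
    show "(\<lambda>z. ennreal ((norm (C (fst (snd z)) (u l) - u l))\<^sup>2))
        \<in> borel_measurable (?U \<Otimes>\<^sub>M (S \<Otimes>\<^sub>M ?B))" for l
      using measurable_compose[OF draw_seed_measurable[unfolded draw_law_def] Cu] by simp
    show "fst \<in> measurable (?U \<Otimes>\<^sub>M (S \<Otimes>\<^sub>M ?B)) (count_space {1..m})"
      using draw_index_measurable unfolding draw_law_def .
  qed simp
  have inner: "(\<integral>\<^sup>+y. h (l, y) \<partial>(S \<Otimes>\<^sub>M ?B)) \<le> ennreal ((1 - \<delta>) * (norm (u l))\<^sup>2)" for l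
  proof -
    have "(\<integral>\<^sup>+y. h (l, y) \<partial>(S \<Otimes>\<^sub>M ?B))
        = (\<integral>\<^sup>+s. ennreal ((norm (C s (u l) - u l))\<^sup>2) \<partial>distr (S \<Otimes>\<^sub>M ?B) S fst)"
      using Cu by (subst nn_integral_distr) (auto simp: h_def)
    also have "\<dots> \<le> ennreal ((1 - \<delta>) * (norm (u l))\<^sup>2)"
      using C by (simp add: measure_pmf.distr_pair_fst compression_operator_def)
    finally show ?thesis .
  qed
  have "(\<integral>\<^sup>+z. h z \<partial>draw_law S m p) = (\<integral>\<^sup>+l. \<integral>\<^sup>+y. h (l, y) \<partial>(S \<Otimes>\<^sub>M ?B) \<partial>?U)"
    unfolding draw_law_def by (rule SB.nn_integral_fst[symmetric]) (fact h)
  also have "\<dots> \<le> (\<integral>\<^sup>+l. ennreal ((1 - \<delta>) * (norm (u l))\<^sup>2) \<partial>?U)"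
    by (intro nn_integral_mono inner)
  also have "\<dots> = ennreal (\<integral>l. (1 - \<delta>) * (norm (u l))\<^sup>2 \<partial>?U)"
    using \<delta> by (intro nn_integral_eq_integral)
      (auto simp: uniform_count_measure_def integrable_point_measure_finite)
  also have "(\<integral>l. (1 - \<delta>) * (norm (u l))\<^sup>2 \<partial>?U) = (1 - \<delta>) * avg m (\<lambda>l. (norm (u l))\<^sup>2)"
    by (simp add: integral_uniform_count_measure avg_real sum_distrib_left)
  finally show ?thesis by (simp add: h_def)
qed

text \<open>The history is generated by the draws with earlier index, a family disjoint from the current
  draw, so both generate independent \<open>\<sigma>\<close>-algebras.\<close>

lemma fresh_draws_fresh_draw:
  assumes "fresh_draws M S n m p Z" and i: "i \<in> {1..n}"
  shows "fresh_draw M (history M S n m p Z k) (draw_law S m p) (Z k i)"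
proof -
  interpret prob_space M using assms by (simp add: fresh_draws_def)
  let ?N = "draw_law S m p" and ?F = "history M S n m p Z k"
  define E where "E = (\<lambda>(j, i). {Z j i -` U \<inter> space M |U. U \<in> sets ?N})"
  define I where "I = case_bool ({..<k} \<times> {1..n}) {(k, i)}"
  have iv: "indep_vars (\<lambda>_. ?N) (\<lambda>(k, i). Z k i) (UNIV \<times> {1..n})"
    using assms by (simp add: fresh_draws_def)
  have rv: "Z j i' \<in> measurable M ?N" if "i' \<in> {1..n}" for j i'
    using iv that by (auto simp: indep_vars_def2)
  have sub: "(\<Union>b. I b) \<subseteq> UNIV \<times> {1..n}" using i by (auto simp: I_def split: bool.splits)
  have "indep_sets E (UNIV \<times> {1..n})"
    using iv by (simp add: indep_vars_def2 E_def case_prod_beta')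
  then have "indep_sets E (\<Union>b\<in>UNIV. I b)"
    using sub by (rule indep_sets_mono_index[rotated]) 
  then have ind: "indep_sets (\<lambda>b. sigma_sets (space M) (\<Union>y\<in>I b. E y)) UNIV"
  proof (rule indep_sets_collect_sigma)
    show "Int_stable (E y)" for y
    proof (rule Int_stableI)
      fix A B assume "A \<in> E y" "B \<in> E y"
      then obtain U V where "U \<in> sets ?N" "V \<in> sets ?N"
        "A = case_prod Z y -` U \<inter> space M" "B = case_prod Z y -` V \<inter> space M"
        by (auto simp: E_def case_prod_beta')
      then show "A \<inter> B \<in> E y"
        by (auto simp: E_def case_prod_beta' intro!: exI[of _ "U \<inter> V"])
    qed
    show "disjoint_family_on I UNIV"
      by (auto simp: disjoint_family_on_def I_def split: bool.splits)
  qed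
  have gen: "{Z j i -` U \<inter> space M | j i U. j < k \<and> i \<in> {1..n} \<and> U \<in> sets ?N} = (\<Union>y\<in>I True. E y)"
  proof (intro set_eqI iffI)
    fix A assume "A \<in> {Z j i -` U \<inter> space M | j i U. j < k \<and> i \<in> {1..n} \<and> U \<in> sets ?N}"
    then obtain j i' where "j < k" "i' \<in> {1..n}" "A \<in> E (j, i')" by (auto simp: E_def)
    then show "A \<in> (\<Union>y\<in>I True. E y)" unfolding I_def by (intro UN_I[of "(j, i')"]) simp_all
  next
    fix A assume "A \<in> (\<Union>y\<in>I True. E y)"
    then obtain j i' where "j < k" "i' \<in> {1..n}" "A \<in> E (j, i')" unfolding I_def by auto
    then show "A \<in> {Z j i -` U \<inter> space M | j i U. j < k \<and> i \<in> {1..n} \<and> U \<in> sets ?N}"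
      unfolding E_def prod.case by blast
  qed
  have spF: "space ?F = space M"
    unfolding history_def by (rule space_measure_of) auto
  have setsF: "sets ?F = sigma_sets (space M) (\<Union>y\<in>I True. E y)"
    unfolding history_def gen[symmetric] by (rule sets_measure_of) auto
  have "E y \<subseteq> sets M" if "y \<in> I True" for y
    using that rv by (auto simp: E_def I_def intro: measurable_sets)
  then have subalg: "subalgebra M ?F"
    unfolding subalgebra_def setsF spF by (auto intro!: sets.sigma_sets_subset)
  have 2: "{Z k i -` A \<inter> space M |A. A \<in> sets ?N} \<subseteq> sigma_sets (space M) (\<Union>y\<in>I False. E y)"
    by (auto simp: I_def E_def)
  have "indep_set (sets ?F) {Z k i -` A \<inter> space M |A. A \<in> sets ?N}"
    unfolding indep_set_def
    using ind by (rule indep_sets_mono_sets) (use 2 in \<open>auto simp: setsF split: bool.splits\<close>)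
  moreover have "Z k i \<in> measurable M ?N" using rv i by simp
  moreover have "distr M ?N (Z k i) = ?N" using assms by (simp add: fresh_draws_def)
  ultimately show ?thesis using subalg by unfold_locales
qed

lemma history_measurable_draw:
  assumes "fresh_draws M S n m p Z" and "i \<in> {1..n}" "j < k"
  shows "Z j i \<in> measurable (history M S n m p Z k) (draw_law S m p)"
proof (rule measurableI)
  interpret prob_space M using assms by (simp add: fresh_draws_def)
  have iv: "indep_vars (\<lambda>_. draw_law S m p) (\<lambda>(k, i). Z k i) (UNIV \<times> {1..n})"
    using assms by (simp add: fresh_draws_def)
  have rv: "Z j i \<in> measurable M (draw_law S m p)"
    using iv assms by (auto simp: indep_vars_def2)
  have sp: "space (history M S n m p Z k) = space M"
    unfolding history_def by (rule space_measure_of) auto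
  fix \<omega> assume "\<omega> \<in> space (history M S n m p Z k)"
  then show "Z j i \<omega> \<in> space (draw_law S m p)" using measurable_space[OF rv] by (simp add: sp)
next
  have sp: "space (history M S n m p Z k) = space M"
    unfolding history_def by (rule space_measure_of) auto
  fix U assume "U \<in> sets (draw_law S m p)"
  then show "Z j i -` U \<inter> space (history M S n m p Z k) \<in> sets (history M S n m p Z k)"
    unfolding sp using assms unfolding history_def
    by (intro in_measure_of) auto
qed

lemma subalgebra_history_mono:
  assumes "j \<le> k"
  shows "subalgebra (history M S n m p Z k) (history M S n m p Z j)"
proof -
  have "sigma_sets (space M) {Z j' i -` U \<inter> space M | j' i U. j' < j \<and> i \<in> {1..n} \<and> U \<in> sets (draw_law S m p)}
     \<subseteq> sigma_sets (space M) {Z j i -` U \<inter> space M | j i U. j < k \<and> i \<in> {1..n} \<and> U \<in> sets (draw_law S m p)}"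
    using assms by (intro sigma_sets_mono') (auto intro: less_le_trans)
  moreover have "space (history M S n m p Z i) = space M" for i
    unfolding history_def by (rule space_measure_of) auto
  moreover have "sets (history M S n m p Z k') = sigma_sets (space M)
      {Z j i -` U \<inter> space M | j i U. j < k' \<and> i \<in> {1..n} \<and> U \<in> sets (draw_law S m p)}" for k'
    unfolding history_def by (rule sets_measure_of) auto
  ultimately show ?thesis by (simp add: subalgebra_def)
qed

section \<open>Moments along the run of the algorithm\<close>

text \<open>The third bound on \<open>\<gamma>\<close> is the form in which the second part of the step size condition is used;
  it follows from that condition because \<open>1/(1 - p) \<ge> 1\<close>.\<close>

locale ec_lsvrg_process = smooth_convex_finite_sum n m fs xs L
  for n m :: nat and fs :: "nat \<Rightarrow> nat \<Rightarrow> 'a::euclidean_space \<Rightarrow> real" and xs :: 'a and L :: real +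
  fixes \<mu> \<delta> p \<gamma> :: real
    and M :: "'w measure" and S :: "'s measure" and C :: "'s \<Rightarrow> 'a \<Rightarrow> 'a"
    and Z :: "nat \<Rightarrow> nat \<Rightarrow> 'w \<Rightarrow> nat \<times> 's \<times> bool"
    and x0 :: 'a and w0 :: "nat \<Rightarrow> 'a"
    and x :: "nat \<Rightarrow> 'w \<Rightarrow> 'a"
    and w e g v :: "nat \<Rightarrow> nat \<Rightarrow> 'w \<Rightarrow> 'a"
  assumes \<mu>: "0 \<le> \<mu>"
    and qsc: "\<And>x. gap x + \<mu> / 2 * (norm (x - xs))\<^sup>2 \<le> inner (grad f x) (x - xs)"
    and compression: "compression_operator S \<delta> C"
    and p: "0 < p" "p < 1"
    and \<gamma>: "0 < \<gamma>" "\<gamma> \<le> 1 / (24 * L)" "\<gamma>\<^sup>2 * L\<^sup>2 * (192 * (2 + 9 * \<delta>)) \<le> \<delta>\<^sup>2"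
    and fresh_draws: "fresh_draws M S n m p Z"
    and run: "ec_lsvrg M n m fs C \<gamma> x0 w0 Z x w e g v"
begin

abbreviation "F k \<equiv> history M S n m p Z k"
abbreviation "law \<equiv> draw_law S m p"
abbreviation "idx k i \<omega> \<equiv> fst (Z k i \<omega>)"
abbreviation "seed k i \<omega> \<equiv> fst (snd (Z k i \<omega>))"
abbreviation "coin k i \<omega> \<equiv> snd (snd (Z k i \<omega>))"

abbreviation "gm k \<omega> \<equiv> avg n (\<lambda>i. g k i \<omega>)"
abbreviation "em k \<omega> \<equiv> avg n (\<lambda>i. e k i \<omega>)"
abbreviation "sig k \<omega> \<equiv> \<sigma>2 (\<lambda>i. w k i \<omega>)"

lemma \<delta>: "0 < \<delta>" "\<delta> \<le> 1"
  using compression by (simp_all add: compression_operator_def)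

lemma prob_space_S: "prob_space S"
  using compression by (simp add: compression_operator_def)

sublocale prob_space M
  using fresh_draws by (simp add: fresh_draws_def)

lemma fresh: "i \<in> {1..n} \<Longrightarrow> fresh_draw M (F k) law (Z k i)"
  using fresh_draws_fresh_draw[OF fresh_draws] .

lemma space_F [simp]: "space (F k) = space M"
  unfolding history_def by (rule space_measure_of) auto

lemma subalg: "subalgebra M (F k)"
proof -
  have "1 \<in> {1..n}" using n by simp
  then show ?thesis using fresh_draw.subalg[OF fresh] by blast
qed

lemma measurable_F: "h \<in> measurable (F k) K \<Longrightarrow> h \<in> measurable M K"
  using measurable_from_subalg[OF subalg] .

lemma measurable_F_Suc: "h \<in> measurable (F k) K \<Longrightarrow> h \<in> measurable (F (Suc k)) K"
  using measurable_from_subalg[OF subalgebra_history_mono[of k "Suc k"]] by simp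

lemma run0:
  assumes "\<omega> \<in> space M"
  shows "x 0 \<omega> = x0" and "i \<in> {1..n} \<Longrightarrow> w 0 i \<omega> = w0 i" and "i \<in> {1..n} \<Longrightarrow> e 0 i \<omega> = 0"
  using run assms by (auto simp: ec_lsvrg_def)

lemma run_x: "\<omega> \<in> space M \<Longrightarrow> x (Suc k) \<omega> = x k \<omega> - avg n (\<lambda>i. v k i \<omega>)"
  using run by (simp add: ec_lsvrg_def)

lemma run_i:
  assumes "\<omega> \<in> space M" "i \<in> {1..n}"
  shows "g k i \<omega> = svrg i (x k \<omega>) (w k i \<omega>) (idx k i \<omega>)"
    and "v k i \<omega> = C (seed k i \<omega>) (e k i \<omega> + \<gamma> *\<^sub>R g k i \<omega>)"
    and "e (Suc k) i \<omega> = e k i \<omega> + \<gamma> *\<^sub>R g k i \<omega> - v k i \<omega>"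
    and "w (Suc k) i \<omega> = (if coin k i \<omega> then x k \<omega> else w k i \<omega>)"
proof -
  obtain l s c where Z: "Z k i \<omega> = (l, s, c)" by (cases "Z k i \<omega>") auto
  have "case Z k i \<omega> of (l, s, c) \<Rightarrow>
             g k i \<omega> = dfs i l (x k \<omega>) - dfs i l (w k i \<omega>) + dloc i (w k i \<omega>) \<and>
             v k i \<omega> = C s (e k i \<omega> + \<gamma> *\<^sub>R g k i \<omega>) \<and>
             e (Suc k) i \<omega> = e k i \<omega> + \<gamma> *\<^sub>R g k i \<omega> - v k i \<omega> \<and>
             w (Suc k) i \<omega> = (if c then x k \<omega> else w k i \<omega>)"
    using run assms by (simp add: ec_lsvrg_def)
  then show "g k i \<omega> = svrg i (x k \<omega>) (w k i \<omega>) (idx k i \<omega>)"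
    and "v k i \<omega> = C (seed k i \<omega>) (e k i \<omega> + \<gamma> *\<^sub>R g k i \<omega>)"
    and "e (Suc k) i \<omega> = e k i \<omega> + \<gamma> *\<^sub>R g k i \<omega> - v k i \<omega>"
    and "w (Suc k) i \<omega> = (if coin k i \<omega> then x k \<omega> else w k i \<omega>)"
    by (simp_all add: Z svrg_def)
qed

lemma dfs_measurable:
  assumes "i \<in> {1..n}" "j \<in> {1..m}" "X \<in> borel_measurable K"
  shows "(\<lambda>\<omega>. dfs i j (X \<omega>)) \<in> borel_measurable K"
proof -
  have "continuous_on UNIV (dfs i j)"
    using lip_fs[OF assms(1,2)] by (rule lipschitz_on_continuous_on)
  then show ?thesis
    using assms(3) by (intro measurable_compose[OF assms(3)] borel_measurable_continuous_onI)
qed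

lemma dloc_measurable:
  assumes "i \<in> {1..n}" "X \<in> borel_measurable K"
  shows "(\<lambda>\<omega>. dloc i (X \<omega>)) \<in> borel_measurable K"
  unfolding dloc_eq[OF assms(1)] using assms by (intro measurable_avg dfs_measurable)

lemma svrg_measurable:
  assumes "i \<in> {1..n}" "l \<in> {1..m}" "X \<in> borel_measurable K" "W \<in> borel_measurable K"
  shows "(\<lambda>\<omega>. svrg i (X \<omega>) (W \<omega>) l) \<in> borel_measurable K"
  unfolding svrg_def using assms
  by (intro borel_measurable_add borel_measurable_diff dfs_measurable dloc_measurable)

lemma dfs_square_integrable:
  assumes "i \<in> {1..n}" "j \<in> {1..m}" "square_integrable M X"
  shows "square_integrable M (\<lambda>\<omega>. dfs i j (X \<omega>))"
proof -
  have "square_integrable M (\<lambda>\<omega>. dfs i j (X \<omega>) - dfs i j 0)"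
  proof (rule square_integrable_dominated)
    show "integrable M (\<lambda>\<omega>. L\<^sup>2 * (norm (X \<omega>))\<^sup>2)"
      using assms by (simp add: square_integrable_norm)
    show "(norm (dfs i j (X \<omega>) - dfs i j 0))\<^sup>2 \<le> L\<^sup>2 * (norm (X \<omega>))\<^sup>2" for \<omega>
      using dist_dfs_square_le[OF assms(1,2), of "X \<omega>" 0] by simp
  qed (intro borel_measurable_diff dfs_measurable assms square_integrable_measurable borel_measurable_const)
  from square_integrable_add[OF this square_integrable_const[of "dfs i j 0"]] show ?thesis by simp
qed

lemma dloc_square_integrable:
  assumes "i \<in> {1..n}" "square_integrable M X"
  shows "square_integrable M (\<lambda>\<omega>. dloc i (X \<omega>))"
  unfolding dloc_eq[OF assms(1)] using assms by (intro square_integrable_avg dfs_square_integrable)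

lemma svrg_square_integrable:
  assumes "i \<in> {1..n}" "l \<in> {1..m}" "square_integrable M X" "square_integrable M W"
  shows "square_integrable M (\<lambda>\<omega>. svrg i (X \<omega>) (W \<omega>) l)"
  unfolding svrg_def using assms
  by (intro square_integrable_add square_integrable_diff dfs_square_integrable dloc_square_integrable)

lemma cond_exp_subalgebra: "finite_measure_subalgebra M (F k)"
  by standard (fact subalg)

lemma cond_exp_cong_space:
  assumes "\<And>\<omega>. \<omega> \<in> space M \<Longrightarrow> Y \<omega> = X \<omega>" and "integrable M X"
  shows "AE \<omega> in M. real_cond_exp M (F k) Y \<omega> = real_cond_exp M (F k) X \<omega>"
proof -
  interpret finite_measure_subalgebra M "F k" by (rule cond_exp_subalgebra)
  have "integrable M Y"
    using assms by (subst Bochner_Integration.integrable_cong[OF refl, where g = X]) auto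
  then show ?thesis using assms by (intro real_cond_exp_cong) auto
qed

lemma fresh_index:
  fixes H :: "nat \<Rightarrow> 'w \<Rightarrow> real"
  assumes i: "i \<in> {1..n}"
    and meas: "\<And>l. l \<in> {1..m} \<Longrightarrow> H l \<in> borel_measurable (F k)"
    and int: "\<And>l. l \<in> {1..m} \<Longrightarrow> integrable M (H l)"
    and Y: "\<And>\<omega>. \<omega> \<in> space M \<Longrightarrow> Y \<omega> = H (idx k i \<omega>) \<omega>"
  shows "integrable M Y"
    and "AE \<omega> in M. real_cond_exp M (F k) Y \<omega> = avg m (\<lambda>l. H l \<omega>)"
    and "(\<integral>\<omega>. Y \<omega> \<partial>M) = (\<integral>\<omega>. avg m (\<lambda>l. H l \<omega>) \<partial>M)"
proof -
  interpret fresh_draw M "F k" law "Z k i" using i by (rule fresh)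
  interpret finite_measure_subalgebra M "F k" by (rule cond_exp_subalgebra)
  have 0: "integrable M (\<lambda>\<omega>. H (idx k i \<omega>) \<omega>)"
    by (rule finite_fresh[OF draw_index_measurable _ meas int]) auto
  then show 1: "integrable M Y"
    using Y by (subst Bochner_Integration.integrable_cong[OF refl]) auto
  have "(\<integral>z. H (fst z) \<omega> \<partial>law) = avg m (\<lambda>l. H l \<omega>)" for \<omega>
    by (rule integral_draw_index[OF prob_space_S])
  then have "AE \<omega> in M. real_cond_exp M (F k) (\<lambda>\<omega>'. H (idx k i \<omega>') \<omega>') \<omega> = avg m (\<lambda>l. H l \<omega>)"
    using finite_fresh(2)[where \<tau> = fst, OF draw_index_measurable finite_atLeastAtMost, of H] meas int
    by simp
  moreover have "AE \<omega> in M. real_cond_exp M (F k) Y \<omega>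
      = real_cond_exp M (F k) (\<lambda>\<omega>'. H (idx k i \<omega>') \<omega>') \<omega>"
    by (rule cond_exp_cong_space[OF _ 0]) (rule Y)
  ultimately
  show 2: "AE \<omega> in M. real_cond_exp M (F k) Y \<omega> = avg m (\<lambda>l. H l \<omega>)"
    by eventually_elim simp
  have "(\<integral>\<omega>. Y \<omega> \<partial>M) = (\<integral>\<omega>. real_cond_exp M (F k) Y \<omega> \<partial>M)"
    using real_cond_exp_int(2)[OF 1] by simp
  also have "\<dots> = (\<integral>\<omega>. avg m (\<lambda>l. H l \<omega>) \<partial>M)"
  proof (rule integral_cong_AE[OF _ _ 2])
    show "(\<lambda>\<omega>. avg m (\<lambda>l. H l \<omega>)) \<in> borel_measurable M"
      using int by (intro measurable_avg) auto
  qed simp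
  finally show "(\<integral>\<omega>. Y \<omega> \<partial>M) = (\<integral>\<omega>. avg m (\<lambda>l. H l \<omega>) \<partial>M)" .
qed

lemma fresh_coin:
  fixes H :: "bool \<Rightarrow> 'w \<Rightarrow> real"
  assumes i: "i \<in> {1..n}"
    and meas: "\<And>b. H b \<in> borel_measurable (F k)"
    and int: "\<And>b. integrable M (H b)"
    and Y: "\<And>\<omega>. \<omega> \<in> space M \<Longrightarrow> Y \<omega> = H (coin k i \<omega>) \<omega>"
  shows "integrable M Y"
    and "AE \<omega> in M. real_cond_exp M (F k) Y \<omega> = p * H True \<omega> + (1 - p) * H False \<omega>"
proof -
  interpret fresh_draw M "F k" law "Z k i" using i by (rule fresh)
  have 0: "integrable M (\<lambda>\<omega>. H (coin k i \<omega>) \<omega>)"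
    by (rule finite_fresh[OF draw_coin_measurable _ meas int]) auto
  then show "integrable M Y"
    using Y by (subst Bochner_Integration.integrable_cong[OF refl]) auto
  have "(\<integral>z. H (snd (snd z)) \<omega> \<partial>law) = p * H True \<omega> + (1 - p) * H False \<omega>" for \<omega>
    using integral_draw_coin[OF prob_space_S m, of p "\<lambda>b. H b \<omega>"] p by simp
  then have "AE \<omega> in M. real_cond_exp M (F k) (\<lambda>\<omega>'. H (coin k i \<omega>') \<omega>') \<omega>
      = p * H True \<omega> + (1 - p) * H False \<omega>"
    using finite_fresh(2)[where \<tau> = "\<lambda>z. snd (snd z)", OF draw_coin_measurable finite, of H] meas int
    by simp
  moreover have "AE \<omega> in M. real_cond_exp M (F k) Y \<omega>
      = real_cond_exp M (F k) (\<lambda>\<omega>'. H (coin k i \<omega>') \<omega>') \<omega>"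
    by (rule cond_exp_cong_space[OF _ 0]) (rule Y)
  ultimately
  show "AE \<omega> in M. real_cond_exp M (F k) Y \<omega> = p * H True \<omega> + (1 - p) * H False \<omega>"
    by eventually_elim simp
qed

text \<open>The integrand is not known to be integrable beforehand, so the seed is integrated out in the
  extended non-negative reals. Finiteness of the result then gives integrability.\<close>

lemma compression_second_moment:
  assumes i: "i \<in> {1..n}"
    and u: "\<And>l. l \<in> {1..m} \<Longrightarrow> u l \<in> borel_measurable (F k)"
      "\<And>l. l \<in> {1..m} \<Longrightarrow> square_integrable M (u l)"
    and Y: "Y \<in> borel_measurable M"
      "\<And>\<omega>. \<omega> \<in> space M \<Longrightarrow> norm (Y \<omega>) = norm (C (seed k i \<omega>) (u (idx k i \<omega>) \<omega>) - u (idx k i \<omega>) \<omega>)"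
  shows "square_integrable M Y"
    and "(\<integral>\<omega>. (norm (Y \<omega>))\<^sup>2 \<partial>M) \<le> (1 - \<delta>) * avg m (\<lambda>l. \<integral>\<omega>. (norm (u l \<omega>))\<^sup>2 \<partial>M)"
proof -
  interpret fresh_draw M "F k" law "Z k i" using i by (rule fresh)
  have Cm: "(\<lambda>y. C (fst y) (snd y)) \<in> borel_measurable (S \<Otimes>\<^sub>M borel)"
    using compression by (simp add: compression_operator_def case_prod_beta')
  define h where "h = (\<lambda>y :: 'w \<times> nat \<times> 's \<times> bool.
    ennreal ((norm (C (fst (snd (snd y))) (u (fst (snd y)) (fst y)) - u (fst (snd y)) (fst y)))\<^sup>2))"
  have h: "h \<in> borel_measurable (F k \<Otimes>\<^sub>M law)"
    unfolding h_def
  proof (rule measurable_compose_countable'[where I = "{1..m}" and g = "\<lambda>y. fst (snd y)"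
        and f = "\<lambda>l y. ennreal ((norm (C (fst (snd (snd y))) (u l (fst y)) - u l (fst y)))\<^sup>2)"])
    fix l assume l: "l \<in> {1..m}"
    have seed: "(\<lambda>y. fst (snd (snd y))) \<in> measurable (F k \<Otimes>\<^sub>M law) S"
      by (rule measurable_compose[OF measurable_snd draw_seed_measurable])
    have ul: "(\<lambda>y. u l (fst y)) \<in> borel_measurable (F k \<Otimes>\<^sub>M law)"
      by (rule measurable_compose[OF measurable_fst u(1)[OF l]])
    have "(\<lambda>y. C (fst (snd (snd y))) (u l (fst y))) \<in> borel_measurable (F k \<Otimes>\<^sub>M law)"
      using measurable_compose[OF measurable_Pair[OF seed ul] Cm] by simp
    then show "(\<lambda>y. ennreal ((norm (C (fst (snd (snd y))) (u l (fst y)) - u l (fst y)))\<^sup>2))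
        \<in> borel_measurable (F k \<Otimes>\<^sub>M law)"
      using ul by measurable
  next
    show "(\<lambda>y. fst (snd y)) \<in> measurable (F k \<Otimes>\<^sub>M law) (count_space {1..m})"
      by (rule measurable_compose[OF measurable_snd draw_index_measurable])
  qed simp
  define B where "B \<omega> = (1 - \<delta>) * avg m (\<lambda>l. (norm (u l \<omega>))\<^sup>2)" for \<omega>
  have B: "integrable M B"
    unfolding B_def using u(2) by (intro integrable_mult_right integrable_avg square_integrable_norm)
  have B0: "0 \<le> B \<omega>" for \<omega>
    unfolding B_def using \<delta> by (intro mult_nonneg_nonneg avg_nonneg) auto
  have "(\<integral>\<^sup>+\<omega>. ennreal ((norm (Y \<omega>))\<^sup>2) \<partial>M) = (\<integral>\<^sup>+\<omega>. h (\<omega>, Z k i \<omega>) \<partial>M)"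
    by (intro nn_integral_cong) (simp add: h_def Y(2))
  also have "\<dots> = (\<integral>\<^sup>+\<omega>. \<integral>\<^sup>+z. h (\<omega>, z) \<partial>law \<partial>M)" by (rule nn_integral_fresh[OF h])
  also have "\<dots> \<le> (\<integral>\<^sup>+\<omega>. ennreal (B \<omega>) \<partial>M)"
    unfolding h_def B_def fst_conv snd_conv
    by (intro nn_integral_mono nn_integral_draw_compression[OF compression m])
  also have "\<dots> = ennreal (\<integral>\<omega>. B \<omega> \<partial>M)"
    using B B0 by (intro nn_integral_eq_integral) auto
  finally have le: "(\<integral>\<^sup>+\<omega>. ennreal ((norm (Y \<omega>))\<^sup>2) \<partial>M) \<le> ennreal (\<integral>\<omega>. B \<omega> \<partial>M)" .
  have int: "integrable M (\<lambda>\<omega>. (norm (Y \<omega>))\<^sup>2)"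
    using Y(1) le by (intro integrableI_bounded) (auto simp: top_unique less_top[symmetric])
  then show "square_integrable M Y" using Y(1) by (simp add: square_integrable_def)
  have "ennreal (\<integral>\<omega>. (norm (Y \<omega>))\<^sup>2 \<partial>M) \<le> ennreal (\<integral>\<omega>. B \<omega> \<partial>M)"
    using le nn_integral_eq_integral[OF int] by simp
  then have "(\<integral>\<omega>. (norm (Y \<omega>))\<^sup>2 \<partial>M) \<le> (\<integral>\<omega>. B \<omega> \<partial>M)"
    using B0 by (simp add: ennreal_le_iff integral_nonneg_AE)
  also have "\<dots> = (1 - \<delta>) * avg m (\<lambda>l. \<integral>\<omega>. (norm (u l \<omega>))\<^sup>2 \<partial>M)"
    unfolding B_def integral_mult_right_zero
    using u(2) by (subst integral_avg) (auto intro: square_integrable_norm)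
  finally show "(\<integral>\<omega>. (norm (Y \<omega>))\<^sup>2 \<partial>M) \<le> (1 - \<delta>) * avg m (\<lambda>l. \<integral>\<omega>. (norm (u l \<omega>))\<^sup>2 \<partial>M)" .
qed

text \<open>The invariant of the run: the state before iteration \<open>k\<close> depends on the past only and has second
  moments. It allows to treat the state as constant when the draws of iteration \<open>k\<close> are averaged.\<close>

definition regular_state :: "nat \<Rightarrow> bool" where
  "regular_state k \<longleftrightarrow> x k \<in> borel_measurable (F k) \<and> square_integrable M (x k) \<and>
    (\<forall>i\<in>{1..n}. w k i \<in> borel_measurable (F k) \<and> square_integrable M (w k i) \<and>
      e k i \<in> borel_measurable (F k) \<and> square_integrable M (e k i))"

lemma g_measurable_Suc:
  assumes "regular_state k" and i: "i \<in> {1..n}"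
  shows "g k i \<in> borel_measurable (F (Suc k))"
proof -
  have Z: "Z k i \<in> measurable (F (Suc k)) law"
    by (rule history_measurable_draw[OF fresh_draws i]) simp
  have "(\<lambda>\<omega>. svrg i (x k \<omega>) (w k i \<omega>) (idx k i \<omega>)) \<in> borel_measurable (F (Suc k))"
  proof (rule measurable_compose_countable'[where I = "{1..m}"])
    show "(\<lambda>\<omega>. idx k i \<omega>) \<in> measurable (F (Suc k)) (count_space {1..m})"
      by (rule measurable_compose[OF Z draw_index_measurable])
    show "(\<lambda>\<omega>. svrg i (x k \<omega>) (w k i \<omega>) l) \<in> borel_measurable (F (Suc k))" if "l \<in> {1..m}" for l
      using assms that by (intro svrg_measurable measurable_F_Suc) (auto simp: regular_state_def)
  qed simp
  then show ?thesis
    by (subst measurable_cong[where g = "\<lambda>\<omega>. svrg i (x k \<omega>) (w k i \<omega>) (idx k i \<omega>)"])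
      (simp_all add: run_i(1)[OF _ i])
qed

lemma v_measurable_Suc:
  assumes reg: "regular_state k" and i: "i \<in> {1..n}"
  shows "v k i \<in> borel_measurable (F (Suc k))"
proof -
  have Z: "Z k i \<in> measurable (F (Suc k)) law"
    by (rule history_measurable_draw[OF fresh_draws i]) simp
  have seed: "(\<lambda>\<omega>. seed k i \<omega>) \<in> measurable (F (Suc k)) S"
    by (rule measurable_compose[OF Z draw_seed_measurable])
  have u: "(\<lambda>\<omega>. e k i \<omega> + \<gamma> *\<^sub>R g k i \<omega>) \<in> borel_measurable (F (Suc k))"
  proof (intro borel_measurable_add borel_measurable_scaleR borel_measurable_const)
    show "e k i \<in> borel_measurable (F (Suc k))"
      using reg i by (intro measurable_F_Suc) (auto simp: regular_state_def)
  qed (fact g_measurable_Suc[OF reg i])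
  have Cm: "(\<lambda>y. C (fst y) (snd y)) \<in> borel_measurable (S \<Otimes>\<^sub>M borel)"
    using compression by (simp add: compression_operator_def case_prod_beta')
  have "(\<lambda>\<omega>. C (seed k i \<omega>) (e k i \<omega> + \<gamma> *\<^sub>R g k i \<omega>)) \<in> borel_measurable (F (Suc k))"
    using measurable_compose[OF measurable_Pair[OF seed u] Cm] by simp
  then show ?thesis
    by (subst measurable_cong[where g = "\<lambda>\<omega>. C (seed k i \<omega>) (e k i \<omega> + \<gamma> *\<^sub>R g k i \<omega>)"])
      (simp_all add: run_i(2)[OF _ i])
qed

lemma state_square_integrable_svrg:
  assumes "regular_state k" "i \<in> {1..n}" "l \<in> {1..m}"
  shows "square_integrable M (\<lambda>\<omega>. svrg i (x k \<omega>) (w k i \<omega>) l)"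
    and "(\<lambda>\<omega>. svrg i (x k \<omega>) (w k i \<omega>) l) \<in> borel_measurable (F k)"
  using assms by (auto simp: regular_state_def intro!: svrg_square_integrable svrg_measurable)

lemma regular_state_g_square_integrable:
  assumes reg: "regular_state k" and i: "i \<in> {1..n}"
  shows "square_integrable M (g k i)"
proof -
  have "integrable M (\<lambda>\<omega>. (norm (g k i \<omega>))\<^sup>2)"
  proof (rule fresh_index(1)[OF i])
    fix l assume l: "l \<in> {1..m}"
    show "(\<lambda>\<omega>. (norm (svrg i (x k \<omega>) (w k i \<omega>) l))\<^sup>2) \<in> borel_measurable (F k)"
      by (intro borel_measurable_power measurable_compose[OF _ borel_measurable_norm]
          state_square_integrable_svrg(2)[OF reg i l])
    show "integrable M (\<lambda>\<omega>. (norm (svrg i (x k \<omega>) (w k i \<omega>) l))\<^sup>2)"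
      by (intro square_integrable_norm state_square_integrable_svrg(1)[OF reg i l])
  qed (simp only: run_i(1)[OF _ i])
  then show ?thesis
    using measurable_F[OF g_measurable_Suc[OF reg i]] by (simp add: square_integrable_def)
qed

text \<open>The new error is what the compressor loses of the vector \<open>e + \<gamma> g\<close>.\<close>

lemma error_second_moment:
  assumes reg: "regular_state k" and i: "i \<in> {1..n}"
  shows "square_integrable M (e (Suc k) i)"
    and "(\<integral>\<omega>. (norm (e (Suc k) i \<omega>))\<^sup>2 \<partial>M)
      \<le> (1 - \<delta>) * avg m (\<lambda>l. \<integral>\<omega>. (norm (e k i \<omega> + \<gamma> *\<^sub>R svrg i (x k \<omega>) (w k i \<omega>) l))\<^sup>2 \<partial>M)"
proof -
  have e: "e k i \<in> borel_measurable (F k)" "square_integrable M (e k i)"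
    using reg i by (auto simp: regular_state_def)
  have meas: "(\<lambda>\<omega>. e k i \<omega> + \<gamma> *\<^sub>R g k i \<omega> - v k i \<omega>) \<in> borel_measurable M"
    using measurable_F[OF e(1)] measurable_F[OF g_measurable_Suc[OF reg i]]
      measurable_F[OF v_measurable_Suc[OF reg i]] by measurable
  have E: "e (Suc k) i \<in> borel_measurable M"
    by (subst measurable_cong[OF run_i(3)[OF _ i]]) (simp_all add: meas)
  note * = compression_second_moment[OF i, of "\<lambda>l \<omega>. e k i \<omega> + \<gamma> *\<^sub>R svrg i (x k \<omega>) (w k i \<omega>) l" k, OF _ _ E]
  have 1: "(\<lambda>\<omega>. e k i \<omega> + \<gamma> *\<^sub>R svrg i (x k \<omega>) (w k i \<omega>) l) \<in> borel_measurable (F k)"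
    and 2: "square_integrable M (\<lambda>\<omega>. e k i \<omega> + \<gamma> *\<^sub>R svrg i (x k \<omega>) (w k i \<omega>) l)" if "l \<in> {1..m}" for l
    using e state_square_integrable_svrg[OF reg i that]
    by (auto intro: square_integrable_add square_integrable_scaleR)
  have 3: "norm (e (Suc k) i \<omega>) = norm (C (seed k i \<omega>)
      (e k i \<omega> + \<gamma> *\<^sub>R svrg i (x k \<omega>) (w k i \<omega>) (idx k i \<omega>))
      - (e k i \<omega> + \<gamma> *\<^sub>R svrg i (x k \<omega>) (w k i \<omega>) (idx k i \<omega>)))" if "\<omega> \<in> space M" for \<omega>
    by (simp add: run_i[OF that i] norm_minus_commute)
  show "square_integrable M (e (Suc k) i)" using *(1)[OF 1 2 3] by blast
  show "(\<integral>\<omega>. (norm (e (Suc k) i \<omega>))\<^sup>2 \<partial>M)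
      \<le> (1 - \<delta>) * avg m (\<lambda>l. \<integral>\<omega>. (norm (e k i \<omega> + \<gamma> *\<^sub>R svrg i (x k \<omega>) (w k i \<omega>) l))\<^sup>2 \<partial>M)"
    using *(2)[OF 1 2 3] by blast
qed

lemma regular_state: "regular_state k"
proof (induction k)
  case 0
  have "x 0 \<in> borel_measurable (F 0)"
    by (subst measurable_cong[of _ _ "\<lambda>_. x0"]) (auto simp: run0)
  moreover have "square_integrable M (x 0)"
    using square_integrable_const[of x0] by (subst square_integrable_cong[OF run0(1)])
  moreover have "w 0 i \<in> borel_measurable (F 0) \<and> square_integrable M (w 0 i) \<and>
      e 0 i \<in> borel_measurable (F 0) \<and> square_integrable M (e 0 i)" if "i \<in> {1..n}" for i
  proof (intro conjI)
    show "w 0 i \<in> borel_measurable (F 0)"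
      by (subst measurable_cong[of _ _ "\<lambda>_. w0 i"]) (auto simp: run0(2)[OF _ that])
    show "e 0 i \<in> borel_measurable (F 0)"
      by (subst measurable_cong[of _ _ "\<lambda>_. 0"]) (auto simp: run0(3)[OF _ that])
    show "square_integrable M (w 0 i)"
      using square_integrable_const by (subst square_integrable_cong[OF run0(2)[OF _ that]])
    show "square_integrable M (e 0 i)"
      using square_integrable_const by (subst square_integrable_cong[OF run0(3)[OF _ that]])
  qed
  ultimately show ?case by (simp add: regular_state_def)
next
  case (Suc k)
  note reg = Suc.IH
  have x: "x k \<in> borel_measurable (F k)" "square_integrable M (x k)"
    using reg by (auto simp: regular_state_def)
  have vF: "v k i \<in> borel_measurable (F (Suc k))" if "i \<in> {1..n}" for i
    using v_measurable_Suc[OF reg that] .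
  have v: "square_integrable M (v k i)" if i: "i \<in> {1..n}" for i
  proof -
    have "square_integrable M (\<lambda>\<omega>. e k i \<omega> + \<gamma> *\<^sub>R g k i \<omega> - e (Suc k) i \<omega>)"
      using reg i error_second_moment(1)[OF reg i] regular_state_g_square_integrable[OF reg i]
      by (intro square_integrable_diff square_integrable_add square_integrable_scaleR)
        (auto simp: regular_state_def)
    then show ?thesis
      using measurable_F[OF vF[OF i]]
      by (simp add: run_i(3)[OF _ i] square_integrable_def cong: Bochner_Integration.integrable_cong)
  qed
  have xS: "x (Suc k) \<in> borel_measurable (F (Suc k))"
  proof (subst measurable_cong[OF run_x])
    show "(\<lambda>\<omega>. x k \<omega> - avg n (\<lambda>i. v k i \<omega>)) \<in> borel_measurable (F (Suc k))"
      using measurable_F_Suc[OF x(1)] vF by (intro borel_measurable_diff measurable_avg)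
  qed simp
  have "square_integrable M (\<lambda>\<omega>. x k \<omega> - avg n (\<lambda>i. v k i \<omega>))"
    using x v by (intro square_integrable_diff square_integrable_avg)
  then have xS2: "square_integrable M (x (Suc k))"
    using measurable_F[OF xS] by (simp add: run_x square_integrable_def cong: Bochner_Integration.integrable_cong)
  have "w (Suc k) i \<in> borel_measurable (F (Suc k)) \<and> square_integrable M (w (Suc k) i) \<and>
      e (Suc k) i \<in> borel_measurable (F (Suc k)) \<and> square_integrable M (e (Suc k) i)"
    if i: "i \<in> {1..n}" for i
  proof (intro conjI)
    have wi: "w k i \<in> borel_measurable (F k)" "square_integrable M (w k i)"
      and ei: "e k i \<in> borel_measurable (F k)"
      using reg i by (auto simp: regular_state_def)
    have Z: "Z k i \<in> measurable (F (Suc k)) law"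
      by (rule history_measurable_draw[OF fresh_draws i]) simp
    have "Measurable.pred (F (Suc k)) (\<lambda>\<omega>. coin k i \<omega>)"
      by (rule measurable_compose[OF Z draw_coin_measurable])
    then show wS: "w (Suc k) i \<in> borel_measurable (F (Suc k))"
      using measurable_F_Suc[OF x(1)] measurable_F_Suc[OF wi(1)]
      by (subst measurable_cong[OF run_i(4)[OF _ i]]) simp_all
    show "square_integrable M (w (Suc k) i)"
    proof (rule square_integrable_dominated[OF measurable_F[OF wS]])
      show "integrable M (\<lambda>\<omega>. (norm (x k \<omega>))\<^sup>2 + (norm (w k i \<omega>))\<^sup>2)"
        using x wi by (simp add: square_integrable_norm)
    qed (simp add: run_i(4)[OF _ i])
    show "e (Suc k) i \<in> borel_measurable (F (Suc k))"
    proof (subst measurable_cong[OF run_i(3)[OF _ i]])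
      show "(\<lambda>\<omega>. e k i \<omega> + \<gamma> *\<^sub>R g k i \<omega> - v k i \<omega>) \<in> borel_measurable (F (Suc k))"
        using measurable_F_Suc[OF ei] g_measurable_Suc[OF reg i] vF[OF i] by measurable
    qed simp
    show "square_integrable M (e (Suc k) i)" by (rule error_second_moment(1)[OF reg i])
  qed
  with xS xS2 show ?case by (simp add: regular_state_def)
qed

lemma x_regular: "x k \<in> borel_measurable (F k)" "square_integrable M (x k)"
  using regular_state[of k] by (simp_all add: regular_state_def)

lemma w_regular:
  "i \<in> {1..n} \<Longrightarrow> w k i \<in> borel_measurable (F k)" "i \<in> {1..n} \<Longrightarrow> square_integrable M (w k i)"
  using regular_state[of k] by (simp_all add: regular_state_def)

lemma e_regular:
  "i \<in> {1..n} \<Longrightarrow> e k i \<in> borel_measurable (F k)" "i \<in> {1..n} \<Longrightarrow> square_integrable M (e k i)"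
  using regular_state[of k] by (simp_all add: regular_state_def)

lemmas svrg_regular = state_square_integrable_svrg[OF regular_state]
lemmas g_square_integrable = regular_state_g_square_integrable[OF regular_state]

lemma em_square_integrable: "square_integrable M (em k)"
  by (intro square_integrable_avg e_regular)

lemma gm_square_integrable: "square_integrable M (gm k)"
  by (intro square_integrable_avg g_square_integrable)

lemma gap_F: "(\<lambda>\<omega>. gap (x k \<omega>)) \<in> borel_measurable (F k)"
  using measurable_compose[OF x_regular(1) borel_measurable_continuous_onI[OF continuous_f]]
  by simp

lemma gap_integrable: "integrable M (\<lambda>\<omega>. gap (x k \<omega>))"
proof (rule Bochner_Integration.integrable_bound)
  show "integrable M (\<lambda>\<omega>. 2 * L * (norm (x k \<omega> - xs))\<^sup>2)"
    using x_regular(2) by (intro integrable_mult_right square_integrable_norm square_integrable_diff square_integrable_const)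
  show "AE \<omega> in M. norm (gap (x k \<omega>)) \<le> norm (2 * L * (norm (x k \<omega> - xs))\<^sup>2)"
    using gap_le_dist gap_nonneg by (intro AE_I2) (simp add: order_trans[OF _ abs_ge_self])
qed (rule measurable_F[OF gap_F])

lemma sig_integrable: "integrable M (sig k)"
  unfolding sigma_sq_avg
  by (intro integrable_avg square_integrable_norm square_integrable_diff dfs_square_integrable
      w_regular square_integrable_const)


section \<open>The parametric inequalities\<close>

lemma cond_exp_g_inner:
  assumes i: "i \<in> {1..n}"
  shows "AE \<omega> in M. real_cond_exp M (F k) (\<lambda>\<omega>'. g k i \<omega>' \<bullet> b) \<omega> = dloc i (x k \<omega>) \<bullet> b"
proof -
  have "AE \<omega> in M. real_cond_exp M (F k) (\<lambda>\<omega>'. g k i \<omega>' \<bullet> b) \<omega>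
      = avg m (\<lambda>l. svrg i (x k \<omega>) (w k i \<omega>) l \<bullet> b)"
  proof (rule fresh_index(2)[OF i])
    fix l assume l: "l \<in> {1..m}"
    show "(\<lambda>\<omega>. svrg i (x k \<omega>) (w k i \<omega>) l \<bullet> b) \<in> borel_measurable (F k)"
      by (intro borel_measurable_inner svrg_regular(2)[OF i l] borel_measurable_const)
    show "integrable M (\<lambda>\<omega>. svrg i (x k \<omega>) (w k i \<omega>) l \<bullet> b)"
      by (intro integrable_inner_square_integrable svrg_regular(1)[OF i l] square_integrable_const)
  qed (simp only: run_i(1)[OF _ i])
  then show ?thesis
    by (simp add: inner_commute[of _ b] avg_inner avg_svrg[OF i])
qed

lemma cond_exp_g:
  assumes i: "i \<in> {1..n}"
  shows "AE \<omega> in M. vec_cond_exp M (F k) (g k i) \<omega> = dloc i (x k \<omega>)"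
proof -
  have "AE \<omega> in M. \<forall>b\<in>Basis. real_cond_exp M (F k) (\<lambda>\<omega>'. g k i \<omega>' \<bullet> b) \<omega> = dloc i (x k \<omega>) \<bullet> b"
    using cond_exp_g_inner[OF i] by (intro AE_finite_allI finite_Basis)
  then show ?thesis
    by eventually_elim (simp add: vec_cond_exp_def euclidean_representation)
qed

lemma cond_exp_all_g:
  "AE \<omega> in M. \<forall>i\<in>{1..n}. vec_cond_exp M (F k) (g k i) \<omega> = dloc i (x k \<omega>)"
  using cond_exp_g by (intro AE_finite_allI) auto

lemma cond_exp_gm: "AE \<omega> in M. vec_cond_exp M (F k) (gm k) \<omega> = grad f (x k \<omega>)"
proof -
  interpret finite_measure_subalgebra M "F k" by (rule cond_exp_subalgebra)
  have "AE \<omega> in M. real_cond_exp M (F k) (\<lambda>\<omega>'. gm k \<omega>' \<bullet> b) \<omega> = grad f (x k \<omega>) \<bullet> b" for b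
  proof -
    have "AE \<omega> in M. \<forall>i\<in>{1..n}. real_cond_exp M (F k) (\<lambda>\<omega>'. g k i \<omega>' \<bullet> b) \<omega> = dloc i (x k \<omega>) \<bullet> b"
      using cond_exp_g_inner by (intro AE_finite_allI) auto
    moreover have "AE \<omega> in M. real_cond_exp M (F k) (\<lambda>\<omega>'. avg n (\<lambda>i. g k i \<omega>' \<bullet> b)) \<omega>
        = avg n (\<lambda>i. real_cond_exp M (F k) (\<lambda>\<omega>'. g k i \<omega>' \<bullet> b) \<omega>)"
      using g_square_integrable by (intro real_cond_exp_avg) (auto intro: integrable_square_integrable)
    ultimately show ?thesis
    proof eventually_elim
      case (elim \<omega>)
      have "avg n (\<lambda>i. real_cond_exp M (F k) (\<lambda>\<omega>'. g k i \<omega>' \<bullet> b) \<omega>) = avg n (\<lambda>i. dloc i (x k \<omega>) \<bullet> b)"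
        using elim(1) by (intro avg_cong) simp
      with elim(2) show ?case by (simp add: inner_commute[of _ b] avg_inner grad_f_eq)
    qed
  qed
  then have "AE \<omega> in M. \<forall>b\<in>Basis. real_cond_exp M (F k) (\<lambda>\<omega>'. gm k \<omega>' \<bullet> b) \<omega> = grad f (x k \<omega>) \<bullet> b"
    by (intro AE_finite_allI finite_Basis)
  then show ?thesis
    by eventually_elim (simp add: vec_cond_exp_def euclidean_representation)
qed

lemma mean_gbar_le:
  "AE \<omega> in M. avg n (\<lambda>i. (norm (vec_cond_exp M (F k) (g k i) \<omega>))\<^sup>2) \<le> 4 * L * gap (x k \<omega>) + heterogeneity"
  using cond_exp_all_g[of k]
proof eventually_elim
  case (elim \<omega>)
  have "avg n (\<lambda>i. (norm (vec_cond_exp M (F k) (g k i) \<omega>))\<^sup>2) = avg n (\<lambda>i. (norm (dloc i (x k \<omega>)))\<^sup>2)"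
    using elim by (intro avg_cong) simp
  also have "\<dots> \<le> 4 * L * gap (x k \<omega>) + heterogeneity" using mean_dloc_le[of 1 "x k \<omega>"] by simp
  finally show ?case .
qed

lemma g_centered:
  assumes i: "i \<in> {1..n}"
  shows "integrable M (\<lambda>\<omega>. (norm (g k i \<omega> - vec_cond_exp M (F k) (g k i) \<omega>))\<^sup>2)"
    and "AE \<omega> in M. real_cond_exp M (F k) (\<lambda>\<omega>'. (norm (g k i \<omega>' - vec_cond_exp M (F k) (g k i) \<omega>'))\<^sup>2) \<omega>
      = avg m (\<lambda>l. (norm (svrg i (x k \<omega>) (w k i \<omega>) l - dloc i (x k \<omega>)))\<^sup>2)"
proof -
  interpret finite_measure_subalgebra M "F k" by (rule cond_exp_subalgebra)
  let ?X = "\<lambda>\<omega>. (norm (g k i \<omega> - vec_cond_exp M (F k) (g k i) \<omega>))\<^sup>2"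
  let ?Y = "\<lambda>\<omega>. (norm (g k i \<omega> - dloc i (x k \<omega>)))\<^sup>2"
  let ?H = "\<lambda>l \<omega>. (norm (svrg i (x k \<omega>) (w k i \<omega>) l - dloc i (x k \<omega>)))\<^sup>2"
  have H: "?H l \<in> borel_measurable (F k)" "integrable M (?H l)" if "l \<in> {1..m}" for l
  proof -
    show "?H l \<in> borel_measurable (F k)"
      by (intro borel_measurable_power measurable_compose[OF _ borel_measurable_norm]
          borel_measurable_diff svrg_regular[OF i that] dloc_measurable[OF i] x_regular)
    show "integrable M (?H l)"
      by (intro square_integrable_norm square_integrable_diff svrg_regular[OF i that]
          dloc_square_integrable[OF i] x_regular)
  qed
  have Y: "integrable M ?Y"
    by (intro square_integrable_norm square_integrable_diff g_square_integrable[OF i]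
          dloc_square_integrable[OF i] x_regular)
  have gm: "g k i \<in> borel_measurable M"
    using g_square_integrable[OF i] by (rule square_integrable_measurable)
  have "vec_cond_exp M (F k) (g k i) \<in> borel_measurable M"
    unfolding vec_cond_exp_def[abs_def] by measurable
  then have X: "?X \<in> borel_measurable M" using gm by measurable
  have XY: "AE \<omega> in M. ?X \<omega> = ?Y \<omega>"
    using cond_exp_g[OF i, of k] by eventually_elim simp
  show "integrable M ?X"
    using integrable_cong_AE_imp[OF Y X] XY by (simp add: eq_commute)
  have "AE \<omega> in M. real_cond_exp M (F k) ?Y \<omega> = avg m (\<lambda>l. ?H l \<omega>)"
    by (rule fresh_index(2)[OF i H]) (simp_all only: run_i(1)[OF _ i])
  moreover have "AE \<omega> in M. real_cond_exp M (F k) ?X \<omega> = real_cond_exp M (F k) ?Y \<omega>"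
    using Y by (intro real_cond_exp_cong XY X) auto
  ultimately show "AE \<omega> in M. real_cond_exp M (F k) ?X \<omega> = avg m (\<lambda>l. ?H l \<omega>)"
    by eventually_elim simp
qed

lemma mean_variance_le:
  "AE \<omega> in M. avg n (\<lambda>i. real_cond_exp M (F k)
      (\<lambda>\<omega>'. (norm (g k i \<omega>' - vec_cond_exp M (F k) (g k i) \<omega>'))\<^sup>2) \<omega>)
    \<le> 4 * L * gap (x k \<omega>) + 2 * sig k \<omega>"
proof -
  have "AE \<omega> in M. \<forall>i\<in>{1..n}. real_cond_exp M (F k)
      (\<lambda>\<omega>'. (norm (g k i \<omega>' - vec_cond_exp M (F k) (g k i) \<omega>'))\<^sup>2) \<omega>
      = avg m (\<lambda>l. (norm (svrg i (x k \<omega>) (w k i \<omega>) l - dloc i (x k \<omega>)))\<^sup>2)"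
    using g_centered(2) by (intro AE_finite_allI) auto
  then show ?thesis
  proof eventually_elim
    case (elim \<omega>)
    then have "avg n (\<lambda>i. real_cond_exp M (F k)
          (\<lambda>\<omega>'. (norm (g k i \<omega>' - vec_cond_exp M (F k) (g k i) \<omega>'))\<^sup>2) \<omega>)
        = avg n (\<lambda>i. avg m (\<lambda>l. (norm (svrg i (x k \<omega>) (w k i \<omega>) l - dloc i (x k \<omega>)))\<^sup>2))"
      by (intro avg_cong) simp
    also note mean_svrg_variance_le
    finally show ?case .
  qed
qed

text \<open>The local gradients at the solution average to zero, so they may be subtracted from the \<open>g\<^sub>i\<close> before
  the square of the mean is bounded by the mean of the squares. This removes the heterogeneity of the
  workers from the bound.\<close>

lemma cond_exp_gm_square_le:
  "AE \<omega> in M. real_cond_exp M (F k) (\<lambda>\<omega>'. (norm (gm k \<omega>'))\<^sup>2) \<omega> \<le> 4 * L * gap (x k \<omega>) + 2 * sig k \<omega>"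
proof -
  interpret finite_measure_subalgebra M "F k" by (rule cond_exp_subalgebra)
  let ?Y = "\<lambda>i \<omega>. (norm (g k i \<omega> - dloc i xs))\<^sup>2"
  let ?H = "\<lambda>i l \<omega>. (norm (svrg i (x k \<omega>) (w k i \<omega>) l - dloc i xs))\<^sup>2"
  have Y: "integrable M (?Y i)" if "i \<in> {1..n}" for i
    by (intro square_integrable_norm square_integrable_diff g_square_integrable[OF that]
          square_integrable_const)
  have "AE \<omega> in M. real_cond_exp M (F k) (?Y i) \<omega> = avg m (\<lambda>l. ?H i l \<omega>)" if i: "i \<in> {1..n}" for i
  proof (rule fresh_index(2)[OF i])
    fix l assume l: "l \<in> {1..m}"
    show "?H i l \<in> borel_measurable (F k)"
      by (intro borel_measurable_power measurable_compose[OF _ borel_measurable_norm]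
          borel_measurable_diff svrg_regular[OF i l] borel_measurable_const)
    show "integrable M (?H i l)"
      by (intro square_integrable_norm square_integrable_diff svrg_regular[OF i l]
          square_integrable_const)
  qed (simp only: run_i(1)[OF _ i])
  then have 1: "AE \<omega> in M. \<forall>i\<in>{1..n}. real_cond_exp M (F k) (?Y i) \<omega> = avg m (\<lambda>l. ?H i l \<omega>)"
    by (intro AE_finite_allI) auto
  have 2: "AE \<omega> in M. real_cond_exp M (F k) (\<lambda>\<omega>'. avg n (\<lambda>i. ?Y i \<omega>')) \<omega>
      = avg n (\<lambda>i. real_cond_exp M (F k) (?Y i) \<omega>)"
    using Y by (rule real_cond_exp_avg)
  have "(norm (gm k \<omega>))\<^sup>2 \<le> avg n (\<lambda>i. ?Y i \<omega>)" for \<omega>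
    using norm_avg_le[OF n, of "\<lambda>i. g k i \<omega> - dloc i xs"] by (simp add: avg_diff avg_dloc_xs)
  then have 3: "AE \<omega> in M. real_cond_exp M (F k) (\<lambda>\<omega>'. (norm (gm k \<omega>'))\<^sup>2) \<omega>
      \<le> real_cond_exp M (F k) (\<lambda>\<omega>'. avg n (\<lambda>i. ?Y i \<omega>')) \<omega>"
    by (intro real_cond_exp_mono AE_I2 square_integrable_norm gm_square_integrable integrable_avg Y)
  from 1 2 3 show ?thesis
  proof eventually_elim
    case (elim \<omega>)
    have "avg n (\<lambda>i. real_cond_exp M (F k) (?Y i) \<omega>) = avg n (\<lambda>i. avg m (\<lambda>l. ?H i l \<omega>))"
      using elim(1) by (intro avg_cong) simp
    then show ?case using elim(2,3) mean_svrg_shifted_le[of "x k \<omega>" "\<lambda>i. w k i \<omega>"] by simp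
  qed
qed

lemma cond_exp_sig_le:
  "AE \<omega> in M. real_cond_exp M (F k) (sig (Suc k)) \<omega>
    \<le> (1 - p) * sig k \<omega> + p * (2 * L * gap (x k \<omega>))"
proof -
  interpret finite_measure_subalgebra M "F k" by (rule cond_exp_subalgebra)
  define R where "R i u = avg m (\<lambda>j. (norm (dfs i j u - dfs i j xs))\<^sup>2)" for i u
  have sig: "sig k' \<omega> = avg n (\<lambda>i. R i (w k' i \<omega>))" for k' \<omega>
    by (simp add: sigma_sq_avg R_def)
  have R: "(\<lambda>\<omega>. R i (X \<omega>)) \<in> borel_measurable (F k)" "integrable M (\<lambda>\<omega>. R i (X \<omega>))"
    if i: "i \<in> {1..n}" and X: "X \<in> borel_measurable (F k)" "square_integrable M X" for i X
  proof -
    show "(\<lambda>\<omega>. R i (X \<omega>)) \<in> borel_measurable (F k)"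
      unfolding R_def using i X
      by (intro measurable_avg borel_measurable_power measurable_compose[OF _ borel_measurable_norm]
          borel_measurable_diff dfs_measurable borel_measurable_const)
    show "integrable M (\<lambda>\<omega>. R i (X \<omega>))"
      unfolding R_def using i X
      by (intro integrable_avg square_integrable_norm square_integrable_diff dfs_square_integrable
          square_integrable_const)
  qed
  have coin: "integrable M (\<lambda>\<omega>. R i (w (Suc k) i \<omega>))"
    "AE \<omega> in M. real_cond_exp M (F k) (\<lambda>\<omega>'. R i (w (Suc k) i \<omega>')) \<omega>
      = p * R i (x k \<omega>) + (1 - p) * R i (w k i \<omega>)" if i: "i \<in> {1..n}" for i
  proof -
    let ?H = "\<lambda>b \<omega>. if b then R i (x k \<omega>) else R i (w k i \<omega>)"
    have H: "?H b \<in> borel_measurable (F k)" "integrable M (?H b)" for b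
      using R[OF i x_regular] R[OF i w_regular[OF i]] by (cases b; simp)+
    have Y: "R i (w (Suc k) i \<omega>) = ?H (coin k i \<omega>) \<omega>" if "\<omega> \<in> space M" for \<omega>
      by (simp add: run_i(4)[OF that i])
    show "integrable M (\<lambda>\<omega>. R i (w (Suc k) i \<omega>))" by (rule fresh_coin(1)[OF i H Y])
    show "AE \<omega> in M. real_cond_exp M (F k) (\<lambda>\<omega>'. R i (w (Suc k) i \<omega>')) \<omega>
      = p * R i (x k \<omega>) + (1 - p) * R i (w k i \<omega>)"
      using fresh_coin(2)[OF i H Y] by simp
  qed
  have "AE \<omega> in M. \<forall>i\<in>{1..n}. real_cond_exp M (F k) (\<lambda>\<omega>'. R i (w (Suc k) i \<omega>')) \<omega>
      = p * R i (x k \<omega>) + (1 - p) * R i (w k i \<omega>)"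
    using coin(2) by (intro AE_finite_allI) auto
  moreover have "AE \<omega> in M. real_cond_exp M (F k) (\<lambda>\<omega>'. avg n (\<lambda>i. R i (w (Suc k) i \<omega>'))) \<omega>
      = avg n (\<lambda>i. real_cond_exp M (F k) (\<lambda>\<omega>'. R i (w (Suc k) i \<omega>')) \<omega>)"
    using coin(1) by (rule real_cond_exp_avg)
  ultimately show ?thesis
  proof eventually_elim
    case (elim \<omega>)
    have "avg n (\<lambda>i. real_cond_exp M (F k) (\<lambda>\<omega>'. R i (w (Suc k) i \<omega>')) \<omega>)
        = avg n (\<lambda>i. p * R i (x k \<omega>) + (1 - p) * R i (w k i \<omega>))"
      using elim(1) by (intro avg_cong) simp
    also have "\<dots> = p * avg n (\<lambda>i. R i (x k \<omega>)) + (1 - p) * sig k \<omega>"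
      by (simp only: avg_simps sig)
    also have "p * avg n (\<lambda>i. R i (x k \<omega>)) \<le> p * (2 * L * gap (x k \<omega>))"
      unfolding R_def using p by (intro mult_left_mono mean_gradient_gap) auto
    finally show ?case using elim(2) unfolding sig by simp
  qed
qed

section \<open>Recursions for the expectations\<close>

definition "gap_mean k = (\<integral>\<omega>. gap (x k \<omega>) \<partial>M)"
definition "sig_mean k = (\<integral>\<omega>. sig k \<omega> \<partial>M)"
definition "err_mean k = avg n (\<lambda>i. \<integral>\<omega>. (norm (e k i \<omega>))\<^sup>2 \<partial>M)"
definition "em_mean k = (\<integral>\<omega>. (norm (em k \<omega>))\<^sup>2 \<partial>M)"
definition "dist_mean k = (\<integral>\<omega>. (norm (x k \<omega> - em k \<omega> - xs))\<^sup>2 \<partial>M)"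

lemma means_nonneg:
  "0 \<le> gap_mean k" "0 \<le> sig_mean k" "0 \<le> err_mean k" "0 \<le> em_mean k" "0 \<le> dist_mean k"
  unfolding gap_mean_def sig_mean_def err_mean_def em_mean_def dist_mean_def
  using gap_nonneg sigma_sq_nonneg
  by (auto intro!: avg_nonneg integral_nonneg_AE)

lemma integral_le_cond_exp_bound:
  fixes X Y :: "'w \<Rightarrow> real"
  assumes "integrable M X" "integrable M Y" "AE \<omega> in M. real_cond_exp M (F k) X \<omega> \<le> Y \<omega>"
  shows "(\<integral>\<omega>. X \<omega> \<partial>M) \<le> (\<integral>\<omega>. Y \<omega> \<partial>M)"
proof -
  interpret finite_measure_subalgebra M "F k" by (rule cond_exp_subalgebra)
  show ?thesis
    using integral_mono_AE[OF real_cond_exp_int(1)[OF assms(1)] assms(2,3)]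
    by (simp add: real_cond_exp_int(2)[OF assms(1)])
qed

lemma sig_mean_Suc: "sig_mean (Suc k) \<le> (1 - p) * sig_mean k + p * (2 * L * gap_mean k)"
proof -
  have "sig_mean (Suc k) \<le> (\<integral>\<omega>. (1 - p) * sig k \<omega> + p * (2 * L * gap (x k \<omega>)) \<partial>M)"
    unfolding sig_mean_def
    by (rule integral_le_cond_exp_bound[OF sig_integrable _ cond_exp_sig_le])
      (use sig_integrable[of k] gap_integrable[of k] in simp)
  then show ?thesis
    using sig_integrable[of k] gap_integrable[of k] by (simp add: sig_mean_def gap_mean_def)
qed

lemma em_le_err: "em_mean k \<le> err_mean k"
proof -
  have "em_mean k \<le> (\<integral>\<omega>. avg n (\<lambda>i. (norm (e k i \<omega>))\<^sup>2) \<partial>M)"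
    unfolding em_mean_def using n
    by (intro integral_mono integrable_avg square_integrable_norm em_square_integrable e_regular norm_avg_le)
  also have "\<dots> = err_mean k"
    unfolding err_mean_def by (intro integral_avg square_integrable_norm e_regular)
  finally show ?thesis .
qed

lemma err_mean_Suc:
  "err_mean (Suc k) \<le> (1 - \<delta> / 2) * err_mean k
    + \<gamma>\<^sup>2 * ((2 / \<delta>) * (6 * L * gap_mean k + 3 / 4 * heterogeneity) + 4 * L * gap_mean k + 2 * sig_mean k)"
proof -
  let ?u = "\<lambda>i l \<omega>. (norm (e k i \<omega> + \<gamma> *\<^sub>R svrg i (x k \<omega>) (w k i \<omega>) l))\<^sup>2"
  have u: "integrable M (?u i l)" if "i \<in> {1..n}" "l \<in> {1..m}" for i l
    using that by (intro square_integrable_norm square_integrable_add square_integrable_scaleR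
        e_regular svrg_regular)
  have ei: "integrable M (\<lambda>\<omega>. (norm (e k i \<omega>))\<^sup>2)" if "i \<in> {1..n}" for i
    using that by (intro square_integrable_norm e_regular)
  have "err_mean (Suc k) \<le> avg n (\<lambda>i. (1 - \<delta>) * avg m (\<lambda>l. \<integral>\<omega>. ?u i l \<omega> \<partial>M))"
    unfolding err_mean_def by (intro avg_mono error_second_moment(2)[OF regular_state])
  also have "\<dots> = (1 - \<delta>) * avg n (\<lambda>i. \<integral>\<omega>. avg m (\<lambda>l. ?u i l \<omega>) \<partial>M)"
    unfolding avg_cmult using u
    by (intro arg_cong[where f = "(*) (1 - \<delta>)"] avg_cong integral_avg[symmetric])
  also have "\<dots> = (\<integral>\<omega>. (1 - \<delta>) * avg n (\<lambda>i. avg m (\<lambda>l. ?u i l \<omega>)) \<partial>M)"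
    unfolding integral_mult_right_zero using u by (subst integral_avg) (auto intro: integrable_avg)
  also have "\<dots> \<le> (\<integral>\<omega>. (1 - \<delta> / 2) * avg n (\<lambda>i. (norm (e k i \<omega>))\<^sup>2)
      + \<gamma>\<^sup>2 * ((2 / \<delta>) * (6 * L * gap (x k \<omega>) + 3 / 4 * heterogeneity) + 4 * L * gap (x k \<omega>) + 2 * sig k \<omega>) \<partial>M)"
  proof (intro integral_mono error_one_step[OF \<delta>])
    show "integrable M (\<lambda>\<omega>. (1 - \<delta>) * avg n (\<lambda>i. avg m (\<lambda>l. ?u i l \<omega>)))"
      using u by (intro integrable_mult_right integrable_avg)
    show "integrable M (\<lambda>\<omega>. (1 - \<delta> / 2) * avg n (\<lambda>i. (norm (e k i \<omega>))\<^sup>2)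
      + \<gamma>\<^sup>2 * ((2 / \<delta>) * (6 * L * gap (x k \<omega>) + 3 / 4 * heterogeneity) + 4 * L * gap (x k \<omega>) + 2 * sig k \<omega>))"
      using ei by (intro Bochner_Integration.integrable_add integrable_mult_right integrable_avg
          gap_integrable sig_integrable integrable_const)
  qed
  also have "\<dots> = (1 - \<delta> / 2) * err_mean k
      + \<gamma>\<^sup>2 * ((2 / \<delta>) * (6 * L * gap_mean k + 3 / 4 * heterogeneity) + 4 * L * gap_mean k + 2 * sig_mean k)"
  proof -
    have "integrable M (\<lambda>\<omega>. avg n (\<lambda>i. (norm (e k i \<omega>))\<^sup>2))" using ei by (rule integrable_avg)
    moreover have "(\<integral>\<omega>. avg n (\<lambda>i. (norm (e k i \<omega>))\<^sup>2) \<partial>M) = err_mean k"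
      unfolding err_mean_def using ei by (rule integral_avg)
    ultimately show ?thesis
      using gap_integrable[of k] sig_integrable[of k]
      by (simp add: gap_mean_def sig_mean_def prob_space)
  qed
  finally show ?thesis .
qed

text \<open>The compressed message cancels in the virtual iterate \<open>x - e\<close>, which therefore performs an
  uncompressed stochastic gradient step.\<close>

lemma virtual_iterate_Suc:
  assumes "\<omega> \<in> space M"
  shows "x (Suc k) \<omega> - em (Suc k) \<omega> = x k \<omega> - em k \<omega> - \<gamma> *\<^sub>R gm k \<omega>"
proof -
  have "em (Suc k) \<omega> = avg n (\<lambda>i. e k i \<omega> + \<gamma> *\<^sub>R g k i \<omega> - v k i \<omega>)"
    using assms by (intro avg_cong) (rule run_i(3))
  then show ?thesis using run_x[OF assms] by (simp add: avg_add avg_diff avg_scaleR)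
qed

text \<open>Expanding the square, the cross term sees only the conditional mean \<open>\<nabla>f(x)\<close> of \<open>g\<close>, since the virtual
  iterate is determined by the past. What remains is the pointwise inequality \<open>lyapunov_one_step\<close>.\<close>

lemma lyapunov_mean_Suc:
  assumes "\<eta> \<le> \<gamma> * \<mu> / 2" "\<eta> \<le> p / 4"
  shows "dist_mean (Suc k) + 4 / p * \<gamma>\<^sup>2 * sig_mean (Suc k)
    \<le> (1 - \<eta>) * (dist_mean k + 4 / p * \<gamma>\<^sup>2 * sig_mean k)
      + (3 * L * \<gamma> * em_mean k - \<gamma> / 2 * gap_mean k)"
proof -
  define y where "y \<omega> = x k \<omega> - em k \<omega> - xs" for \<omega>
  have y: "square_integrable M y"
    unfolding y_def[abs_def]
    by (intro square_integrable_diff x_regular em_square_integrable square_integrable_const)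
  have yF: "y \<in> borel_measurable (F k)"
    unfolding y_def[abs_def]
    by (intro borel_measurable_diff x_regular measurable_avg e_regular borel_measurable_const)
  have dloc: "square_integrable M (\<lambda>\<omega>. dloc i (x k \<omega>))" if "i \<in> {1..n}" for i
    using that by (intro dloc_square_integrable x_regular)
  have cross_i: "(\<integral>\<omega>. inner (y \<omega>) (g k i \<omega>) \<partial>M) = (\<integral>\<omega>. inner (y \<omega>) (dloc i (x k \<omega>)) \<partial>M)"
    if i: "i \<in> {1..n}" for i
  proof -
    have "(\<integral>\<omega>. inner (y \<omega>) (g k i \<omega>) \<partial>M)
        = (\<integral>\<omega>. avg m (\<lambda>l. inner (y \<omega>) (svrg i (x k \<omega>) (w k i \<omega>) l)) \<partial>M)"
    proof (rule fresh_index(3)[OF i])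
      fix l assume l: "l \<in> {1..m}"
      show "(\<lambda>\<omega>. inner (y \<omega>) (svrg i (x k \<omega>) (w k i \<omega>) l)) \<in> borel_measurable (F k)"
        by (intro borel_measurable_inner svrg_regular(2)[OF i l] yF)
      show "integrable M (\<lambda>\<omega>. inner (y \<omega>) (svrg i (x k \<omega>) (w k i \<omega>) l))"
        by (intro integrable_inner_square_integrable svrg_regular(1)[OF i l] y)
    qed (simp only: run_i(1)[OF _ i])
    then show ?thesis by (simp add: avg_inner avg_svrg[OF i])
  qed
  have "(\<integral>\<omega>. inner (y \<omega>) (gm k \<omega>) \<partial>M) = avg n (\<lambda>i. \<integral>\<omega>. inner (y \<omega>) (g k i \<omega>) \<partial>M)"
    unfolding avg_inner[symmetric]
    using y g_square_integrable by (intro integral_avg integrable_inner_square_integrable)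
  also have "\<dots> = avg n (\<lambda>i. \<integral>\<omega>. inner (y \<omega>) (dloc i (x k \<omega>)) \<partial>M)"
    by (intro avg_cong cross_i)
  also have "\<dots> = (\<integral>\<omega>. inner (y \<omega>) (grad f (x k \<omega>)) \<partial>M)"
    unfolding grad_f_eq avg_inner[symmetric]
    using y dloc by (intro integral_avg[symmetric] integrable_inner_square_integrable)
  finally have cross: "(\<integral>\<omega>. inner (y \<omega>) (gm k \<omega>) \<partial>M) = (\<integral>\<omega>. inner (y \<omega>) (grad f (x k \<omega>)) \<partial>M)" .
  have gm_sq: "(\<integral>\<omega>. (norm (gm k \<omega>))\<^sup>2 \<partial>M) \<le> 4 * L * gap_mean k + 2 * sig_mean k"
  proof -
    have "(\<integral>\<omega>. (norm (gm k \<omega>))\<^sup>2 \<partial>M) \<le> (\<integral>\<omega>. 4 * L * gap (x k \<omega>) + 2 * sig k \<omega> \<partial>M)"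
      by (rule integral_le_cond_exp_bound[OF square_integrable_norm[OF gm_square_integrable] _
            cond_exp_gm_square_le])
        (use sig_integrable[of k] gap_integrable[of k] in simp)
    then show ?thesis
      using sig_integrable[of k] gap_integrable[of k] by (simp add: sig_mean_def gap_mean_def)
  qed
  have i1: "integrable M (\<lambda>\<omega>. (norm (y \<omega>))\<^sup>2)" "integrable M (\<lambda>\<omega>. (norm (gm k \<omega>))\<^sup>2)"
    "integrable M (\<lambda>\<omega>. (norm (em k \<omega>))\<^sup>2)" "integrable M (\<lambda>\<omega>. inner (y \<omega>) (gm k \<omega>))"
    using y by (auto intro: square_integrable_norm gm_square_integrable em_square_integrable
        integrable_inner_square_integrable)
  have i2: "integrable M (\<lambda>\<omega>. inner (y \<omega>) (grad f (x k \<omega>)))"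
    unfolding grad_f_eq using y dloc by (intro integrable_inner_square_integrable square_integrable_avg)
  have "dist_mean (Suc k) = (\<integral>\<omega>. (norm (y \<omega>))\<^sup>2 - 2 * \<gamma> * inner (y \<omega>) (gm k \<omega>) + \<gamma>\<^sup>2 * (norm (gm k \<omega>))\<^sup>2 \<partial>M)"
    unfolding dist_mean_def
  proof (intro Bochner_Integration.integral_cong refl)
    fix \<omega> assume "\<omega> \<in> space M"
    then have *: "x (Suc k) \<omega> - em (Suc k) \<omega> - xs = y \<omega> - \<gamma> *\<^sub>R gm k \<omega>"
      by (simp add: virtual_iterate_Suc y_def)
    have "(norm (a - \<gamma> *\<^sub>R b))\<^sup>2 = (norm a)\<^sup>2 - 2 * \<gamma> * inner a b + \<gamma>\<^sup>2 * (norm b)\<^sup>2" for a b :: 'a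
      by (simp add: power2_norm_eq_inner inner_diff_left inner_diff_right inner_commute
          power2_eq_square[of \<gamma>] algebra_simps)
    then show "(norm (x (Suc k) \<omega> - em (Suc k) \<omega> - xs))\<^sup>2
        = (norm (y \<omega>))\<^sup>2 - 2 * \<gamma> * inner (y \<omega>) (gm k \<omega>) + \<gamma>\<^sup>2 * (norm (gm k \<omega>))\<^sup>2"
      unfolding * .
  qed
  also have "\<dots> = (\<integral>\<omega>. (norm (y \<omega>))\<^sup>2 \<partial>M) - 2 * \<gamma> * (\<integral>\<omega>. inner (y \<omega>) (gm k \<omega>) \<partial>M)
      + \<gamma>\<^sup>2 * (\<integral>\<omega>. (norm (gm k \<omega>))\<^sup>2 \<partial>M)"
    using i1 by simp
  also have "\<dots> \<le> (\<integral>\<omega>. (norm (y \<omega>))\<^sup>2 \<partial>M) - 2 * \<gamma> * (\<integral>\<omega>. inner (y \<omega>) (grad f (x k \<omega>)) \<partial>M)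
      + \<gamma>\<^sup>2 * (4 * L * gap_mean k + 2 * sig_mean k)"
    unfolding cross using gm_sq by (intro add_left_mono mult_left_mono) auto
  finally have d: "dist_mean (Suc k) \<le> (\<integral>\<omega>. (norm (y \<omega>))\<^sup>2 \<partial>M)
      - 2 * \<gamma> * (\<integral>\<omega>. inner (y \<omega>) (grad f (x k \<omega>)) \<partial>M) + \<gamma>\<^sup>2 * (4 * L * gap_mean k + 2 * sig_mean k)" .
  have s: "4 / p * \<gamma>\<^sup>2 * sig_mean (Suc k)
      \<le> 4 / p * \<gamma>\<^sup>2 * ((1 - p) * sig_mean k + p * (2 * L * gap_mean k))"
    using p by (intro mult_left_mono sig_mean_Suc) auto
  have "(\<integral>\<omega>. (norm (y \<omega>))\<^sup>2 - 2 * \<gamma> * inner (y \<omega>) (grad f (x k \<omega>))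
        + \<gamma>\<^sup>2 * (4 * L * gap (x k \<omega>) + 2 * sig k \<omega>)
        + 4 / p * \<gamma>\<^sup>2 * ((1 - p) * sig k \<omega> + p * (2 * L * gap (x k \<omega>))) \<partial>M)
      \<le> (\<integral>\<omega>. (1 - \<eta>) * ((norm (y \<omega>))\<^sup>2 + 4 / p * \<gamma>\<^sup>2 * sig k \<omega>)
        - \<gamma> / 2 * gap (x k \<omega>) + 3 * L * \<gamma> * (norm (em k \<omega>))\<^sup>2 \<partial>M)" (is "?l \<le> ?r")
    unfolding y_def
    by (intro integral_mono lyapunov_one_step[OF qsc \<mu> \<gamma>(1,2) p(1) assms sigma_sq_nonneg])
      (use i1 i2 gap_integrable sig_integrable in \<open>simp_all add: y_def\<close>)
  moreover have "?l = (\<integral>\<omega>. (norm (y \<omega>))\<^sup>2 \<partial>M)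
      - 2 * \<gamma> * (\<integral>\<omega>. inner (y \<omega>) (grad f (x k \<omega>)) \<partial>M) + \<gamma>\<^sup>2 * (4 * L * gap_mean k + 2 * sig_mean k)
      + 4 / p * \<gamma>\<^sup>2 * ((1 - p) * sig_mean k + p * (2 * L * gap_mean k))"
    using i1 i2 gap_integrable[of k] sig_integrable[of k] by (simp add: gap_mean_def sig_mean_def)
  moreover have "?r = (1 - \<eta>) * (dist_mean k + 4 / p * \<gamma>\<^sup>2 * sig_mean k)
      - \<gamma> / 2 * gap_mean k + 3 * L * \<gamma> * em_mean k"
    using i1 i2 gap_integrable[of k] sig_integrable[of k]
    by (simp add: gap_mean_def sig_mean_def em_mean_def dist_mean_def y_def)
  ultimately show ?thesis using d s by linarith
qed


section \<open>The weighted error and the convergence rate\<close>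

lemma stepsize_error: "\<gamma> * L \<le> \<delta> / 10"
proof (rule power2_le_imp_le)
  have "(\<gamma> * L)\<^sup>2 * 384 \<le> \<gamma>\<^sup>2 * L\<^sup>2 * (192 * (2 + 9 * \<delta>))"
    using \<delta> unfolding power_mult_distrib by (intro mult_left_mono) auto
  also have "\<dots> \<le> \<delta>\<^sup>2" by (rule \<gamma>(3))
  finally have "(\<gamma> * L)\<^sup>2 * 100 \<le> \<delta>\<^sup>2" using zero_le_power2[of "\<gamma> * L"] by linarith
  then show "(\<gamma> * L)\<^sup>2 \<le> (\<delta> / 10)\<^sup>2" by (simp add: power_divide)
qed (use \<delta> in simp)

lemma \<mu>_le_L: "\<mu> \<le> L"
  using qsc by (rule quasi_strong_convexity_le_smoothness)

lemma sig0: "\<omega> \<in> space M \<Longrightarrow> sig 0 \<omega> = \<sigma>2 w0"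
  unfolding sigma_sq_avg by (intro avg_cong) (simp add: run0)

lemma sig_mean_0: "sig_mean 0 = \<sigma>2 w0"
proof -
  have "sig_mean 0 = (\<integral>\<omega>. \<sigma>2 w0 \<partial>M)"
    unfolding sig_mean_def by (intro Bochner_Integration.integral_cong refl sig0)
  then show ?thesis by (simp add: prob_space)
qed

lemma em0: "\<omega> \<in> space M \<Longrightarrow> em 0 \<omega> = 0"
  using avg_cong[of n "\<lambda>i. e 0 i \<omega>" "\<lambda>_. 0"] n by (simp add: run0)

lemma dist_mean_0: "dist_mean 0 = (norm (x0 - xs))\<^sup>2"
proof -
  have "dist_mean 0 = (\<integral>\<omega>. (norm (x0 - xs))\<^sup>2 \<partial>M)"
    unfolding dist_mean_def by (intro Bochner_Integration.integral_cong refl) (simp add: run0 em0)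
  then show ?thesis by (simp add: prob_space)
qed

lemma err_mean_0: "err_mean 0 = 0"
proof -
  have "(\<integral>\<omega>. (norm (e 0 i \<omega>))\<^sup>2 \<partial>M) = (\<integral>\<omega>. 0 \<partial>M)" if "i \<in> {1..n}" for i
    using that by (intro Bochner_Integration.integral_cong refl) (simp add: run0)
  then have "err_mean 0 = avg n (\<lambda>i. 0)" unfolding err_mean_def by (intro avg_cong) simp
  then show ?thesis using n by simp
qed

text \<open>The recursion for \<open>\<sigma>\<^sup>2\<close> is summed first and inserted into the sum of the recursion for the
  error. Since \<open>\<eta> \<le> \<delta>/10\<close> the latter has an effective contraction gap of \<open>2\<delta>/5\<close>, which gives
  \<open>45/4 \<le> 12\<close> in front of \<open>heterogeneity\<close>; the third bound on the step size makes the coefficient of the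
  function values at most \<open>1/4\<close>.\<close>

lemma weighted_error:
  assumes \<eta>: "\<eta> \<le> \<gamma> * \<mu> / 2" "\<eta> \<le> p / 4"
  shows "3 * L * (\<Sum>k=0..K. weight \<eta> k * em_mean k)
    \<le> 1 / 4 * (\<Sum>k=0..K. weight \<eta> k * gap_mean k)
      + 20 * L * \<gamma>\<^sup>2 / (\<delta> * p) * \<sigma>2 w0 + 12 * L * \<gamma>\<^sup>2 / \<delta>\<^sup>2 * heterogeneity * weight_sum \<eta> K"
proof -
  have \<eta>1: "\<eta> < 1" using \<eta>(2) p by simp
  define Sg where "Sg = (\<Sum>k=0..K. weight \<eta> k * gap_mean k)"
  define Ss where "Ss = (\<Sum>k=0..K. weight \<eta> k * sig_mean k)"
  define Se where "Se = (\<Sum>k=0..K. weight \<eta> k * err_mean k)"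
  define W where "W = weight_sum \<eta> K"
  define s0 where "s0 = \<sigma>2 w0"
  have nn: "0 \<le> Sg" "0 \<le> Ss" "0 \<le> Se" "0 \<le> W"
    unfolding Sg_def Ss_def Se_def W_def
    by (intro sum_nonneg mult_nonneg_nonneg means_nonneg less_imp_le[OF weight_pos[OF \<eta>1]]
        less_imp_le[OF weight_sum_pos[OF \<eta>1]])+
  have sigma: "Ss \<le> 4 / (3 * p) * s0 + 8 * L / 3 * Sg"
  proof -
    have "(p - \<eta>) * Ss \<le> s0 + (\<Sum>k=0..K. weight \<eta> k * (p * (2 * L * gap_mean k)))"
      unfolding Ss_def s0_def sig_mean_0[symmetric]
      by (rule weighted_sum_recursion) (rule sig_mean_Suc means_nonneg \<eta>1)+
    also have "(\<Sum>k=0..K. weight \<eta> k * (p * (2 * L * gap_mean k))) = 2 * L * p * Sg"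
      by (simp add: Sg_def sum_distrib_left mult_ac)
    finally have "(p - \<eta>) * Ss \<le> s0 + 2 * L * p * Sg" .
    moreover have "3 / 4 * p * Ss \<le> (p - \<eta>) * Ss"
      using \<eta>(2) nn(2) by (intro mult_right_mono) auto
    ultimately have "3 / 4 * p * Ss \<le> s0 + 2 * L * p * Sg" by linarith
    then show ?thesis using p by (simp add: field_simps)
  qed
  have "(\<delta> / 2 - \<eta>) * Se \<le> err_mean 0 + (\<Sum>k=0..K. weight \<eta> k *
      (\<gamma>\<^sup>2 * ((2 / \<delta>) * (6 * L * gap_mean k + 3 / 4 * heterogeneity) + 4 * L * gap_mean k + 2 * sig_mean k)))"
    unfolding Se_def by (rule weighted_sum_recursion) (rule err_mean_Suc means_nonneg \<eta>1)+
  also have "\<dots> = \<gamma>\<^sup>2 * ((2 / \<delta>) * (6 * L * Sg + 3 / 4 * heterogeneity * W) + 4 * L * Sg + 2 * Ss)"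
    unfolding err_mean_0 Sg_def Ss_def W_def weight_sum_def
    by (simp add: sum_distrib_left sum.distrib distrib_left mult_ac)
  finally have "(\<delta> / 2 - \<eta>) * Se
      \<le> \<gamma>\<^sup>2 * ((2 / \<delta>) * (6 * L * Sg + 3 / 4 * heterogeneity * W) + 4 * L * Sg + 2 * Ss)" .
  moreover have "2 / 5 * \<delta> * Se \<le> (\<delta> / 2 - \<eta>) * Se"
  proof (intro mult_right_mono nn)
    have "\<gamma> * \<mu> \<le> \<gamma> * L" using \<gamma> by (intro mult_left_mono \<mu>_le_L) auto
    then show "2 / 5 * \<delta> \<le> \<delta> / 2 - \<eta>" using \<eta>(1) stepsize_error \<delta> by simp
  qed
  moreover have "\<gamma>\<^sup>2 * ((2 / \<delta>) * (6 * L * Sg + 3 / 4 * heterogeneity * W) + 4 * L * Sg + 2 * Ss)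
      \<le> \<gamma>\<^sup>2 * ((2 / \<delta>) * (6 * L * Sg + 3 / 4 * heterogeneity * W) + 4 * L * Sg
        + 2 * (4 / (3 * p) * s0 + 8 * L / 3 * Sg))"
    using sigma by (intro mult_left_mono add_left_mono) auto
  ultimately have "2 / 5 * \<delta> * Se \<le> \<gamma>\<^sup>2 * ((2 / \<delta>) * (6 * L * Sg + 3 / 4 * heterogeneity * W) + 4 * L * Sg
        + 2 * (4 / (3 * p) * s0 + 8 * L / 3 * Sg))" by linarith
  then have "15 / 2 * L / \<delta> * (2 / 5 * \<delta> * Se)
      \<le> 15 / 2 * L / \<delta> * (\<gamma>\<^sup>2 * ((2 / \<delta>) * (6 * L * Sg + 3 / 4 * heterogeneity * W) + 4 * L * Sg
        + 2 * (4 / (3 * p) * s0 + 8 * L / 3 * Sg)))"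
    using L \<delta> by (intro mult_left_mono) auto
  also have "15 / 2 * L / \<delta> * (2 / 5 * \<delta> * Se) = 3 * L * Se" using \<delta> by simp
  also have "15 / 2 * L / \<delta> * (\<gamma>\<^sup>2 * ((2 / \<delta>) * (6 * L * Sg + 3 / 4 * heterogeneity * W) + 4 * L * Sg
        + 2 * (4 / (3 * p) * s0 + 8 * L / 3 * Sg)))
      = \<gamma>\<^sup>2 * L\<^sup>2 * (90 + 70 * \<delta>) / \<delta>\<^sup>2 * Sg + 20 * L * \<gamma>\<^sup>2 / (\<delta> * p) * s0
        + 45 / 4 * L * \<gamma>\<^sup>2 / \<delta>\<^sup>2 * (heterogeneity * W)"
    using \<delta> p by (simp add: field_simps power2_eq_square)
  also have "\<dots> \<le> 1 / 4 * Sg + 20 * L * \<gamma>\<^sup>2 / (\<delta> * p) * s0 + 12 * L * \<gamma>\<^sup>2 / \<delta>\<^sup>2 * (heterogeneity * W)"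
  proof (intro add_mono order_refl mult_right_mono nn divide_right_mono mult_nonneg_nonneg heterogeneity_nonneg)
    have "\<gamma>\<^sup>2 * L\<^sup>2 * (4 * (90 + 70 * \<delta>)) \<le> \<gamma>\<^sup>2 * L\<^sup>2 * (192 * (2 + 9 * \<delta>))"
      using \<delta> by (intro mult_left_mono) auto
    also have "\<dots> \<le> \<delta>\<^sup>2" by (rule \<gamma>(3))
    finally show "\<gamma>\<^sup>2 * L\<^sup>2 * (90 + 70 * \<delta>) / \<delta>\<^sup>2 \<le> 1 / 4"
      using \<delta> by (simp add: field_simps)
  qed (use L in auto)
  finally have "3 * L * Se \<le> 1 / 4 * Sg + 20 * L * \<gamma>\<^sup>2 / (\<delta> * p) * s0 + 12 * L * \<gamma>\<^sup>2 / \<delta>\<^sup>2 * (heterogeneity * W)" .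
  moreover have "3 * L * (\<Sum>k=0..K. weight \<eta> k * em_mean k) \<le> 3 * L * Se"
    unfolding Se_def using L weight_pos[OF \<eta>1]
    by (intro mult_left_mono sum_mono em_le_err) (auto intro: less_imp_le)
  ultimately show ?thesis by (simp add: Sg_def W_def s0_def)
qed

text \<open>The Lyapunov function contracts exactly at the rate \<open>\<eta>\<close> of the weights, so its weighted sum
  telescopes. The error bound then eats half of the gain \<open>\<gamma>/2\<close> in the function gap.\<close>

lemma weighted_gap:
  assumes \<eta>: "\<eta> \<le> \<gamma> * \<mu> / 2" "\<eta> \<le> p / 4"
    and error: "3 * L * (\<Sum>k=0..K. weight \<eta> k * em_mean k)
      \<le> 1 / 4 * (\<Sum>k=0..K. weight \<eta> k * gap_mean k) + B"
  shows "(\<Sum>k=0..K. weight \<eta> k * gap_mean k)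
    \<le> 4 * ((norm (x0 - xs))\<^sup>2 + 4 / p * \<gamma>\<^sup>2 * \<sigma>2 w0 + \<gamma> * B) / \<gamma>"
proof -
  have \<eta>1: "\<eta> < 1" using \<eta>(2) p by simp
  define Sg where "Sg = (\<Sum>k=0..K. weight \<eta> k * gap_mean k)"
  define V where "V k = dist_mean k + 4 / p * \<gamma>\<^sup>2 * sig_mean k" for k
  have V: "0 \<le> V k" for k
    unfolding V_def using means_nonneg p by (intro add_nonneg_nonneg mult_nonneg_nonneg) auto
  have "(\<eta> - \<eta>) * (\<Sum>k=0..K. weight \<eta> k * V k)
      \<le> V 0 + (\<Sum>k=0..K. weight \<eta> k * (3 * L * \<gamma> * em_mean k - \<gamma> / 2 * gap_mean k))"
    using lyapunov_mean_Suc[OF \<eta>] unfolding V_def[symmetric]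
    by (rule weighted_sum_recursion) (auto simp: V \<eta>1)
  also have "\<dots> = V 0 + \<gamma> * (3 * L * (\<Sum>k=0..K. weight \<eta> k * em_mean k)) - \<gamma> / 2 * Sg"
    by (simp add: Sg_def right_diff_distrib sum_subtractf sum_distrib_left mult_ac)
  also have "\<dots> \<le> V 0 + \<gamma> * (1 / 4 * Sg + B) - \<gamma> / 2 * Sg"
    using mult_left_mono[OF error, of \<gamma>] \<gamma> by (simp add: Sg_def)
  finally have "\<gamma> / 4 * Sg \<le> V 0 + \<gamma> * B" by (simp add: algebra_simps)
  then have "Sg \<le> 4 * (V 0 + \<gamma> * B) / \<gamma>" using \<gamma> by (simp add: field_simps)
  then show ?thesis by (simp add: Sg_def V_def dist_mean_0 sig_mean_0)
qed

lemma weighted_avg_gap: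
  assumes \<eta>: "\<eta> < 1"
  shows "integrable M (\<lambda>\<omega>. gap (weighted_avg \<eta> (\<lambda>k. x k \<omega>) K))"
    and "(\<integral>\<omega>. gap (weighted_avg \<eta> (\<lambda>k. x k \<omega>) K) \<partial>M)
      \<le> (\<Sum>k=0..K. weight \<eta> k * gap_mean k) / weight_sum \<eta> K"
proof -
  define W where "W = weight_sum \<eta> K"
  have W: "0 < W" unfolding W_def by (rule weight_sum_pos[OF \<eta>])
  have sum1: "(\<Sum>k=0..K. weight \<eta> k / W) = 1"
    using W by (simp add: W_def weight_sum_def sum_divide_distrib[symmetric])
  let ?X = "\<lambda>\<omega>. weighted_avg \<eta> (\<lambda>k. x k \<omega>) K"
  have X: "?X \<omega> = (\<Sum>k=0..K. (weight \<eta> k / W) *\<^sub>R x k \<omega>)" for \<omega>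
    by (simp add: weighted_avg_def W_def scaleR_sum_right)
  have le: "gap (?X \<omega>) \<le> (\<Sum>k=0..K. weight \<eta> k * gap (x k \<omega>)) / W" for \<omega>
  proof -
    have "f (?X \<omega>) \<le> (\<Sum>k=0..K. weight \<eta> k / W * f (x k \<omega>))"
      unfolding X using W weight_pos[OF \<eta>]
      by (intro convex_on_sum[OF _ _ convex_f sum1]) (auto intro!: divide_nonneg_pos less_imp_le)
    moreover have "(\<Sum>k=0..K. weight \<eta> k / W * gap (x k \<omega>))
        = (\<Sum>k=0..K. weight \<eta> k / W * f (x k \<omega>)) - (\<Sum>k=0..K. weight \<eta> k / W) * f xs"
      by (simp add: right_diff_distrib sum_subtractf sum_distrib_right)
    ultimately show ?thesis by (simp add: sum1 sum_divide_distrib)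
  qed
  have int: "integrable M (\<lambda>\<omega>. (\<Sum>k=0..K. weight \<eta> k * gap (x k \<omega>)) / W)"
    by (intro integrable_divide Bochner_Integration.integrable_sum integrable_mult_right gap_integrable)
  have Xm: "?X \<in> borel_measurable M"
    unfolding X using measurable_F[OF x_regular(1)] by measurable
  have meas: "(\<lambda>\<omega>. gap (?X \<omega>)) \<in> borel_measurable M"
    using measurable_compose[OF Xm borel_measurable_continuous_onI[OF continuous_f]] by simp
  show *: "integrable M (\<lambda>\<omega>. gap (?X \<omega>))"
    using le gap_nonneg
    by (intro Bochner_Integration.integrable_bound[OF int meas] AE_I2)
      (auto simp del: abs_divide intro: order_trans[OF le abs_ge_self])
  have "(\<integral>\<omega>. gap (?X \<omega>) \<partial>M) \<le> (\<integral>\<omega>. (\<Sum>k=0..K. weight \<eta> k * gap (x k \<omega>)) / W \<partial>M)"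
    by (rule integral_mono[OF * int le])
  also have "\<dots> = (\<Sum>k=0..K. weight \<eta> k * gap_mean k) / W"
    using gap_integrable by (simp add: gap_mean_def Bochner_Integration.integral_sum)
  finally show "(\<integral>\<omega>. gap (?X \<omega>) \<partial>M) \<le> (\<Sum>k=0..K. weight \<eta> k * gap_mean k) / weight_sum \<eta> K"
    by (simp add: W_def)
qed

text \<open>The factor \<open>c\<close> stands for any upper bound of \<open>1/W\<^sub>K\<close>: \<open>(1 - \<eta>)\<^sup>K\<close> in the strongly convex case and
  \<open>1/K\<close> in the case \<open>\<mu> = 0\<close>, where all weights are \<open>1\<close>.\<close>

lemma convergence:
  assumes \<eta>: "\<eta> \<le> \<gamma> * \<mu> / 2" "\<eta> \<le> p / 4"
    and F2: "20 * L * \<gamma>\<^sup>2 / (\<delta> * p) \<le> F2"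
    and T: "T = (norm (x0 - xs))\<^sup>2 + 4 / p * \<gamma>\<^sup>2 * \<sigma>2 w0"
    and c: "1 \<le> c * weight_sum \<eta> K"
  shows "(\<integral>\<omega>. gap (weighted_avg \<eta> (\<lambda>k. x k \<omega>) K) \<partial>M)
    \<le> c * (4 * (T + \<gamma> * F2 * \<sigma>2 w0) / \<gamma>) + 48 * L * \<gamma>\<^sup>2 / \<delta>\<^sup>2 * heterogeneity"
proof -
  have \<eta>1: "\<eta> < 1" using \<eta>(2) p by simp
  define W where "W = weight_sum \<eta> K"
  have W: "0 < W" unfolding W_def by (rule weight_sum_pos[OF \<eta>1])
  define B where "B = F2 * \<sigma>2 w0 + 12 * L * \<gamma>\<^sup>2 / \<delta>\<^sup>2 * heterogeneity * W"
  have F20: "0 \<le> F2" using F2 L \<delta> p by (intro order_trans[OF _ F2]) simp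
  have "3 * L * (\<Sum>k=0..K. weight \<eta> k * em_mean k) \<le> 1 / 4 * (\<Sum>k=0..K. weight \<eta> k * gap_mean k) + B"
    using weighted_error[OF \<eta>, of K] mult_right_mono[OF F2 sigma_sq_nonneg[of w0]]
    by (simp add: B_def W_def)
  then have S: "(\<Sum>k=0..K. weight \<eta> k * gap_mean k) \<le> 4 * (T + \<gamma> * B) / \<gamma>"
    unfolding T by (rule weighted_gap[OF \<eta>])
  have "(\<integral>\<omega>. gap (weighted_avg \<eta> (\<lambda>k. x k \<omega>) K) \<partial>M) \<le> (\<Sum>k=0..K. weight \<eta> k * gap_mean k) / W"
    unfolding W_def by (rule weighted_avg_gap(2)[OF \<eta>1])
  also have "\<dots> \<le> 4 * (T + \<gamma> * B) / \<gamma> / W" using S W by (intro divide_right_mono) auto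
  also have "\<dots> = (1 / W) * (4 * (T + \<gamma> * F2 * \<sigma>2 w0) / \<gamma>) + 48 * L * \<gamma>\<^sup>2 / \<delta>\<^sup>2 * heterogeneity"
    using W \<gamma>(1) by (simp add: B_def field_simps)
  also have "\<dots> \<le> c * (4 * (T + \<gamma> * F2 * \<sigma>2 w0) / \<gamma>) + 48 * L * \<gamma>\<^sup>2 / \<delta>\<^sup>2 * heterogeneity"
  proof (intro add_right_mono mult_right_mono)
    show "1 / W \<le> c" using c W by (simp add: W_def field_simps)
    show "0 \<le> 4 * (T + \<gamma> * F2 * \<sigma>2 w0) / \<gamma>"
      unfolding T using \<gamma> p F20 sigma_sq_nonneg[of w0] by simp
  qed
  finally show ?thesis .
qed

end

lemma weight_sum_ge:
  assumes "0 \<le> \<eta>" "\<eta> < 1"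
  shows "1 \<le> (1 - \<eta>) ^ K * weight_sum \<eta> K"
proof -
  have "1 \<le> (1 - \<eta>) ^ K * weight \<eta> K"
    using assms by (simp add: weight_def)
  also have "weight \<eta> K \<le> weight_sum \<eta> K"
    unfolding weight_sum_def using weight_pos[OF assms(2)]
    by (intro member_le_sum) (auto intro: less_imp_le)
  finally show ?thesis using assms by (simp add: mult_left_mono)
qed

theorem theoremJ6:
  fixes n m :: nat
    and fs :: "nat \<Rightarrow> nat \<Rightarrow> 'a::euclidean_space \<Rightarrow> real"
    and xs x0 :: 'a and w0 :: "nat \<Rightarrow> 'a"
    and \<mu> L \<delta> p \<gamma> :: real
    and M :: "'w measure" and S :: "'s measure" and C :: "'s \<Rightarrow> 'a \<Rightarrow> 'a"
    and Z :: "nat \<Rightarrow> nat \<Rightarrow> 'w \<Rightarrow> nat \<times> 's \<times> bool"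
    and x :: "nat \<Rightarrow> 'w \<Rightarrow> 'a"
    and w e g v :: "nat \<Rightarrow> nat \<Rightarrow> 'w \<Rightarrow> 'a"
    and f :: "'a \<Rightarrow> real" and D1 \<sigma>0_sq F2 M2 T0 :: real and c :: ec_constants
  defines "f \<equiv> f_glob n m fs"
    and "D1 \<equiv> 2 / real n * (\<Sum>i=1..n. (norm (grad (f_loc m fs i) xs))\<^sup>2)"
    and "\<sigma>0_sq \<equiv> sigma_sq n m fs xs w0"
    and "F2 \<equiv> 72 * L * \<gamma>\<^sup>2 / (\<delta> * p * (1 - min (\<gamma> * \<mu> / 2) (p / 4)))"
    and "M2 \<equiv> 4 / p"
    and "T0 \<equiv> (norm (x0 - xs))\<^sup>2 + M2 * \<gamma>\<^sup>2 * \<sigma>0_sq"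
    and "c \<equiv> \<lparr> cA = 2 * L, cAt = 12 * L, cAp = 2 * L,
               cB1 = 0, cB1t = 0, cB1p = 0,
               cB2 = 0, cB2t = 3, cB2p = 2,
               cC1 = 0, cC2 = L * p,
               cD1 = D1, cD1t = 0, cD1p = 0,
               cD2 = 0, cD3 = 12 * L * \<gamma> / \<delta>\<^sup>2 * D1,
               cF1 = 0, cF2 = F2,
               cG = 0,
               rho1 = 1, rho2 = p \<rparr>"
  assumes "n \<ge> 1" and "m \<ge> 1"
    and "\<mu> \<ge> 0" and "quasi_strongly_convex \<mu> f xs"
    and "\<And>i j. i \<in> {1..n} \<Longrightarrow> j \<in> {1..m} \<Longrightarrow> convex_on UNIV (fs i j) \<and> L_smooth L (fs i j)"
    and "compression_operator S \<delta> C"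
    and "0 < p" and "p < 1"
    and "0 < \<gamma>"
    and "\<gamma> \<le> min (1 / (24 * L)) (\<delta> / (8 * L * sqrt (3 * (2 + 3 * \<delta> * (2 + 1 / (1 - p))))))"
    and "fresh_draws M S n m p Z"
    and "ec_lsvrg M n m fs C \<gamma> x0 w0 Z x w e g v"
  shows "parametric_assumption M (history M S n m p Z) n f xs L \<mu> \<gamma> x g e
           (\<lambda>k \<omega>. 0) (\<lambda>k \<omega>. sigma_sq n m fs xs (\<lambda>i. w k i \<omega>)) c \<and>
         (\<forall>K. integrable M (\<lambda>\<omega>. f (weighted_avg (rate \<gamma> \<mu> c) (\<lambda>k. x k \<omega>) K) - f xs)) \<and>
         (\<mu> > 0 \<longrightarrow> (\<forall>K.
            (\<integral>\<omega>. f (weighted_avg (rate \<gamma> \<mu> c) (\<lambda>k. x k \<omega>) K) - f xs \<partial>M)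
              \<le> (1 - min (\<gamma> * \<mu> / 2) (p / 4)) ^ K * (4 * (T0 + \<gamma> * F2 * \<sigma>0_sq) / \<gamma>)
                 + 48 * L * \<gamma>\<^sup>2 / \<delta>\<^sup>2 * D1)) \<and>
         (\<mu> = 0 \<longrightarrow> (\<forall>K\<ge>1.
            (\<integral>\<omega>. f (weighted_avg (rate \<gamma> \<mu> c) (\<lambda>k. x k \<omega>) K) - f xs \<partial>M)
              \<le> 4 * (T0 + \<gamma> * F2 * \<sigma>0_sq) / (\<gamma> * real K)
                 + 48 * L * \<gamma>\<^sup>2 / \<delta>\<^sup>2 * D1))"
proof -
  have \<gamma>24: "\<gamma> \<le> 1 / (24 * L)"
    and \<gamma>8: "\<gamma> \<le> \<delta> / (8 * L * sqrt (3 * (2 + 3 * \<delta> * (2 + 1 / (1 - p)))))"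
    using \<open>\<gamma> \<le> min _ _\<close> by auto
  have \<delta>: "0 < \<delta>" using \<open>compression_operator S \<delta> C\<close> by (simp add: compression_operator_def)
  \<comment> \<open>For \<open>L = 0\<close> the quotient \<open>1 / (24 * L)\<close> is \<open>0\<close>, so \<open>0 < \<gamma>\<close> excludes this case as well.\<close>
  have L: "0 < L"
  proof (rule ccontr)
    assume "\<not> 0 < L"
    then have "1 / (24 * L) \<le> 0" by (simp add: divide_nonneg_nonpos)
    with \<gamma>24 \<open>0 < \<gamma>\<close> show False by linarith
  qed
  have step: "\<gamma>\<^sup>2 * L\<^sup>2 * (192 * (2 + 9 * \<delta>)) \<le> \<delta>\<^sup>2"
  proof -
    define r where "r = 3 * (2 + 3 * \<delta> * (2 + 1 / (1 - p)))"
    have "1 \<le> 1 / (1 - p)" using \<open>0 < p\<close> \<open>p < 1\<close> by simp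
    then have "3 * \<delta> * 3 \<le> 3 * \<delta> * (2 + 1 / (1 - p))" using \<delta> by (intro mult_left_mono) auto
    then have r: "3 * (2 + 9 * \<delta>) \<le> r" by (simp add: r_def)
    then have r0: "0 < r" using \<delta> by simp
    have "\<gamma> * (8 * L * sqrt r) \<le> \<delta>"
      using \<gamma>8 L r0 unfolding r_def[symmetric] by (subst (asm) pos_le_divide_eq) auto
    then have "(\<gamma> * (8 * L * sqrt r))\<^sup>2 \<le> \<delta>\<^sup>2"
      using \<open>0 < \<gamma>\<close> L r0 by (intro power_mono) auto
    then have "\<gamma>\<^sup>2 * L\<^sup>2 * (64 * r) \<le> \<delta>\<^sup>2"
      using r0 by (simp add: power_mult_distrib mult_ac)
    moreover have "\<gamma>\<^sup>2 * L\<^sup>2 * (192 * (2 + 9 * \<delta>)) \<le> \<gamma>\<^sup>2 * L\<^sup>2 * (64 * r)"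
      using r by (intro mult_left_mono) auto
    ultimately show ?thesis by linarith
  qed
  have qsc: "f x - f xs + \<mu> / 2 * (norm (x - xs))\<^sup>2 \<le> inner (grad f x) (x - xs)" for x
    using \<open>quasi_strongly_convex \<mu> f xs\<close>
    by (simp add: quasi_strongly_convex_def inner_diff_right) (smt (verit))
  interpret ec_lsvrg_process n m fs xs L \<mu> \<delta> p \<gamma> M S C Z x0 w0 x w e g v
  proof unfold_locales
    show "f_glob n m fs xs \<le> f_glob n m fs y" for y
      using \<open>quasi_strongly_convex \<mu> f xs\<close>
      by (simp add: quasi_strongly_convex_def unique_minimizer_def f_def)
    show "f_glob n m fs x - f_glob n m fs xs + \<mu> / 2 * (norm (x - xs))\<^sup>2
        \<le> inner (grad (f_glob n m fs) x) (x - xs)" for x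
      using qsc[of x] by (simp add: f_def)
  qed (use assms L \<gamma>24 step in auto)
  have D1: "D1 = heterogeneity" by (simp add: D1_def heterogeneity_def)
  define \<eta> where "\<eta> = min (\<gamma> * \<mu> / 2) (p / 4)"
  have rate: "rate \<gamma> \<mu> c = \<eta>"
    using \<open>p < 1\<close> by (simp add: rate_def c_def \<eta>_def min_def)
  have \<eta>: "\<eta> \<le> \<gamma> * \<mu> / 2" "\<eta> \<le> p / 4" "0 \<le> \<eta>"
    using \<open>0 < \<gamma>\<close> \<open>0 \<le> \<mu>\<close> \<open>0 < p\<close> by (auto simp: \<eta>_def)
  have \<eta>1: "\<eta> < 1" using \<eta>(2) \<open>p < 1\<close> by simp
  have F2: "20 * L * \<gamma>\<^sup>2 / (\<delta> * p) \<le> F2"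
  proof -
    have "20 * L * \<gamma>\<^sup>2 / (\<delta> * p) \<le> 72 * L * \<gamma>\<^sup>2 / (\<delta> * p)"
      using L \<delta> \<open>0 < p\<close> by (intro divide_right_mono mult_right_mono) auto
    also have "\<dots> \<le> 72 * L * \<gamma>\<^sup>2 / (\<delta> * p * (1 - \<eta>))"
      using L \<delta> \<open>0 < p\<close> \<eta> \<eta>1 by (intro divide_left_mono mult_left_le mult_pos_pos) auto
    finally show ?thesis by (simp add: F2_def \<eta>_def)
  qed
  have T0: "T0 = (norm (x0 - xs))\<^sup>2 + 4 / p * \<gamma>\<^sup>2 * sigma_sq n m fs xs w0"
    by (simp add: T0_def M2_def \<sigma>0_sq_def)
  have bound: "(\<integral>\<omega>. f (weighted_avg (rate \<gamma> \<mu> c) (\<lambda>k. x k \<omega>) K) - f xs \<partial>M)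
      \<le> a * (4 * (T0 + \<gamma> * F2 * \<sigma>0_sq) / \<gamma>) + 48 * L * \<gamma>\<^sup>2 / \<delta>\<^sup>2 * D1"
    if "1 \<le> a * weight_sum \<eta> K" for a K
    using convergence[OF \<eta>(1,2) F2 T0 that] unfolding rate D1 f_def \<sigma>0_sq_def .
  show ?thesis
  proof (intro conjI impI allI)
    show "integrable M (\<lambda>\<omega>. f (weighted_avg (rate \<gamma> \<mu> c) (\<lambda>k. x k \<omega>) K) - f xs)" for K
      unfolding rate f_def by (rule weighted_avg_gap(1)[OF \<eta>1])
    show "(\<integral>\<omega>. f (weighted_avg (rate \<gamma> \<mu> c) (\<lambda>k. x k \<omega>) K) - f xs \<partial>M)
        \<le> (1 - min (\<gamma> * \<mu> / 2) (p / 4)) ^ K * (4 * (T0 + \<gamma> * F2 * \<sigma>0_sq) / \<gamma>)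
          + 48 * L * \<gamma>\<^sup>2 / \<delta>\<^sup>2 * D1" for K
      unfolding \<eta>_def[symmetric] by (intro bound weight_sum_ge \<eta> \<eta>1)
    show "(\<integral>\<omega>. f (weighted_avg (rate \<gamma> \<mu> c) (\<lambda>k. x k \<omega>) K) - f xs \<partial>M)
        \<le> 4 * (T0 + \<gamma> * F2 * \<sigma>0_sq) / (\<gamma> * real K) + 48 * L * \<gamma>\<^sup>2 / \<delta>\<^sup>2 * D1"
      if "\<mu> = 0" "1 \<le> K" for K
    proof -
      have "weight_sum \<eta> K = real K + 1"
        using that \<open>0 < p\<close> by (simp add: \<eta>_def weight_sum_def weight_def)
      then have "1 \<le> 1 / real K * weight_sum \<eta> K" using that by (simp add: field_simps)
      from bound[OF this] show ?thesis by (simp add: mult.commute)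
    qed
    show "parametric_assumption M (history M S n m p Z) n f xs L \<mu> \<gamma> x g e
           (\<lambda>k \<omega>. 0) (\<lambda>k \<omega>. sigma_sq n m fs xs (\<lambda>i. w k i \<omega>)) c"
      unfolding parametric_assumption_def Let_def rate
    proof (intro conjI allI ballI)
      fix k
      show "integrable M (g k i)" if "i \<in> {1..n}" for i
        by (rule integrable_square_integrable[OF g_square_integrable[OF that]])
      show "integrable M (\<lambda>\<omega>. (norm (g k i \<omega> - vec_cond_exp M (F k) (g k i) \<omega>))\<^sup>2)"
        if "i \<in> {1..n}" for i
        by (rule g_centered(1)[OF that])
      show "integrable M (\<lambda>\<omega>. (norm (avg n (\<lambda>i. g k i \<omega>)))\<^sup>2)"
        by (rule square_integrable_norm[OF gm_square_integrable])
      show "integrable M (\<lambda>\<omega>. (norm (avg n (\<lambda>i. e k i \<omega>)))\<^sup>2)"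
        by (rule square_integrable_norm[OF em_square_integrable])
      show "integrable M (\<lambda>\<omega>. f (x k \<omega>) - f xs)"
        unfolding f_def by (rule gap_integrable)
      show "integrable M (\<lambda>\<omega>. sigma_sq n m fs xs (\<lambda>i. w k i \<omega>))"
        by (rule sig_integrable)
      show "integrable M (\<lambda>\<omega>. 0 :: real)" by simp
      show "AE \<omega> in M. vec_cond_exp M (F k) (\<lambda>\<omega>. avg n (\<lambda>i. g k i \<omega>)) \<omega> = grad f (x k \<omega>)"
        unfolding f_def by (rule cond_exp_gm)
      show "AE \<omega> in M. avg n (\<lambda>i. (norm (vec_cond_exp M (F k) (g k i) \<omega>))\<^sup>2)
          \<le> 2 * cA c * (f (x k \<omega>) - f xs) + cB1 c * 0
            + cB2 c * sigma_sq n m fs xs (\<lambda>i. w k i \<omega>) + cD1 c"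
        using mean_gbar_le[of k] by eventually_elim (simp add: c_def f_def D1)
      show "AE \<omega> in M. avg n (\<lambda>i. real_cond_exp M (F k)
            (\<lambda>\<omega>'. (norm (g k i \<omega>' - vec_cond_exp M (F k) (g k i) \<omega>'))\<^sup>2) \<omega>)
          \<le> 2 * cAt c * (f (x k \<omega>) - f xs) + cB1t c * 0
            + cB2t c * sigma_sq n m fs xs (\<lambda>i. w k i \<omega>) + cD1t c"
        using mean_variance_le[of k]
      proof eventually_elim
        case (elim \<omega>)
        have "4 * L * gap (x k \<omega>) \<le> 24 * L * gap (x k \<omega>)"
          using L gap_nonneg[of "x k \<omega>"] by (intro mult_right_mono) auto
        then show ?case
          using elim sigma_sq_nonneg[of "\<lambda>i. w k i \<omega>"] by (simp add: c_def f_def)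
      qed
      show "AE \<omega> in M. real_cond_exp M (F k) (\<lambda>\<omega>'. (norm (avg n (\<lambda>i. g k i \<omega>')))\<^sup>2) \<omega>
          \<le> 2 * cAp c * (f (x k \<omega>) - f xs) + cB1p c * 0
            + cB2p c * sigma_sq n m fs xs (\<lambda>i. w k i \<omega>) + cD1p c"
        using cond_exp_gm_square_le[of k] by eventually_elim (simp add: c_def f_def)
      show "AE \<omega> in M. real_cond_exp M (F k) (\<lambda>\<omega>. 0) \<omega>
          \<le> (1 - rho1 c) * 0 + 2 * cC1 c * (f (x k \<omega>) - f xs)
            + cG c * rho1 c * sigma_sq n m fs xs (\<lambda>i. w k i \<omega>) + cD2 c"
      proof -
        interpret finite_measure_subalgebra M "F k" by (rule cond_exp_subalgebra)
        have "AE \<omega> in M. real_cond_exp M (F k) (\<lambda>\<omega>. 0) \<omega> = 0"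
          by (rule real_cond_exp_F_meas) auto
        then show ?thesis by eventually_elim (simp add: c_def)
      qed
      show "AE \<omega> in M. real_cond_exp M (F k) (\<lambda>\<omega>. sigma_sq n m fs xs (\<lambda>i. w (Suc k) i \<omega>)) \<omega>
          \<le> (1 - rho2 c) * sigma_sq n m fs xs (\<lambda>i. w k i \<omega>) + 2 * cC2 c * (f (x k \<omega>) - f xs)"
        using cond_exp_sig_le[of k] by eventually_elim (simp add: c_def f_def mult_ac)
    next
      fix K
      have "3 * L * (\<Sum>k=0..K. weight \<eta> k * em_mean k)
          \<le> 1 / 4 * (\<Sum>k=0..K. weight \<eta> k * gap_mean k)
            + F2 * sigma_sq n m fs xs w0 + \<gamma> * (12 * L * \<gamma> / \<delta>\<^sup>2 * D1) * weight_sum \<eta> K"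
        using weighted_error[OF \<eta>(1,2), of K] mult_right_mono[OF F2 sigma_sq_nonneg[of w0]]
        by (simp add: D1 power2_eq_square[of \<gamma>] mult_ac)
      then show "AE \<omega> in M.
         3 * L * (\<Sum>k=0..K. weight \<eta> k * (\<integral>\<omega>'. (norm (avg n (\<lambda>i. e k i \<omega>')))\<^sup>2 \<partial>M))
           \<le> 1 / 4 * (\<Sum>k=0..K. weight \<eta> k * (\<integral>\<omega>'. f (x k \<omega>') - f xs \<partial>M))
              + cF1 c * 0 + cF2 c * sigma_sq n m fs xs (\<lambda>i. w 0 i \<omega>)
              + \<gamma> * cD3 c * weight_sum \<eta> K"
        by (intro AE_I2) (simp add: sig0 c_def f_def em_mean_def gap_mean_def)
    qed
  qed
qed

end
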